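(* Let $n\ge 3$ be an integer. Then the burnt pancake graph $BP_n$ is $(n-2)$-hybrid fault Hamiltonian, and $BP_n$ is $(n-3)$-hybrid fault Hamiltonian connected. Furthermore, both bounds are tight: for every $n\ge 3$, $BP_n$ is not $(n-1)$-hybrid fault Hamiltonian, and $BP_n$ is not $(n-2)$-hybrid fault Hamiltonian connected.
   Context: Burnt pancake graph. For a positive integer $n$, write $\bar{i}=-i$ (so $\bar{\bar{i}}=i$) and $[n]=\{1,\dots,n\}\cup\{\bar 1,\dots,\bar n\}$. A signed permutation of $\{1,\dots,n\}$ is a word $u_1u_2\cdots u_n$ with $u_i\in[n]$ such that $|u_1||u_2|\cdots|u_n|$ is a permutation of $\{1,\dots,n\}$. The graph $BP_n$ is the simple undirected graph whose vertices are all the $2^n\, n!$ signed permutations of $\{1,\dots,n\}$, where $u=u_1\cdots u_n$ is adjacent to exactly the $n$ vertices $k(u)=\bar u_k\bar u_{k-1}\cdots\bar u_1u_{k+1}\cdots u_n$ for $1\le k\le n$. Hybrid faults. In a graph $G$, a hybrid fault set is $F=F^{mv}\cup F^e$, where $F^{mv}=\{\{a_i,b_i\}: (a_i,b_i)\in M\}$ is the set of pairs of end-vertices of the edges of some (possibly empty) matching $M$ of $G$, and $F^e$ is a (possibly empty) set of edges of $G-F^{mv}$. Here $G-F^{mv}$ is the graph obtained from $G$ by deleting all the vertices belonging to the pairs in $F^{mv}$, and $G-F=G-F^{mv}-F^e$ is obtained from $G-F^{mv}$ by further deleting the edges in $F^e$. Put $|F|=|F^{mv}|+|F^e|$ (each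 pair counts once). For an integer $k\ge 0$, $G$ is $k$-hybrid fault Hamiltonian if $G-F$ has a Hamiltonian cycle for every hybrid fault set $F$ with $|F|\le k$; $G$ is $k$-hybrid fault Hamiltonian connected if for every hybrid fault set $F$ with $|F|\le k$, the graph $G-F$ is Hamiltonian connected, i.e. for any two distinct vertices of $G-F$ there is a Hamiltonian path of $G-F$ between them. *)

theory Defs
  imports "HOL-Combinatorics.Multiset_Permutations"
begin

record 'a ugraph =
  verts :: "'a set"
  edges :: "'a set set"

definition simple_graph :: "'a ugraph \<Rightarrow> bool" where
  "simple_graph G \<longleftrightarrow> (\<forall>e \<in> edges G. e \<subseteq> verts G \<and> card e = 2)"

definition delete_verts :: "'a ugraph \<Rightarrow> 'a set \<Rightarrow> 'a ugraph" where
  "delete_verts G W = \<lparr>verts = verts G - W, edges = {e \<in> edges G. e \<inter> W = {}}\<rparr>"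

definition delete_edges :: "'a ugraph \<Rightarrow> 'a set set \<Rightarrow> 'a ugraph" where
  "delete_edges G D = \<lparr>verts = verts G, edges = edges G - D\<rparr>"

definition is_matching :: "'a ugraph \<Rightarrow> 'a set set \<Rightarrow> bool" where
  "is_matching G M \<longleftrightarrow> M \<subseteq> edges G \<and> pairwise disjnt M"

definition hamiltonian_cycle :: "'a ugraph \<Rightarrow> 'a list \<Rightarrow> bool" where
  "hamiltonian_cycle G xs \<longleftrightarrow>
     3 \<le> length xs \<and> distinct xs \<and> set xs = verts G \<and>
     successively (\<lambda>x y. {x, y} \<in> edges G) xs \<and> {last xs, hd xs} \<in> edges G"

definition hamiltonian_path :: "'a ugraph \<Rightarrow> 'a \<Rightarrow> 'a list \<Rightarrow> 'a \<Rightarrow> bool" where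
  "hamiltonian_path G u xs v \<longleftrightarrow>
     xs \<noteq> [] \<and> hd xs = u \<and> last xs = v \<and> distinct xs \<and> set xs = verts G \<and>
     successively (\<lambda>x y. {x, y} \<in> edges G) xs"

definition hamiltonian_connected :: "'a ugraph \<Rightarrow> bool" where
  "hamiltonian_connected G \<longleftrightarrow>
     (\<forall>u \<in> verts G. \<forall>v \<in> verts G. u \<noteq> v \<longrightarrow> (\<exists>xs. hamiltonian_path G u xs v))"

text \<open>
  A hybrid fault set is kept as the pair of its two parts, the set \<open>M\<close> of deleted pairs of matched
  vertices and the set \<open>D\<close> of deleted edges: an edge is itself a pair of vertices, so the
  union of the two parts would not tell whether the pair or only the edge fails. As
  \<^const>\<open>card\<close> is 0 on infinite sets, finiteness is required explicitly.
\<close>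

definition hybrid_fault_set :: "'a ugraph \<Rightarrow> 'a set set \<Rightarrow> 'a set set \<Rightarrow> bool" where
  "hybrid_fault_set G M D \<longleftrightarrow>
     is_matching G M \<and> finite M \<and> D \<subseteq> edges (delete_verts G (\<Union>M)) \<and> finite D"

definition remove_faults :: "'a ugraph \<Rightarrow> 'a set set \<Rightarrow> 'a set set \<Rightarrow> 'a ugraph" where
  "remove_faults G M D = delete_edges (delete_verts G (\<Union>M)) D"

definition hybrid_fault_hamiltonian :: "nat \<Rightarrow> 'a ugraph \<Rightarrow> bool" where
  "hybrid_fault_hamiltonian k G \<longleftrightarrow>
     (\<forall>M D. hybrid_fault_set G M D \<and> card M + card D \<le> k \<longrightarrow>
        (\<exists>xs. hamiltonian_cycle (remove_faults G M D) xs))"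

definition hybrid_fault_hamiltonian_connected :: "nat \<Rightarrow> 'a ugraph \<Rightarrow> bool" where
  "hybrid_fault_hamiltonian_connected k G \<longleftrightarrow>
     (\<forall>M D. hybrid_fault_set G M D \<and> card M + card D \<le> k \<longrightarrow>
        hamiltonian_connected (remove_faults G M D))"

definition signed_perms :: "nat \<Rightarrow> int list set" where
  "signed_perms n = {u. map abs u \<in> permutations_of_set {1..int n}}"

definition signed_prefix_reversal :: "nat \<Rightarrow> int list \<Rightarrow> int list" where
  "signed_prefix_reversal k u = map uminus (rev (take k u)) @ drop k u"

definition burnt_pancake_graph :: "nat \<Rightarrow> int list ugraph" where
  "burnt_pancake_graph n =
     \<lparr>verts = signed_perms n,
      edges = {{u, signed_prefix_reversal k u} | u k. u \<in> signed_perms n \<and> k \<in> {1..n}}\<rparr>"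

lemma length_signed_perms: "u \<in> signed_perms n \<Longrightarrow> length u = n"
  unfolding signed_perms_def
  using length_finite_permutations_of_set[of "map abs u" "{1..int n}"] by simp

lemma signed_prefix_reversal_in_signed_perms:
  assumes "u \<in> signed_perms n"
  shows "signed_prefix_reversal k u \<in> signed_perms n"
proof -
  have "map abs (signed_prefix_reversal k u) = rev (take k (map abs u)) @ drop k (map abs u)"
    by (simp add: signed_prefix_reversal_def take_map drop_map rev_map)
  moreover have "mset (rev (take k (map abs u)) @ drop k (map abs u)) = mset (map abs u)"
    by (metis append_take_drop_id mset_append mset_rev)
  ultimately have "mset (map abs (signed_prefix_reversal k u)) = mset (map abs u)"
    by simp
  from mset_eq_setD[OF this] mset_eq_imp_distinct_iff[OF this] assms show ?thesis
    by (simp only: signed_perms_def permutations_of_set_def mem_Collect_eq)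
qed

lemma signed_prefix_reversal_involutive:
  assumes "k \<le> length u"
  shows "signed_prefix_reversal k (signed_prefix_reversal k u) = u"
  using assms by (simp add: signed_prefix_reversal_def rev_map o_def)

lemma signed_prefix_reversal_neq:
  assumes "u \<in> signed_perms n" and "k \<in> {1..n}"
  shows "signed_prefix_reversal k u \<noteq> u"
proof
  assume eq: "signed_prefix_reversal k u = u"
  have len: "length u = n" using assms(1) by (rule length_signed_perms)
  have "u ! 0 = - (u ! (k - 1))"
    using arg_cong[OF eq, of "\<lambda>v. v ! 0"] assms(2) len
    by (simp add: signed_prefix_reversal_def nth_append rev_nth)
  then have abs_eq: "map abs u ! 0 = map abs u ! (k - 1)"
    using assms(2) len by (subst (1 2) nth_map) auto
  have "distinct (map abs u)" and "set (map abs u) = {1..int n}"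
    using assms(1) by (auto simp: signed_perms_def permutations_of_set_def)
  moreover have "k - 1 < n" and "0 < n" using assms(2) by auto
  ultimately have "k - 1 = 0"
    using abs_eq len nth_eq_iff_index_eq[of "map abs u" 0 "k - 1"] by simp
  with \<open>u ! 0 = - (u ! (k - 1))\<close> have "map abs u ! 0 = 0" using assms(2) len by simp
  moreover have "map abs u ! 0 \<in> set (map abs u)"
    using assms(2) len by (intro nth_mem) simp
  ultimately show False using \<open>set (map abs u) = {1..int n}\<close> by auto
qed

lemma simple_graph_burnt_pancake_graph: "simple_graph (burnt_pancake_graph n)"
proof -
  have "card {u, signed_prefix_reversal k u} = 2"
    if "u \<in> signed_perms n" and "k \<in> {1..n}" for u k
    using signed_prefix_reversal_neq[OF that] by (simp add: card_insert_if)
  then show ?thesis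
    unfolding simple_graph_def burnt_pancake_graph_def
    by (fastforce simp: signed_prefix_reversal_in_signed_perms)
qed

lemma burnt_pancake_graph_adjacent_iff:
  assumes "u \<in> signed_perms n"
  shows "{u, v} \<in> edges (burnt_pancake_graph n) \<longleftrightarrow>
    (\<exists>k \<in> {1..n}. v = signed_prefix_reversal k u)"
proof
  assume "{u, v} \<in> edges (burnt_pancake_graph n)"
  then obtain w k where w: "w \<in> signed_perms n" and k: "k \<in> {1..n}"
    and e: "{u, v} = {w, signed_prefix_reversal k w}"
    by (auto simp: burnt_pancake_graph_def)
  have "signed_prefix_reversal k (signed_prefix_reversal k w) = w"
    using w k by (intro signed_prefix_reversal_involutive) (simp add: length_signed_perms)
  with e have "v = signed_prefix_reversal k u"
    by (auto simp: doubleton_eq_iff)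
  with k show "\<exists>k \<in> {1..n}. v = signed_prefix_reversal k u" by blast
next
  assume "\<exists>k \<in> {1..n}. v = signed_prefix_reversal k u"
  with assms show "{u, v} \<in> edges (burnt_pancake_graph n)"
    unfolding burnt_pancake_graph_def by fastforce
qed

end

theory Submission
  imports Defs
begin

text \<open>
  The signed permutations of \<open>m + 1\<close> symbols fall into \<open>2 (m + 1)\<close> copies of the burnt pancake graph
  on \<open>m\<close> symbols, one for each signed symbol \<open>i\<close> that can stand in the last place. The longest
  reversal is the only one that leaves the copy; it leads from a word with first symbol \<open>h\<close> to the copy
  \<open>- h\<close>. Hence two copies \<open>i\<close> and \<open>j\<close> are joined by exactly
  \<open>2 ^ (m - 1) * (m - 1)!\<close> edges, unless \<open>j = - i\<close>, in which case they are not joined at all.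
  The positive half of the theorem is proved by induction along this decomposition.

  A faulty pair can be torn apart by the decomposition and then leaves one faulty vertex in each of two
  copies. The induction therefore runs on a stronger statement, \<open>fault_tolerant\<close>, in which a fault is
  a vertex, a pair of adjacent vertices, or an edge, each of them at cost one. A copy touched by at
  most \<open>m - 3\<close> faults is then Hamiltonian connected, and a copy touched by at most \<open>m - 2\<close> faults is
  Hamiltonian.

  Hamiltonian connected copies can be strung together in any order in which consecutive copies are
  not antipodal: a fault destroys at most one edge between two given copies
  (\<open>many_free_edges\<close>), and after entering a copy one may leave it anywhere else. As a copy
  avoids only one other copy, a chain of copies whose two ends differ can always be extended and closed
  (\<open>block_merge\<close>, \<open>block_finish\<close>, \<open>block_close\<close>). A path that has to start and to end in
  the same copy is cut open inside this copy, at an edge whose ends lead to suitable other copies;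
  such an edge exists because the vertices that lead to a few forbidden copies are too few to meet every
  edge of a Hamiltonian path (\<open>break_path\<close>). In the same way a copy that is only Hamiltonian
  is inserted into a chain by cutting its cycle (\<open>break_cycle\<close>).

  A copy touched by more faults is Hamiltonian once one of its faults is put back. Taking this fault
  out of the cycle again leaves one or two segments that end in neighbours of the removed
  vertices, and it is known where these ends lead: the neighbours of a word inside its copy lead to
  pairwise different copies (\<open>inner_two\<close>), and the neighbours of the two ends of an edge between two
  copies never lead to the same copy (\<open>inner_across\<close>). This determines how the segments have to be
  connected through the other copies.

  Two copies can be touched by almost all faults only if almost all faults are pairs that join them,
  and three or more such copies occur only for \<open>m \<le> 4\<close>; these configurations are treated one by one.
  The base of the induction, three symbols, consists of explicit walks at one word, and a signed
  renaming of the symbols carries them to every other word.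

  The bounds are sharp because faulty edges may isolate a vertex up to one or two of its neighbours.\<close>

section \<open>Hamiltonian paths and cycles of a relation\<close>

definition hpath :: "('a \<Rightarrow> 'a \<Rightarrow> bool) \<Rightarrow> 'a set \<Rightarrow> 'a \<Rightarrow> 'a \<Rightarrow> bool" where
  "hpath r S x y \<longleftrightarrow> (\<exists>xs. xs \<noteq> [] \<and> hd xs = x \<and> last xs = y \<and> distinct xs \<and> set xs = S
     \<and> successively r xs)"

definition hcycle :: "('a \<Rightarrow> 'a \<Rightarrow> bool) \<Rightarrow> 'a set \<Rightarrow> bool" where
  "hcycle r S \<longleftrightarrow> (\<exists>xs. 3 \<le> length xs \<and> distinct xs \<and> set xs = S
     \<and> successively r xs \<and> r (last xs) (hd xs))"

lemma hpathI:
  assumes "xs \<noteq> []" "hd xs = x" "last xs = y" "distinct xs" "set xs = S" "successively r xs"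
  shows "hpath r S x y"
  using assms unfolding hpath_def by blast

lemma hpathE:
  assumes "hpath r S x y"
  obtains xs where "xs \<noteq> []" "hd xs = x" "last xs = y" "distinct xs" "set xs = S" "successively r xs"
  using assms unfolding hpath_def by blast

lemma hpath_list:
  "xs \<noteq> [] \<Longrightarrow> distinct xs \<Longrightarrow> successively r xs \<Longrightarrow> hpath r (set xs) (hd xs) (last xs)"
  unfolding hpath_def by blast

lemma hpath_single: "hpath r {x} x x"
  by (rule hpathI[of "[x]"]) auto

lemma hpath_mono:
  assumes "hpath r S x y" and "\<And>u v. u \<in> S \<Longrightarrow> v \<in> S \<Longrightarrow> r u v \<Longrightarrow> r' u v"
  shows "hpath r' S x y"
proof -
  obtain xs where xs: "xs \<noteq> []" "hd xs = x" "last xs = y" "distinct xs" "set xs = S" "successively r xs"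
    using assms(1) by (rule hpathE)
  have "successively r' xs"
    using xs(6) by (rule successively_mono) (use xs(5) assms(2) in auto)
  with xs show ?thesis by (blast intro: hpathI)
qed

lemma hcycle_mono:
  assumes "hcycle r S" and "\<And>u v. u \<in> S \<Longrightarrow> v \<in> S \<Longrightarrow> r u v \<Longrightarrow> r' u v"
  shows "hcycle r' S"
proof -
  obtain xs where xs: "3 \<le> length xs" "distinct xs" "set xs = S" "successively r xs"
    "r (last xs) (hd xs)"
    using assms(1) unfolding hcycle_def by blast
  have "successively r' xs"
    using xs(4) by (rule successively_mono) (use xs(3) assms(2) in auto)
  moreover have "r' (last xs) (hd xs)"
    using xs by (intro assms(2)) (auto intro!: last_in_set hd_in_set)
  ultimately show ?thesis using xs unfolding hcycle_def by blast
qed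

lemma hpath_ends: "hpath r S x y \<Longrightarrow> x \<in> S \<and> y \<in> S \<and> finite S"
  by (auto elim!: hpathE)

lemma hpath_same: "hpath r S x x \<Longrightarrow> S = {x}"
proof (elim hpathE)
  fix xs assume xs: "xs \<noteq> []" "hd xs = x" "last xs = x" "distinct xs" "set xs = S"
  then obtain ys where ys: "xs = x # ys" by (cases xs) auto
  have "ys = []"
  proof (rule ccontr)
    assume "ys \<noteq> []"
    then have "x \<in> set ys" using xs ys by (metis last_ConsR last_in_set)
    then show False using xs ys by simp
  qed
  then show "S = {x}" using ys xs by simp
qed

lemma hpath_rev:
  assumes "symp r" and "hpath r S x y"
  shows "hpath r S y x"
proof -
  obtain xs where xs: "xs \<noteq> []" "hd xs = x" "last xs = y" "distinct xs" "set xs = S" "successively r xs"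
    using assms(2) by (rule hpathE)
  have "successively r (rev xs)"
    unfolding successively_rev using xs(6)
    by (rule successively_mono) (use assms(1) in \<open>simp add: symp_def\<close>)
  then show ?thesis
    using xs by (intro hpathI[of "rev xs"]) (auto simp: hd_rev last_rev)
qed

lemma hpath_join:
  assumes "hpath r S x y" and "r y x'" and "hpath r T x' y'" and "S \<inter> T = {}"
  shows "hpath r (S \<union> T) x y'"
proof -
  obtain xs where xs: "xs \<noteq> []" "hd xs = x" "last xs = y" "distinct xs" "set xs = S" "successively r xs"
    using assms(1) by (rule hpathE)
  obtain ys where ys: "ys \<noteq> []" "hd ys = x'" "last ys = y'" "distinct ys" "set ys = T" "successively r ys"
    using assms(3) by (rule hpathE)
  show ?thesis
    by (rule hpathI[of "xs @ ys"]) (use xs ys assms in \<open>auto simp: successively_append_iff\<close>)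
qed

lemma hpath_Cons:
  assumes "r w x" and "hpath r S x y" and "w \<notin> S"
  shows "hpath r (insert w S) w y"
  using hpath_join[OF hpath_single assms(1,2)] assms(3) by simp

lemma hpath_imp_hcycle:
  assumes "hpath r S x y" and "r y x" and "3 \<le> card S"
  shows "hcycle r S"
  using assms unfolding hcycle_def by (auto elim!: hpathE simp: distinct_card)

lemma hpath_uncons:
  assumes "hpath r S w y" and "w \<noteq> y"
  obtains x where "r w x" "hpath r (S - {w}) x y"
proof -
  obtain xs where xs: "xs \<noteq> []" "hd xs = w" "last xs = y" "distinct xs" "set xs = S" "successively r xs"
    using assms(1) by (rule hpathE)
  then obtain ys where ys: "xs = w # ys" by (cases xs) auto
  then have "ys \<noteq> []" using xs assms(2) by auto
  then have "r w (hd ys)" "hpath r (S - {w}) (hd ys) y"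
    using xs ys by (auto simp: successively_Cons intro!: hpathI[of ys])
  then show thesis using that by blast
qed

lemma hpath_remove_inner:
  assumes "hpath r S s t" and "w \<in> S" and "w \<noteq> s" and "w \<noteq> t"
  obtains S1 S2 x y where "S1 \<union> S2 = S - {w}" "S1 \<inter> S2 = {}" "hpath r S1 s x" "hpath r S2 y t"
    "r x w" "r w y"
proof -
  obtain xs where xs: "xs \<noteq> []" "hd xs = s" "last xs = t" "distinct xs" "set xs = S" "successively r xs"
    using assms(1) by (rule hpathE)
  then obtain ys zs where e: "xs = ys @ w # zs"
    using assms(2) by (metis split_list)
  have ne: "ys \<noteq> []" "zs \<noteq> []" using e xs assms(3,4) by auto
  have suc: "successively r (ys @ w # zs)" and dis: "distinct (ys @ w # zs)"
    using xs(4,6) e by simp_all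
  have "hpath r (set ys) (hd ys) (last ys)" "hpath r (set zs) (hd zs) (last zs)"
    using suc dis ne by (auto simp: successively_append_iff successively_Cons intro!: hpath_list)
  moreover have "hd ys = s" "last zs = t" using xs(2,3) e ne by auto
  moreover have "r (last ys) w" "r w (hd zs)"
    using xs e ne by (auto simp: successively_append_iff successively_Cons)
  moreover have "set ys \<union> set zs = S - {w}" "set ys \<inter> set zs = {}"
    using xs e by auto
  ultimately show thesis using that by blast
qed

text \<open>
  If a set meets every edge of a path, it contains at least every second vertex. Each end of the
  path that lies in the set improves the count by one; without this gain some of the
  cuts below would fail by a single vertex.\<close>

lemma alternating_length:
  assumes "xs \<noteq> []" and "distinct xs" and "successively (\<lambda>x y. x \<in> B \<or> y \<in> B) xs"
  shows "length xs + of_bool (hd xs \<in> B) + of_bool (last xs \<in> B) \<le> 2 * card (B \<inter> set xs) + 1"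
  using assms
proof (induction xs rule: induct_list012)
  case (2 x)
  then show ?case by auto
next
  case (3 x y zs)
  have IH: "length (y # zs) + of_bool (y \<in> B) + of_bool (last (y # zs) \<in> B)
      \<le> 2 * card (B \<inter> set (y # zs)) + 1"
    using 3 by simp
  show ?case
  proof (cases "x \<in> B")
    case True
    have "B \<inter> set (x # y # zs) = insert x (B \<inter> set (y # zs))" using True by auto
    moreover have "x \<notin> B \<inter> set (y # zs)" using 3 by auto
    ultimately have "card (B \<inter> set (x # y # zs)) = Suc (card (B \<inter> set (y # zs)))"
      by (metis card_insert_disjoint finite_Int List.finite_set)
    then show ?thesis using IH True by (auto split: if_splits)
  next
    case False
    then have "y \<in> B" using 3 by auto
    moreover have "B \<inter> set (x # y # zs) = B \<inter> set (y # zs)" using False by auto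
    ultimately show ?thesis using IH False by (auto split: if_splits)
  qed
qed simp

lemma not_successively_split:
  assumes "\<not> successively P xs"
  obtains ys x y zs where "xs = ys @ x # y # zs" "\<not> P x y"
proof -
  from assms have "\<exists>ys x y zs. xs = ys @ x # y # zs \<and> \<not> P x y"
  proof (induction xs rule: induct_list012)
    case (3 x y zs)
    show ?case
    proof (cases "P x y")
      case True
      then have "\<not> successively P (y # zs)" using 3 by simp
      then obtain ys u v ws where "y # zs = ys @ u # v # ws" "\<not> P u v" using 3 by blast
      then have "x # y # zs = (x # ys) @ u # v # ws" by simp
      with \<open>\<not> P u v\<close> show ?thesis by blast
    next
      case False
      then show ?thesis by (intro exI[of _ "[]"]) auto
    qed
  qed auto
  with that show thesis by blast
qed

lemma hpath_break:
  assumes "hpath r S s t"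
    and "2 * card (B \<inter> S) + 1 < card S + of_bool (s \<in> B) + of_bool (t \<in> B)"
  obtains S1 S2 x y where "S1 \<union> S2 = S" "S1 \<inter> S2 = {}" "hpath r S1 s x" "hpath r S2 y t"
    "r x y" "x \<notin> B" "y \<notin> B"
proof -
  obtain xs where xs: "xs \<noteq> []" "hd xs = s" "last xs = t" "distinct xs" "set xs = S" "successively r xs"
    using assms(1) by (rule hpathE)
  have "\<not> successively (\<lambda>x y. x \<in> B \<or> y \<in> B) xs"
    using alternating_length[OF xs(1,4), of B] assms(2) xs distinct_card[OF xs(4)] by auto
  then obtain ys x y zs where e: "xs = ys @ x # y # zs" and b: "\<not> (x \<in> B \<or> y \<in> B)"
    by (rule not_successively_split)
  have suc: "successively r ((ys @ [x]) @ (y # zs))" and dis: "distinct ((ys @ [x]) @ (y # zs))"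
    using xs(4,6) e by simp_all
  have "hpath r (set (ys @ [x])) (hd (ys @ [x])) (last (ys @ [x]))"
    "hpath r (set (y # zs)) (hd (y # zs)) (last (y # zs))"
    using suc dis unfolding successively_append_iff distinct_append
    using hpath_list[of "ys @ [x]" r] hpath_list[of "y # zs" r]
    by (simp_all add: successively_append_iff)
  moreover have "hd (ys @ [x]) = s" "last (y # zs) = t" using xs(2,3) e by (auto simp: hd_append)
  moreover have "r x y" using xs(6) e by (auto simp: successively_append_iff)
  moreover have "set (ys @ [x]) \<union> set (y # zs) = S" "set (ys @ [x]) \<inter> set (y # zs) = {}"
    using xs(4,5) e by auto
  ultimately show thesis using that[of "set (ys @ [x])" "set (y # zs)" x y] b by simp
qed

lemma hcycle_rotate:
  assumes "hcycle r S" and "s \<in> S"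
  obtains xs where "3 \<le> length (s # xs)" "distinct (s # xs)" "set (s # xs) = S"
    "successively r (s # xs)" "r (last xs) s"
proof -
  obtain xs where xs: "3 \<le> length xs" "distinct xs" "set xs = S" "successively r xs"
    "r (last xs) (hd xs)"
    using assms(1) unfolding hcycle_def by blast
  then obtain ys zs where e: "xs = ys @ s # zs" using assms(2) by (metis split_list)
  have len: "3 \<le> length (s # zs @ ys)" "distinct (s # zs @ ys)" "set (s # zs @ ys) = S"
    using xs(1-3) e by auto
  have "successively r (s # zs @ ys)" "r (last (zs @ ys)) s"
    using xs(1,4,5) e
    by (cases "zs = []"; cases "ys = []"; auto simp: successively_append_iff successively_Cons)+
  with len that show thesis by blast
qed

lemma hcycle_remove:
  assumes "symp r" and "hcycle r S" and "v \<in> S"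
  obtains x y where "x \<noteq> y" "hpath r (S - {v}) x y" "r v x" "r v y"
proof -
  obtain xs where xs: "3 \<le> length (v # xs)" "distinct (v # xs)" "set (v # xs) = S"
    "successively r (v # xs)" "r (last xs) v"
    using hcycle_rotate[OF assms(2,3)] by blast
  have "xs \<noteq> []" using xs by auto
  have "hpath r (S - {v}) (hd xs) (last xs)"
    using xs \<open>xs \<noteq> []\<close> by (intro hpathI[of xs]) (auto simp: successively_Cons)
  moreover have "hd xs \<noteq> last xs" using xs by (cases xs) auto
  moreover have "r v (hd xs)" using xs \<open>xs \<noteq> []\<close> by (auto simp: successively_Cons)
  moreover have "r v (last xs)" using xs(5) assms(1) unfolding symp_def by blast
  ultimately show thesis using that by blast
qed

lemma hcycle_from:
  assumes "symp r" and "hcycle r S" and "s \<in> S"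
  obtains x y where "x \<noteq> y" "r s x" "r s y" "hpath r S s x" "hpath r S s y"
proof -
  obtain x y where xy: "x \<noteq> y" "hpath r (S - {s}) x y" "r s x" "r s y"
    using hcycle_remove[OF assms] by blast
  have "insert s (S - {s}) = S" using assms(3) by auto
  then have "hpath r S s y" "hpath r S s x"
    using hpath_Cons[OF xy(3,2)] hpath_Cons[OF xy(4) hpath_rev[OF assms(1) xy(2)]] by simp_all
  with xy that show thesis by blast
qed

lemma hcycle_split:
  assumes "symp r" and "hcycle r S" and "s \<in> S" and "t \<in> S" and "s \<noteq> t"
  obtains S1 S2 x y where "S1 \<union> S2 = S" "S1 \<inter> S2 = {}" "hpath r S1 s x" "hpath r S2 y t"
proof -
  obtain xs where xs: "3 \<le> length (s # xs)" "distinct (s # xs)" "set (s # xs) = S"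
    "successively r (s # xs)" "r (last xs) s"
    using hcycle_rotate[OF assms(2,3)] by blast
  then obtain ys zs where e: "xs = ys @ t # zs" using assms(4,5)
    by (metis set_ConsD split_list)
  have suc: "successively r ((s # ys) @ (t # zs))" and dis: "distinct ((s # ys) @ (t # zs))"
    using xs(2,4) e by simp_all
  have "successively r (s # ys)" "successively r (t # zs)"
    using suc unfolding successively_append_iff by blast+
  moreover have "distinct (s # ys)" "distinct (t # zs)" using dis unfolding distinct_append by blast+
  ultimately have "hpath r (set (s # ys)) s (last (s # ys))" and "hpath r (set (t # zs)) t (last (t # zs))"
    using hpath_list[of "s # ys" r] hpath_list[of "t # zs" r] by simp_all
  moreover from this(2) have "hpath r (set (t # zs)) (last (t # zs)) t" by (rule hpath_rev[OF assms(1)])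
  moreover have "set (s # ys) \<union> set (t # zs) = S" "set (s # ys) \<inter> set (t # zs) = {}"
    using xs(2,3) e by auto
  ultimately show thesis using that by blast
qed

lemma hcycle_break:
  assumes "hcycle r S" and "2 * card (B \<inter> S) < card S"
  obtains x y where "hpath r S x y" "x \<noteq> y" "r y x" "x \<notin> B" "y \<notin> B"
proof -
  obtain xs where xs: "3 \<le> length xs" "distinct xs" "set xs = S" "successively r xs"
    "r (last xs) (hd xs)"
    using assms(1) unfolding hcycle_def by blast
  have ne: "xs \<noteq> []" "hd xs \<noteq> last xs" using xs by (cases xs; auto)+
  show thesis
  proof (cases "hd xs \<in> B \<or> last xs \<in> B")
    case False
    then show ?thesis using xs ne by (intro that[of "hd xs" "last xs"]) (auto intro: hpathI)
  next
    case True
    have "hpath r S (hd xs) (last xs)" using xs ne by (auto intro: hpathI)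
    moreover have "2 * card (B \<inter> S) + 1 < card S + of_bool (hd xs \<in> B) + of_bool (last xs \<in> B)"
      using True assms(2) by auto
    ultimately obtain S1 S2 x y where s: "S1 \<union> S2 = S" "S1 \<inter> S2 = {}" "hpath r S1 (hd xs) x"
      "hpath r S2 y (last xs)" "r x y" "x \<notin> B" "y \<notin> B"
      by (rule hpath_break)
    have "hpath r (S2 \<union> S1) y x" using hpath_join[OF s(4) xs(5) s(3)] s(2) by blast
    moreover have "x \<noteq> y" using s(2) hpath_ends[OF s(3)] hpath_ends[OF s(4)] by blast
    ultimately show ?thesis
      using that[of y x] s(1,5,6,7) by (simp add: Un_commute)
  qed
qed

text \<open>
  For a faulty pair that is used by a cycle of the repaired graph: the neighbours of the two vertices
  on the cycle become the ends of what is left. Of two segments, each joins a neighbour of \<open>a\<close> to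
  a neighbour of \<open>b\<close>.\<close>

lemma hcycle_remove2:
  assumes "symp r" and "hcycle r S" and "a \<in> S" and "b \<in> S" and "a \<noteq> b" and "4 \<le> card S"
  obtains (one) x y where "hpath r (S - {a, b}) x y" "r a x" "r b y" "x \<noteq> y"
  | (two) S1 S2 x1 y1 x2 y2 where "S1 \<union> S2 = S - {a, b}" "S1 \<inter> S2 = {}"
      "hpath r S1 x1 y1" "hpath r S2 x2 y2" "r a x1" "r b y1" "r b x2" "r a y2"
proof -
  obtain x y where xy: "x \<noteq> y" "hpath r (S - {a}) x y" "r a x" "r a y"
    using hcycle_remove[OF assms(1-3)] by blast
  have sub: "S - {a} - {b} = S - {a, b}" by auto
  have c: "card (S - {a, b}) \<ge> 2"
    using assms(3-6) card_Diff_subset[of "{a,b}" S] by auto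
  have big: "u \<noteq> v" if "hpath r (S - {a, b}) u v" for u v
  proof
    assume "u = v"
    then have "S - {a, b} = {u}" using that hpath_same by metis
    then show False using c by simp
  qed
  have s: "r u v \<longleftrightarrow> r v u" for u v using assms(1) unfolding symp_def by blast
  consider "b = x" | "b = y" | "b \<noteq> x" "b \<noteq> y" by blast
  then show thesis
  proof cases
    case 1
    have "hpath r (S - {a}) b y" "b \<noteq> y" using xy 1 by simp_all
    then obtain z where z: "r b z" "hpath r (S - {a} - {b}) z y" by (rule hpath_uncons)
    have "hpath r (S - {a, b}) y z" using hpath_rev[OF assms(1) z(2)] sub by simp
    from this xy(4) z(1) big[OF this] show ?thesis by (rule one)
  next
    case 2
    have "hpath r (S - {a}) b x" "b \<noteq> x" using xy 2 hpath_rev[OF assms(1) xy(2)] by simp_all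
    then obtain z where z: "r b z" "hpath r (S - {a} - {b}) z x" by (rule hpath_uncons)
    have "hpath r (S - {a, b}) x z" using hpath_rev[OF assms(1) z(2)] sub by simp
    from this xy(3) z(1) big[OF this] show ?thesis by (rule one)
  next
    case 3
    have "b \<in> S - {a}" using assms(4,5) by blast
    from xy(2) this 3 obtain S1 S2 u v where *: "S1 \<union> S2 = S - {a} - {b}" "S1 \<inter> S2 = {}"
      "hpath r S1 x u" "hpath r S2 v y" "r u b" "r b v"
      by (rule hpath_remove_inner)
    have "r b u" using *(5) s by blast
    show ?thesis
      by (rule two[OF _ *(2-4) xy(3) \<open>r b u\<close> *(6) xy(4)]) (use *(1) sub in simp)
  qed
qed

section \<open>Signed words with a fixed tail\<close>

abbreviation spr :: "nat \<Rightarrow> int list \<Rightarrow> int list" where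
  "spr \<equiv> signed_prefix_reversal"

text \<open>
  The tail \<open>z\<close> is never touched by the reversals considered. It makes the copies inside
  the burnt pancake graph literally instances of the same notion, so that an induction
  hypothesis applies to them without any isomorphism.\<close>

definition sperms :: "int set \<Rightarrow> int list \<Rightarrow> int list set" where
  "sperms A z = {u @ z | u. distinct (map abs u) \<and> abs ` set u = A}"

definition labels :: "int set \<Rightarrow> int set" where
  "labels A = A \<union> uminus ` A"

text \<open>
  Adjacency by one of the first \<open>k\<close> reversals along an edge outside \<open>D\<close>. The condition on the length
  makes the relation symmetric on all words.\<close>

definition padj :: "int list set set \<Rightarrow> nat \<Rightarrow> int list \<Rightarrow> int list \<Rightarrow> bool" where
  "padj D k x y \<longleftrightarrow> k \<le> length x \<and> (\<exists>j \<in> {1..k}. y = spr j x) \<and> {x, y} \<notin> D"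

text \<open>
  The label of the copy to which the longest reversal leads: it moves the first symbol,
  negated, to the last place.\<close>

definition out :: "int list \<Rightarrow> int" where
  "out x = - x ! 0"

definition posset :: "int set \<Rightarrow> bool" where
  "posset A \<longleftrightarrow> finite A \<and> (\<forall>a \<in> A. 0 < a)"

lemma posset_finite: "posset A \<Longrightarrow> finite A"
  by (simp add: posset_def)

lemma posset_remove: "posset A \<Longrightarrow> posset (A - B)"
  by (simp add: posset_def)

lemma labels_iff: "posset A \<Longrightarrow> i \<in> labels A \<longleftrightarrow> \<bar>i\<bar> \<in> A"
proof -
  assume "posset A"
  then have "0 < a" if "a \<in> A" for a using that by (simp add: posset_def)
  then show ?thesis unfolding labels_def
    by (cases "i < 0") (force simp: abs_if image_iff intro: bexI[of _ "- i"])+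
qed

lemma finite_labels: "posset A \<Longrightarrow> finite (labels A)"
  by (simp add: labels_def posset_def)

lemma uminus_labels: "posset A \<Longrightarrow> - i \<in> labels A \<longleftrightarrow> i \<in> labels A"
  by (simp add: labels_iff)

lemma label_nonzero: "posset A \<Longrightarrow> i \<in> labels A \<Longrightarrow> i \<noteq> 0"
  by (auto simp: labels_iff posset_def)

lemma card_labels: "posset A \<Longrightarrow> card (labels A) = 2 * card A"
proof -
  assume A: "posset A"
  have "A \<inter> uminus ` A = {}"
  proof (rule ccontr)
    assume "A \<inter> uminus ` A \<noteq> {}"
    then obtain a where "a \<in> A" "- a \<in> A" by auto
    then have "0 < a" "0 < - a" using A unfolding posset_def by blast+
    then show False by simp
  qed
  then show ?thesis using A unfolding labels_def
    by (subst card_Un_disjoint) (auto simp: posset_def card_image)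
qed

lemma length_spr [simp]: "k \<le> length x \<Longrightarrow> length (spr k x) = length x"
  by (simp add: signed_prefix_reversal_def)

lemma nth_spr:
  assumes "k \<le> length x" and "i < length x"
  shows "spr k x ! i = (if i < k then - x ! (k - 1 - i) else x ! i)"
  using assms by (auto simp: signed_prefix_reversal_def nth_append rev_nth)

lemma spr_spr: "k \<le> length x \<Longrightarrow> spr k (spr k x) = x"
  by (rule signed_prefix_reversal_involutive)

lemma symp_padj: "symp (padj D k)"
proof (rule sympI)
  fix x y assume a: "padj D k x y"
  then obtain j where j: "j \<in> {1..k}" "y = spr j x" "k \<le> length x" "{x, y} \<notin> D"
    unfolding padj_def by blast
  then have "x = spr j y" "k \<le> length y" by (simp_all add: spr_spr)
  with j show "padj D k y x" unfolding padj_def by (auto simp: insert_commute)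
qed

lemma padj_mono: "padj D k x y \<Longrightarrow> k \<le> k' \<Longrightarrow> k' \<le> length x \<Longrightarrow> padj D k' x y"
  unfolding padj_def by auto

lemma spermsE:
  assumes "x \<in> sperms A z" "posset A"
  obtains u where "x = u @ z" "distinct (map abs u)" "abs ` set u = A" "length u = card A"
proof -
  obtain u where u: "x = u @ z" "distinct (map abs u)" "abs ` set u = A"
    using assms unfolding sperms_def by blast
  then have "length u = card A" using distinct_card[OF u(2)] by simp
  with u that show thesis by blast
qed

lemma spermsI: "distinct (map abs u) \<Longrightarrow> abs ` set u = A \<Longrightarrow> u @ z \<in> sperms A z"
  unfolding sperms_def by blast

lemma length_sperms: "posset A \<Longrightarrow> x \<in> sperms A z \<Longrightarrow> length x = card A + length z"
  by (erule (1) spermsE) simp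

lemma sperms_empty: "sperms {} z = {z}"
  by (auto simp: sperms_def)

lemma spr_sperms:
  assumes "posset A" "x \<in> sperms A z" and "k \<le> card A"
  shows "spr k x \<in> sperms A z"
proof -
  obtain u where u: "x = u @ z" "distinct (map abs u)" "abs ` set u = A" "length u = card A"
    using assms by (blast elim: spermsE)
  let ?v = "map uminus (rev (take k u)) @ drop k u"
  have "spr k x = ?v @ z" using u assms(3) by (simp add: signed_prefix_reversal_def)
  moreover have e: "map abs ?v = rev (take k (map abs u)) @ drop k (map abs u)"
    by (simp add: take_map drop_map rev_map o_def)
  have m: "mset (map abs ?v) = mset (map abs u)"
    unfolding e by (metis append_take_drop_id mset_append mset_rev)
  then have "distinct (map abs ?v)" using u(2) mset_eq_imp_distinct_iff by blast
  moreover have "abs ` set ?v = A" using mset_eq_setD[OF m] u(3) by (simp only: set_map)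
  ultimately show ?thesis by (simp only: spermsI)
qed

lemma sperms_nth_abs:
  assumes "posset A" "x \<in> sperms A z" "i < card A"
  shows "\<bar>x ! i\<bar> \<in> A" "x ! i \<noteq> 0"
proof -
  obtain u where u: "x = u @ z" "distinct (map abs u)" "abs ` set u = A" "length u = card A"
    using assms by (blast elim: spermsE)
  then show "\<bar>x ! i\<bar> \<in> A" using assms(3) by (auto simp: nth_append)
  then show "x ! i \<noteq> 0" using assms(1) by (force simp: posset_def)
qed

lemma sperms_nth_neq:
  assumes "posset A" "x \<in> sperms A z" "i < card A" "j < card A" "i \<noteq> j"
  shows "\<bar>x ! i\<bar> \<noteq> \<bar>x ! j\<bar>"
proof -
  obtain u where u: "x = u @ z" "distinct (map abs u)" "abs ` set u = A" "length u = card A"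
    using assms by (blast elim: spermsE)
  then show ?thesis
    using assms(3-5) nth_eq_iff_index_eq[OF u(2), of i j] by (auto simp: nth_append)
qed

lemma sperms_snoc:
  assumes "posset A" "x \<in> sperms A z" "card A = Suc m"
  shows "x \<in> sperms (A - {\<bar>x ! m\<bar>}) (x ! m # z)"
proof -
  obtain u where u: "x = u @ z" "distinct (map abs u)" "abs ` set u = A" "length u = card A"
    using assms by (blast elim: spermsE)
  then obtain v a where v: "u = v @ [a]" using assms(3) by (cases u rule: rev_cases) auto
  have am: "x ! m = a" using u v assms(3) by (auto simp: nth_append)
  have "\<bar>a\<bar> \<notin> abs ` set v" using u(2) v by simp
  moreover have "A = insert \<bar>a\<bar> (abs ` set v)" using u(3) v by auto
  ultimately have "abs ` set v = A - {\<bar>a\<bar>}" by simp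
  then show ?thesis using u v am by (auto simp: sperms_def)
qed

lemma sperms_snocD:
  assumes "posset A" "i \<in> labels A" "card A = Suc m" "x \<in> sperms (A - {\<bar>i\<bar>}) (i # z)"
  shows "x \<in> sperms A z" "x ! m = i"
proof -
  have iA: "\<bar>i\<bar> \<in> A" using assms(1,2) by (simp add: labels_iff)
  obtain u where u: "x = u @ i # z" "distinct (map abs u)" "abs ` set u = A - {\<bar>i\<bar>}"
    "length u = card (A - {\<bar>i\<bar>})"
    using assms posset_remove by (blast elim: spermsE)
  have "length u = m" using u(4) iA assms(1,3) posset_finite by simp
  then show "x ! m = i" using u(1) by auto
  have "abs ` set (u @ [i]) = A" using u(3) iA by auto
  moreover have "\<bar>i\<bar> \<notin> set (map abs u)" using u(3) by auto
  then have "distinct (map abs (u @ [i]))" using u(2) by simp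
  ultimately have "(u @ [i]) @ z \<in> sperms A z" by (simp only: spermsI)
  then show "x \<in> sperms A z" using u(1) by simp
qed

lemma sperms_head:
  assumes "posset A" "h \<in> labels A"
  shows "{x \<in> sperms A z. x ! 0 = h} = Cons h ` sperms (A - {\<bar>h\<bar>}) z"
proof (intro set_eqI iffI)
  have hA: "\<bar>h\<bar> \<in> A" using assms by (simp add: labels_iff)
  fix x
  {
    assume x: "x \<in> {x \<in> sperms A z. x ! 0 = h}"
    then obtain u where u: "x = u @ z" "distinct (map abs u)" "abs ` set u = A" "length u = card A"
      using assms(1) by (blast elim: spermsE)
    then obtain v a where v: "u = a # v" using hA by (cases u) auto
    have "a = h" using x u v by simp
    moreover have "\<bar>a\<bar> \<notin> abs ` set v" using u(2) v by simp
    moreover have "A = insert \<bar>a\<bar> (abs ` set v)" using u(3) v by auto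
    ultimately have "a = h" "abs ` set v = A - {\<bar>h\<bar>}" by simp_all
    then show "x \<in> Cons h ` sperms (A - {\<bar>h\<bar>}) z" using u v by (auto simp: sperms_def)
  next
    assume "x \<in> Cons h ` sperms (A - {\<bar>h\<bar>}) z"
    then obtain u where u: "x = h # u @ z" "distinct (map abs u)" "abs ` set u = A - {\<bar>h\<bar>}"
      by (auto simp: sperms_def)
    have "abs ` set (h # u) = A" using u(3) hA by auto
    moreover have "\<bar>h\<bar> \<notin> set (map abs u)" using u(3) by auto
    then have "distinct (map abs (h # u))" using u(2) by simp
    ultimately have "(h # u) @ z \<in> sperms A z" unfolding sperms_def by blast
    then show "x \<in> {x \<in> sperms A z. x ! 0 = h}" using u by simp
  }
qed

lemma card_sperms:
  assumes "posset A"
  shows "finite (sperms A z) \<and> card (sperms A z) = 2 ^ card A * fact (card A)"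
  using assms
proof (induction "card A" arbitrary: A)
  case 0
  then have "A = {}" by (simp add: posset_def)
  then show ?case by (simp add: sperms_empty)
next
  case (Suc m)
  have 1: "finite (sperms (A - {\<bar>h\<bar>}) z) \<and> card (sperms (A - {\<bar>h\<bar>}) z) = 2 ^ m * fact m"
    if "h \<in> labels A" for h
  proof -
    have c: "m = card (A - {\<bar>h\<bar>})"
      using that Suc.hyps(2) Suc.prems by (simp add: labels_iff posset_finite)
    from Suc.hyps(1)[OF c posset_remove[OF Suc.prems]] show ?thesis using c by simp
  qed
  have e: "sperms A z = (\<Union>h \<in> labels A. {x \<in> sperms A z. x ! 0 = h})"
    using sperms_nth_abs[OF Suc.prems, of _ z 0] Suc.hyps(2)[symmetric] Suc.prems
    by (auto simp: labels_iff)
  have fin: "finite {x \<in> sperms A z. x ! 0 = h}" if "h \<in> labels A" for h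
    unfolding sperms_head[OF Suc.prems that] using 1[OF that] by simp
  have cc: "card {x \<in> sperms A z. x ! 0 = h} = 2 ^ m * fact m" if "h \<in> labels A" for h
    unfolding sperms_head[OF Suc.prems that] using 1[OF that] by (simp add: card_image)
  have f: "finite (sperms A z)" using fin finite_labels[OF Suc.prems] by (subst e) blast
  have "card (\<Union>h \<in> labels A. {x \<in> sperms A z. x ! 0 = h})
      = (\<Sum>h \<in> labels A. card {x \<in> sperms A z. x ! 0 = h})"
    using fin finite_labels[OF Suc.prems] by (intro card_UN_disjoint) auto
  also have "\<dots> = card (labels A) * (2 ^ m * fact m)" using cc by simp
  also have "\<dots> = 2 ^ Suc m * fact (Suc m)"
    using card_labels[OF Suc.prems] Suc.hyps(2)[symmetric] by (simp add: algebra_simps)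
  finally show ?case using e f Suc.hyps(2) by metis
qed

text \<open>
  Copies are joined by the words with a given first symbol, so this is the number of edges between
  two copies.\<close>

lemma card_head_class:
  assumes "posset A" "h \<in> labels A" "card A = Suc m"
  shows "card {x \<in> sperms A z. x ! 0 = h} = 2 ^ m * fact m"
proof -
  have "card (A - {\<bar>h\<bar>}) = m" using assms by (simp add: labels_iff posset_finite)
  then show ?thesis
    unfolding sperms_head[OF assms(1,2)]
    using card_sperms[OF posset_remove[OF assms(1)], of "{\<bar>h\<bar>}" z] by (simp add: card_image)
qed

lemma out_spr: "1 \<le> k \<Longrightarrow> k \<le> length x \<Longrightarrow> out (spr k x) = x ! (k - 1)"
  unfolding out_def by (subst nth_spr) auto

lemma spr_neq:
  assumes "posset A" "a \<in> sperms A z" "k \<in> {1..card A}"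
  shows "spr k a \<noteq> a"
proof
  assume "spr k a = a"
  then have "spr k a ! (k - 1) = a ! (k - 1)" by simp
  moreover have "k \<le> length a" using length_sperms[OF assms(1,2)] assms(3) by simp
  ultimately have e: "- a ! 0 = a ! (k - 1)" using assms(3) by (subst (asm) nth_spr) auto
  have k: "k - 1 < card A" "0 < card A" using assms(3) by auto
  show False
  proof (cases "k = 1")
    case True
    then show False using e sperms_nth_abs(2)[OF assms(1,2) k(2)] by simp
  next
    case False
    then have "0 \<noteq> k - 1" using assms(3) by auto
    from sperms_nth_neq[OF assms(1,2) k(2,1) this] e show False by (metis abs_minus_cancel)
  qed
qed

text \<open>
  A reversal changes the entry in the last place that it affects. Among three reversals that close up,
  the longest would therefore have to occur twice, and then it cancels.\<close>

lemma spr_no_triangle: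
  assumes "posset A" "a \<in> sperms A z" "i \<in> {1..card A}" "j \<in> {1..card A}" "k \<in> {1..card A}"
  shows "spr j (spr k a) \<noteq> spr i a"
proof
  assume eq: "spr j (spr k a) = spr i a"
  have len: "length a = card A + length z" using length_sperms assms by blast
  have le: "i \<le> length a" "j \<le> length a" "k \<le> length a" using assms(3-5) len by auto
  have ka: "spr k a \<in> sperms A z" using spr_sperms assms by simp
  have ne: "- a ! 0 \<noteq> a ! (p - 1)" if "p \<in> {1..card A}" for p
  proof (cases "p = 1")
    case True
    then show ?thesis using sperms_nth_abs(2)[OF assms(1,2), of 0] that by auto
  next
    case False
    then have "0 < card A" "p - 1 < card A" "0 \<noteq> p - 1" using that by auto
    from sperms_nth_neq[OF assms(1,2) this] show ?thesis by (metis abs_minus_cancel)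
  qed
  consider "i = j" | "j = k" | "i = k" | "j < i" "k < i" | "j < k" "i < k" | "i < j" "k < j"
    by linarith
  then show False
  proof cases
    case 1
    then have "spr j (spr j (spr k a)) = spr j (spr j a)" using eq by simp
    then have "spr k a = a" using le by (simp add: spr_spr)
    then show False using spr_neq assms by blast
  next
    case 2
    then have "a = spr i a" using eq le by (simp add: spr_spr)
    then show False using spr_neq assms by metis
  next
    case 3
    then have "spr j (spr k a) = spr k a" using eq by simp
    then show False using spr_neq[OF assms(1) ka assms(4)] by simp
  next
    \<comment> \<open>In the remaining cases only one of the three reversals moves the position considered.\<close>
    case 4
    have "spr j (spr k a) ! (i - 1) = spr k a ! (i - 1)" using 4 le by (subst nth_spr) auto
    also have "\<dots> = a ! (i - 1)" using 4 le by (subst nth_spr) auto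
    finally have "spr j (spr k a) ! (i - 1) = a ! (i - 1)" .
    moreover have "spr i a ! (i - 1) = - a ! 0" using 4 le by (subst nth_spr) auto
    ultimately show False using eq ne[OF assms(3)] by simp
  next
    case 5
    have "spr j (spr k a) ! (k - 1) = spr k a ! (k - 1)" using 5 le by (subst nth_spr) auto
    moreover have "spr k a ! (k - 1) = - a ! 0" using 5 le by (subst nth_spr) auto
    moreover have "spr i a ! (k - 1) = a ! (k - 1)" using 5 le by (subst nth_spr) auto
    ultimately show False using eq ne[OF assms(5)] by simp
  next
    case 6
    have "spr j (spr k a) ! (j - 1) = - spr k a ! 0" using 6 le by (subst nth_spr) auto
    also have "\<dots> = a ! (k - 1)" using assms(5) le by (subst nth_spr) auto
    finally have "spr j (spr k a) ! (j - 1) = a ! (k - 1)" .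
    moreover have "spr i a ! (j - 1) = a ! (j - 1)" using 6 le by (subst nth_spr) auto
    ultimately have "a ! (k - 1) = a ! (j - 1)" using eq by simp
    moreover have "k - 1 < card A" "j - 1 < card A" "k - 1 \<noteq> j - 1" using 6 assms(4,5) by auto
    then have "\<bar>a ! (k - 1)\<bar> \<noteq> \<bar>a ! (j - 1)\<bar>" by (rule sperms_nth_neq[OF assms(1,2)])
    ultimately show False by simp
  qed
qed

section \<open>Walks on three symbols\<close>

fun walk :: "nat list \<Rightarrow> int list \<Rightarrow> int list list" where
  "walk [] u = [u]"
| "walk (k # ks) u = u # walk ks (spr k u)"

text \<open>
  The number 48 of vertices turns being Hamiltonian into a matter of distinctness: a walk without
  repetition whose vertices, together with the removed vertices \<open>W\<close>, are 48 in number visits everything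
  outside \<open>W\<close>. All walks are described by the lengths of the successive reversals.\<close>

definition good_walk :: "int list list \<Rightarrow> int list \<Rightarrow> nat list \<Rightarrow> bool" where
  "good_walk W s ks \<longleftrightarrow> distinct (W @ walk ks s) \<and> length (W @ walk ks s) = 48
     \<and> list_all (\<lambda>k. k \<in> {1, 2, 3}) ks"

text \<open>
  Hamiltonian paths from \<open>[1, 2, 3]\<close> to each of the other 47 vertices.\<close>

definition ham_words :: "nat list list" where
  "ham_words = [
    [1,3,2,1,2,3,1,3,2,3,1,2,1,3,1,3,1,2,1,3,2,1,2,3,1,3,2,3,2,3,1,3,1,3,1,3,2,3,2,3,1,3,2,3,2,1,2],
    [2,1,3,1,3,1,3,1,2,1,3,1,3,1,3,1,2,1,3,2,3,1,2,1,3,1,3,1,3,1,2,1,3,1,3,1,3,2,3,1,3,1,2,1,3,1,3],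
    [3,2,1,3,2,1,3,2,3,2,3,1,2,3,1,2,3,2,3,2,1,3,1,2,3,2,3,2,3,2,3,2,3,2,1,3,1,2,3,1,2,3,1,3,2,3,1],
    [2,3,2,3,2,3,2,1,2,1,3,1,2,1,2,1,3,2,1,3,2,1,2,1,2,3,1,3,1,3,2,1,2,1,2,3,1,2,3,1,2,1,2,1,3,1,2],
    [3,2,3,1,3,1,3,1,3,2,3,2,1,3,1,3,1,3,1,2,1,2,1,3,1,3,1,2,1,3,1,2,1,3,2,1,2,3,1,3,1,3,2,1,2,3,1],
    [2,3,1,3,2,3,1,2,1,2,3,2,3,2,1,3,1,2,3,2,3,2,1,2,1,3,1,2,3,2,1,3,1,2,1,2,1,3,1,2,3,2,1,2,3,1,3],
    [1,2,3,1,3,1,3,2,1,2,3,1,3,2,1,3,1,2,1,3,1,3,1,2,1,2,1,2,1,3,2,3,1,3,2,1,3,1,3,2,3,2,1,3,1,3,1],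
    [2,1,2,3,1,3,2,1,3,1,2,3,1,2,3,1,3,1,2,1,3,1,3,1,2,3,2,3,1,3,1,2,3,1,3,2,3,1,2,1,2,1,2,1,3,1,3],
    [3,2,3,1,3,2,3,2,3,2,1,3,2,1,2,3,2,1,3,1,3,1,3,1,2,3,2,1,2,3,1,2,3,1,3,2,1,3,2,3,2,3,2,3,2,3,1],
    [1,3,2,1,3,2,1,3,1,2,3,1,2,3,1,3,2,1,3,2,1,3,1,3,1,2,1,2,1,2,1,3,2,3,2,1,2,1,2,1,2,3,2,1,2,1,3],
    [2,3,1,3,2,1,3,2,1,3,1,3,2,1,2,3,1,3,2,1,3,1,2,3,2,3,2,3,2,3,1,3,1,3,1,3,2,1,2,3,2,1,3,2,1,2,3],
    [2,1,2,1,2,3,1,2,1,2,1,2,1,3,2,1,2,1,2,1,2,3,2,3,2,3,2,1,2,1,2,1,2,3,1,2,1,2,1,2,1,3,2,1,2,1,2],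
    [3,2,1,3,1,3,2,1,3,2,3,2,1,3,2,3,2,3,1,3,2,3,2,1,3,1,3,1,2,3,2,3,1,3,1,3,1,3,2,3,1,3,1,2,3,2,1],
    [1,3,2,1,2,1,3,1,3,2,1,2,1,2,3,1,2,3,1,2,1,3,2,1,3,1,2,3,1,2,1,3,2,3,2,3,1,3,1,2,1,2,3,1,3,1,2],
    [3,2,3,2,3,1,2,1,3,2,1,3,2,1,2,3,2,1,3,1,3,1,3,1,2,1,3,2,3,1,2,1,3,2,1,3,2,1,2,1,3,1,3,2,3,1,3],
    [1,3,1,3,1,2,3,1,3,1,3,1,3,2,3,2,1,2,1,2,1,2,3,1,3,1,3,2,1,3,2,1,3,1,3,1,2,1,2,1,3,1,3,1,2,3,1],
    [3,2,3,1,3,1,2,1,3,1,3,2,1,2,3,2,1,3,1,3,1,3,1,2,1,3,2,3,1,2,1,2,3,1,3,2,3,1,2,1,3,1,3,1,2,1,3],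
    [1,2,3,1,2,3,1,2,1,2,1,3,1,3,1,2,1,2,3,1,2,3,1,2,1,2,1,3,1,2,1,2,3,2,1,3,1,3,1,3,1,2,3,2,1,3,1],
    [1,2,3,2,3,1,3,2,3,2,3,1,3,1,3,1,3,2,1,3,2,3,1,3,2,1,2,1,2,3,1,3,2,3,1,2,1,3,1,3,1,2,1,3,2,3,1],
    [2,3,2,3,1,2,3,2,1,2,3,1,2,3,2,3,2,3,1,2,3,2,1,3,2,1,2,3,2,1,3,1,3,2,1,2,3,2,1,3,2,3,2,3,2,3,2],
    [2,3,1,2,3,1,2,3,2,1,3,1,3,2,1,2,1,2,3,1,2,3,1,2,1,3,2,1,3,1,2,3,1,2,1,2,3,2,1,2,1,3,1,3,2,3,2],
    [1,3,2,3,2,3,2,3,2,1,2,1,2,3,2,1,2,1,2,3,2,3,2,3,2,3,1,2,3,2,1,2,3,1,2,3,2,3,2,3,2,1,3,2,1,2,3],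
    [1,3,2,3,2,3,2,3,2,1,2,1,2,3,2,1,2,1,2,3,1,3,1,2,3,2,1,3,2,1,3,2,3,2,3,1,2,1,3,2,1,3,1,2,3,1,2],
    [2,3,2,1,3,2,1,2,1,2,1,2,3,1,2,3,2,1,2,3,1,2,1,2,3,2,1,2,1,2,1,2,3,2,1,2,1,3,2,3,1,2,1,2,1,2,1],
    [2,1,2,1,3,1,3,2,1,2,3,2,1,3,2,1,2,3,1,2,3,2,1,3,1,2,1,2,1,2,1,3,1,3,2,1,2,3,2,1,3,2,1,2,3,1,2],
    [1,2,3,2,1,2,3,1,2,1,2,3,1,2,3,2,1,3,1,3,1,2,3,2,1,2,1,3,1,2,1,2,3,2,3,1,2,1,2,1,3,2,3,2,1,2,1],
    [1,2,3,1,2,3,2,1,2,3,1,2,3,1,2,1,2,3,1,2,3,2,1,3,1,2,1,2,1,2,1,3,2,3,2,1,2,1,2,1,2,3,2,1,2,1,3],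
    [2,3,2,1,2,1,3,1,3,2,3,2,1,2,1,2,1,2,3,1,2,3,2,1,3,2,1,2,3,1,2,3,2,3,2,3,2,1,3,2,1,2,3,2,1,3,2],
    [2,3,2,3,1,3,1,3,1,3,2,3,2,3,1,3,1,3,1,2,3,2,1,3,2,1,2,3,1,2,3,1,2,1,3,2,1,3,2,1,2,3,1,2,3,1,2],
    [1,3,1,2,3,1,3,1,2,3,1,2,3,1,3,1,3,2,1,2,3,1,3,1,3,1,3,2,3,1,3,1,3,2,1,3,1,2,3,2,3,2,3,1,3,1,2],
    [1,3,1,3,1,2,1,3,2,3,1,3,2,1,3,1,3,2,3,1,3,1,2,3,1,3,2,3,2,1,2,3,2,3,1,3,2,3,2,3,1,3,1,3,1,3,2],
    [3,2,3,1,3,2,3,2,3,1,3,2,3,2,1,2,1,2,3,1,3,2,1,2,3,1,2,3,1,2,1,2,3,1,3,2,1,2,3,1,2,1,3,2,3,2,3],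
    [3,1,3,2,3,1,3,1,3,2,1,3,1,3,1,3,1,2,3,2,3,1,3,2,3,2,3,1,3,1,3,1,3,2,1,3,2,3,1,3,2,1,3,1,3,2,3],
    [1,3,2,1,2,3,1,3,2,1,2,1,3,2,1,2,3,2,1,3,1,3,2,3,2,1,2,3,2,3,1,2,3,1,3,1,2,1,2,1,3,1,3,1,2,1,2],
    [3,1,3,1,3,2,3,1,3,1,2,1,3,1,3,1,2,3,1,2,1,3,1,2,1,2,1,3,1,3,1,3,1,2,1,3,1,3,1,3,1,2,3,2,1,3,1],
    [2,1,3,2,1,2,1,2,1,2,3,2,3,1,3,1,2,1,2,3,2,1,2,1,3,2,1,3,1,2,3,1,2,1,2,1,3,1,2,3,2,1,3,2,1,3,2],
    [1,2,3,2,1,3,1,2,1,2,1,3,1,2,3,2,1,2,3,1,3,1,2,3,2,1,2,1,2,1,2,3,2,3,2,1,2,3,2,3,1,3,2,3,2,1,2],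
    [3,2,3,2,1,2,3,2,3,2,1,2,1,2,1,2,3,2,3,2,1,2,3,2,3,2,1,2,1,2,1,3,1,2,3,2,1,2,3,1,3,2,1,2,3,2,1],
    [2,1,2,1,2,1,2,3,1,2,3,2,1,2,3,1,2,1,2,3,2,1,2,1,3,2,1,2,3,2,1,3,2,1,2,1,2,1,2,3,2,3,2,1,2,3,2],
    [3,2,1,3,1,2,1,3,1,2,3,1,3,2,1,2,3,2,1,3,1,3,1,2,3,2,3,1,3,2,3,2,1,2,3,2,3,2,1,2,1,2,1,2,3,2,3],
    [1,2,3,2,1,2,3,1,3,2,1,2,3,2,1,3,2,3,2,3,2,1,2,3,2,3,2,1,2,1,2,1,2,3,2,3,2,1,2,3,2,3,2,1,2,1,2],
    [3,2,1,2,3,2,1,3,2,1,3,2,3,2,1,3,2,1,2,1,3,2,3,2,1,2,3,2,3,1,2,1,2,1,2,1,3,2,3,1,2,1,2,3,2,1,2],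
    [1,3,1,2,3,2,1,3,1,2,1,2,1,2,1,3,1,3,2,1,3,1,2,3,1,3,1,2,1,2,3,1,3,1,3,2,1,3,2,1,3,1,2,3,1,2,1],
    [1,2,1,3,2,1,3,2,1,2,1,3,2,1,3,1,3,1,2,1,2,3,1,2,1,2,1,2,1,3,2,3,1,2,1,2,3,1,2,1,2,1,2,1,3,1,3],
    [1,2,3,1,3,2,3,1,2,1,2,1,3,2,3,2,1,2,1,2,3,1,3,1,3,1,3,2,3,2,1,2,1,3,1,2,1,3,1,2,1,3,2,1,2,3,1],
    [2,1,2,3,1,2,3,1,2,1,3,2,1,3,2,1,2,1,3,2,3,1,2,1,3,1,3,1,3,1,2,1,2,3,1,2,1,3,2,1,2,1,3,1,3,2,3],
    [1,3,2,1,2,3,1,2,1,3,2,1,2,3,1,3,2,1,2,1,2,1,2,3,1,3,2,1,2,3,1,2,1,3,2,1,2,3,1,3,2,1,2,1,2,1,2]]"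

text \<open>
  Cycles through all vertices but \<open>[1, 2, 3]\<close>, or all but \<open>[1, 2, 3]\<close> and one of its three
  neighbours, each with the removed vertices and a starting point.\<close>

definition cycle_words :: "(int list list \<times> int list \<times> nat list) list" where
  "cycle_words = [
    ([[1,2,3]], [-1,2,3], [2,3,2,3,2,3,2,3,1,3,1,3,2,3,1,3,1,3,2,1,2,1,2,3,1,2,3,1,2,1,3,1,2,1,3,2,1,3,2,1,2,3,2,1,3,1]),
    ([[1,2,3], [-1,2,3]], [1,2,-3], [1,2,3,1,3,1,3,2,1,3,2,1,2,3,1,2,3,2,3,2,3,1,3,1,2,1,2,1,3,1,3,2,3,1,3,1,3,2,3,1,3,1,3,1,3]),
    ([[1,2,3], [-2,-1,3]], [1,2,-3], [1,3,1,3,2,1,2,1,2,3,1,2,3,1,2,1,2,1,3,1,2,1,2,3,2,1,2,1,2,1,2,3,1,2,1,2,1,2,1,3,1,2,1,2,1]),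
    ([[1,2,3], [-3,-2,-1]], [1,2,-3], [3,2,3,2,3,2,1,3,2,1,3,2,3,2,1,3,2,3,2,3,2,3,1,2,3,2,3,1,3,2,3,2,1,2,1,3,2,3,1,3,2,1,2,3,2])]"

text \<open>
  Hamiltonian cycles from \<open>[1, 2, 3]\<close>; the first one avoids the first reversal at this vertex, and so on.\<close>

definition edge_cycle_words :: "nat list list" where
  "edge_cycle_words = [
    [2,3,1,3,1,3,2,3,2,3,2,3,2,1,3,2,3,1,3,2,1,3,2,3,2,3,2,3,1,2,3,1,3,2,3,1,2,3,2,3,2,3,2,3,1,3,1],
    [3,2,3,1,3,1,3,2,1,3,1,3,1,3,1,2,3,2,3,1,3,1,3,1,3,2,3,1,3,1,3,1,3,2,3,2,1,3,1,3,1,3,1,2,3,1,3],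
    [2,1,3,2,1,2,1,2,3,2,1,2,1,2,3,1,2,1,2,1,2,1,3,2,3,2,1,2,1,2,1,2,3,2,1,2,1,2,1,2,3,2,3,1,2,1,2]]"

text \<open>
  Paths through all vertices but \<open>[1, 2, 3]\<close>, one for each pair of labels other than \<open>-1\<close> to
  which the two ends may lead.\<close>

definition one_hole_words :: "(int list \<times> nat list) list" where
  "one_hole_words = [
    ([-1,2,3], [3,1,2,3,2,1,3,1,3,2,3,1,3,1,2,1,2,3,1,3,2,1,2,3,1,2,1,3,1,2,1,2,1,3,1,3,2,1,3,2,3,2,1,3,2,1]),
    ([-1,2,3], [2,3,2,3,1,3,2,3,2,1,2,1,3,2,3,2,1,2,1,2,1,2,3,2,1,2,1,2,3,2,1,3,1,2,1,2,1,3,1,2,3,2,1,2,3,1]),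
    ([-1,2,3], [3,1,2,1,3,2,3,1,2,1,2,1,3,2,3,1,2,1,2,3,1,3,1,3,2,3,2,1,2,3,2,3,2,1,3,2,3,1,2,1,2,1,3,2,3,1]),
    ([-1,2,3], [2,1,2,1,2,1,3,2,1,2,1,2,3,2,1,2,1,2,1,2,3,1,3,2,1,2,1,2,1,2,3,2,3,2,1,2,1,2,1,2,3,1,2,1,2,1]),
    ([-2,1,3], [2,3,1,2,1,3,1,2,1,3,2,1,3,1,2,3,1,3,1,3,1,3,2,3,2,1,3,1,3,1,3,1,2,1,3,1,2,3,1,3,1,3,2,3,1,3]),
    ([-2,1,3], [2,3,1,3,2,3,1,2,3,1,3,1,3,1,3,2,3,1,3,1,3,2,3,1,3,1,2,3,1,3,2,3,1,2,1,3,1,3,1,3,1,2,3,2,3,1]),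
    ([-2,1,3], [2,3,2,3,1,3,2,1,3,2,1,3,1,3,1,3,1,2,3,2,1,3,1,3,2,1,3,1,3,1,3,1,2,1,2,3,2,3,1,2,3,1,3,1,2,3]),
    ([2,1,3], [3,1,3,2,1,3,2,3,1,3,2,1,3,1,3,2,3,2,3,2,1,2,1,3,1,3,1,3,1,2,3,1,3,1,3,2,1,2,3,1,3,2,1,3,2,3]),
    ([2,1,3], [3,2,3,2,1,2,3,2,3,1,2,1,2,1,2,1,3,2,3,1,3,2,1,2,3,1,2,1,3,1,2,1,3,2,1,3,2,1,2,3,2,1,3,2,3,1]),
    ([-3,1,2], [3,1,2,3,2,1,2,1,2,1,2,3,2,3,1,2,1,2,1,2,1,3,1,2,3,2,1,2,3,1,2,1,3,1,2,1,2,1,2,3,2,1,2,1,2,3])]"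

text \<open>
  Paths that miss \<open>[1, 2, 3]\<close> and a second vertex. The second vertex ranges over all vertices that do not
  begin with 1; the ends of the path begin with different symbols, and with none of the first symbols
  of the two missing vertices.\<close>

definition two_hole_words :: "(int list \<times> int list \<times> nat list) list" where
  "two_hole_words = [
    ([-1,2,3], [2,1,3], [1,3,2,3,2,1,3,1,3,1,2,3,2,3,1,3,2,3,2,1,2,1,3,2,3,2,1,2,3,2,3,1,3,1,2,3,2,1,2,3,1,2,3,2,1]),
    ([-1,2,-3], [2,1,3], [2,1,2,1,3,1,2,1,3,2,1,2,1,3,2,1,2,3,2,1,3,2,1,2,1,2,1,3,1,2,1,3,2,1,2,1,3,2,1,2,3,2,1,3,2]),
    ([-1,-2,3], [2,1,-3], [1,3,1,2,3,2,1,3,2,1,3,2,3,1,2,3,1,3,2,3,1,2,1,2,1,2,1,3,1,2,3,2,1,2,1,3,1,2,1,3,2,1,3,1,2]),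
    ([-1,-2,-3], [2,1,3], [2,3,1,2,3,1,2,3,2,3,2,1,3,1,2,3,1,3,1,2,3,1,2,3,2,1,3,1,3,1,2,3,2,1,3,1,2,1,2,3,2,3,1,3,1]),
    ([-1,3,2], [2,1,3], [1,2,3,1,3,2,3,1,2,3,1,3,2,1,3,2,1,3,1,2,3,1,3,1,3,1,3,2,1,3,2,1,3,1,2,3,1,2,1,3,1,2,1,3,1]),
    ([-1,3,-2], [2,1,3], [3,2,3,1,3,1,2,3,1,3,1,3,2,3,1,3,1,3,2,1,3,1,2,3,2,3,2,1,2,1,3,2,3,1,3,2,1,3,1,2,1,3,1,2,3]),
    ([-1,-3,2], [2,1,3], [2,3,2,1,3,1,3,2,1,3,2,3,1,3,1,2,3,2,3,2,3,2,3,1,3,2,3,2,1,3,1,3,2,1,3,2,3,2,1,3,2,1,3,2,3]),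
    ([-1,-3,-2], [-2,1,3], [2,3,2,1,3,2,3,2,3,1,2,3,2,1,3,2,3,1,3,2,1,2,3,2,1,3,2,3,1,2,3,2,3,2,1,2,3,2,3,2,3,1,2,1,3]),
    ([2,1,3], [-1,2,3], [2,3,1,3,1,3,1,2,3,1,3,1,2,3,1,2,1,3,2,1,2,1,3,1,3,1,2,3,1,2,1,2,3,1,2,3,1,2,1,3,2,1,3,2,1]),
    ([2,1,-3], [-1,2,3], [2,1,2,1,3,1,3,1,3,1,2,1,2,1,2,1,3,2,3,1,3,2,1,2,1,2,1,2,3,1,2,1,2,3,1,2,3,1,2,1,2,1,3,1,2]),
    ([2,-1,3], [-1,3,-2], [2,1,2,1,2,3,1,3,1,3,2,3,2,1,2,1,3,1,2,1,2,1,3,2,1,3,1,3,2,1,3,1,2,3,2,3,2,1,2,1,3,1,2,1,3]),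
    ([2,-1,-3], [-1,2,3], [3,2,1,3,2,3,2,3,1,2,3,1,2,1,3,1,3,2,3,2,1,3,1,3,2,3,2,3,2,3,2,3,1,3,1,3,2,3,1,3,1,3,2,1,3]),
    ([-2,1,3], [-1,2,3], [3,1,2,3,2,1,2,3,1,2,3,2,3,2,3,2,1,2,3,2,3,2,3,2,3,2,3,1,2,3,2,3,1,2,3,2,1,2,3,1,2,3,2,3,2]),
    ([-2,1,-3], [-1,2,3], [2,3,1,2,3,1,2,1,2,3,2,3,2,3,1,2,3,1,3,2,1,3,2,1,3,1,2,3,1,2,1,3,1,2,1,2,1,2,3,2,1,2,1,2,3]),
    ([-2,-1,3], [-1,2,3], [2,3,2,3,2,3,2,1,2,1,3,1,2,3,2,1,3,2,3,2,3,2,3,1,2,3,2,3,2,1,2,3,2,3,2,3,1,2,3,2,1,2,3,1,3]),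
    ([-2,-1,-3], [-1,2,-3], [1,3,1,2,1,3,1,2,1,3,1,2,3,1,2,1,3,2,1,2,1,3,1,2,3,2,1,2,3,1,2,3,2,1,3,2,1,2,1,3,1,2,1,3,2]),
    ([2,3,1], [-1,2,3], [3,1,2,3,2,1,2,1,2,3,1,2,1,3,1,2,1,2,1,2,1,3,2,3,1,3,2,1,3,2,3,1,2,1,3,1,3,1,2,1,3,2,3,1,2]),
    ([2,3,-1], [-1,-3,2], [2,3,1,3,2,1,2,1,3,2,1,3,2,3,2,3,1,2,1,3,2,1,3,1,2,3,1,3,2,1,2,3,2,3,2,1,2,1,2,1,2,3,1,3,1]),
    ([2,-3,1], [-1,2,3], [3,1,3,1,3,1,2,3,2,1,3,1,3,1,3,1,2,3,2,3,1,3,1,3,1,2,1,2,3,1,2,3,1,2,1,3,1,2,1,3,2,1,3,2,1]),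
    ([2,-3,-1], [-1,2,3], [2,3,2,3,2,3,1,2,3,2,1,3,2,1,2,3,1,2,3,2,1,3,2,1,2,1,3,1,2,3,2,1,3,2,1,2,3,2,3,1,3,1,3,1,3]),
    ([-2,3,1], [-1,2,3], [2,3,1,2,1,2,3,2,1,2,1,2,3,1,3,2,3,1,2,1,3,2,1,2,1,3,1,3,2,3,2,3,1,2,1,3,2,1,2,1,2,3,2,1,3]),
    ([-2,3,-1], [-1,2,3], [3,1,3,1,3,1,2,3,1,3,1,3,1,2,3,1,3,1,2,3,1,2,1,3,2,1,3,1,3,1,2,1,3,1,3,2,1,3,2,1,3,1,3,2,1]),
    ([-2,-3,1], [-1,2,3], [3,1,2,3,1,3,1,3,1,2,3,1,3,1,3,2,3,1,3,1,3,1,3,2,1,2,1,2,3,2,3,1,3,1,2,1,3,1,3,1,2,3,1,2,1]),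
    ([-2,-3,-1], [-1,-2,3], [2,3,1,2,1,2,1,2,1,3,2,1,2,1,3,2,3,1,2,3,1,2,3,2,1,3,1,2,3,1,3,2,1,2,1,3,2,1,3,1,2,3,2,3,2]),
    ([3,1,2], [-1,2,3], [2,1,3,1,3,2,3,1,3,1,3,1,3,2,1,2,3,1,2,3,1,2,1,3,1,3,2,3,1,3,1,3,1,3,2,1,3,2,3,1,2,1,3,1,3]),
    ([3,1,-2], [-1,2,3], [3,2,3,1,3,2,1,3,2,1,2,3,2,1,3,1,2,3,1,3,1,2,3,2,1,3,2,3,1,3,2,1,3,2,3,2,3,2,3,2,1,3,1,2,3]),
    ([3,-1,2], [-1,2,-3], [2,1,3,2,1,3,1,3,1,3,1,2,1,3,2,3,1,3,1,2,3,1,2,1,3,2,3,2,3,1,3,1,2,3,1,2,3,2,1,3,2,3,2,1,3]),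
    ([3,-1,-2], [-1,2,3], [3,2,3,1,3,2,1,2,3,2,3,1,3,2,3,2,3,2,3,1,2,3,2,3,1,2,3,2,3,2,3,1,2,1,3,2,3,2,3,2,1,3,2,3,2]),
    ([-3,1,2], [-1,3,2], [1,2,3,2,3,2,3,1,3,2,1,3,1,3,2,1,2,3,1,3,2,1,3,1,2,1,3,1,3,2,3,2,3,2,3,1,3,1,3,2,3,2,3,2,1]),
    ([-3,1,-2], [-1,2,3], [2,3,1,2,3,1,2,1,3,2,3,2,3,1,2,1,3,2,1,2,3,1,3,2,3,1,2,1,2,3,2,3,1,3,2,1,3,2,1,3,1,3,1,3,1]),
    ([-3,-1,2], [-1,2,3], [2,1,2,1,2,1,3,2,1,3,2,1,2,3,2,3,1,2,1,2,1,3,2,3,2,1,2,1,3,2,1,2,3,2,1,3,1,3,1,2,3,2,1,2,3]),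
    ([-3,-1,-2], [-1,2,3], [2,1,2,1,2,1,3,1,2,3,2,1,3,1,2,1,2,3,1,2,3,2,3,1,2,3,1,2,3,2,1,2,1,3,1,2,1,2,3,2,1,2,1,3,1]),
    ([3,2,1], [-1,2,3], [2,3,2,3,1,2,1,2,1,3,2,3,2,1,2,1,3,1,2,1,2,3,2,3,2,3,2,1,2,3,1,2,1,2,3,1,2,3,2,1,3,1,3,2,1]),
    ([3,2,-1], [-1,2,3], [3,1,3,2,1,2,1,2,3,2,3,1,2,1,2,1,3,2,3,1,3,2,1,3,1,3,2,1,2,3,2,1,3,2,3,2,1,2,1,3,1,2,1,3,2]),
    ([3,-2,1], [-1,2,3], [3,2,3,1,3,2,1,2,3,1,3,1,3,2,3,1,3,1,3,2,3,2,3,2,3,1,3,1,3,2,3,1,3,1,3,2,3,2,3,2,1,2,3,2,3]),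
    ([3,-2,-1], [2,-1,3], [1,3,2,3,1,2,1,3,2,1,3,1,2,1,3,1,3,2,3,2,1,2,1,2,3,1,3,1,3,1,3,2,3,1,2,1,3,1,3,2,1,2,3,1,2]),
    ([-3,2,1], [-1,2,3], [3,2,1,3,2,1,3,1,2,1,2,1,3,2,1,3,2,3,1,2,1,2,3,1,2,3,1,2,1,2,3,2,3,2,3,2,3,2,1,2,1,3,2,1,3]),
    ([-3,2,-1], [-1,2,3], [3,2,1,2,3,1,2,1,3,1,2,1,3,1,2,1,3,2,1,2,3,2,1,3,2,3,1,3,2,1,3,2,3,2,3,2,1,2,1,2,3,2,3,2,3]),
    ([-3,-2,1], [-2,-1,3], [3,1,3,2,1,3,2,1,3,1,3,2,3,2,3,2,3,1,3,1,3,2,3,2,3,2,1,3,2,1,2,3,2,1,3,2,3,1,3,2,1,3,1,3,2]),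
    ([-3,-2,-1], [-1,2,3], [3,1,3,1,3,2,3,1,3,1,3,2,3,1,3,1,3,1,3,2,1,2,3,1,3,1,3,1,3,2,3,2,3,1,3,1,3,1,3,2,1,3,1,3,1])]"

definition is_sperm3 :: "int list \<Rightarrow> bool" where
  "is_sperm3 u \<longleftrightarrow> length u = 3 \<and> distinct (map abs u) \<and> list_all (\<lambda>i. \<bar>i\<bar> \<in> {1, 2, 3}) u"

definition closes :: "int list \<Rightarrow> nat list \<Rightarrow> bool" where
  "closes s w \<longleftrightarrow> s \<in> {spr 1 (last (walk w s)), spr 2 (last (walk w s)), spr 3 (last (walk w s))}"

lemma ham_words: "list_all (\<lambda>w. good_walk [] [1,2,3] w) ham_words
   \<and> length ham_words = 47 \<and> distinct ([1,2,3] # map (\<lambda>w. last (walk w [1,2,3])) ham_words)"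
  by code_simp

lemma cycle_words:
  "list_all (\<lambda>(W, s, w). good_walk W s w \<and> is_sperm3 s \<and> closes s w) cycle_words
   \<and> map fst cycle_words = [[[1,2,3]], [[1,2,3], spr 1 [1,2,3]], [[1,2,3], spr 2 [1,2,3]],
     [[1,2,3], spr 3 [1,2,3]]]"
  by code_simp

lemma edge_cycle_words:
  "list_all (\<lambda>(k, w). good_walk [] [1,2,3] w \<and> closes [1,2,3] w
       \<and> spr k [1,2,3] \<notin> {walk w [1,2,3] ! 1, last (walk w [1,2,3])})
     (zip [1,2,3] edge_cycle_words) \<and> length edge_cycle_words = 3"
  by code_simp

lemma one_hole_words:
  "list_all (\<lambda>(s, w). good_walk [[1,2,3]] s w \<and> is_sperm3 s) one_hole_words
   \<and> map (\<lambda>(s, w). (- s ! 0, - last (walk w s) ! 0)) one_hole_words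
     = [(1,2), (1,-2), (1,3), (1,-3), (2,-2), (2,3), (2,-3), (-2,3), (-2,-3), (3,-3)]"
  by code_simp

lemma two_hole_words:
  "list_all (\<lambda>(u, s, w). good_walk [[1,2,3], u] s w \<and> is_sperm3 s \<and> is_sperm3 u \<and> u ! 0 \<noteq> 1
      \<and> s ! 0 \<noteq> last (walk w s) ! 0 \<and> s ! 0 \<notin> {1, u ! 0} \<and> last (walk w s) ! 0 \<notin> {1, u ! 0})
     two_hole_words
   \<and> length two_hole_words = 40 \<and> distinct (map fst two_hole_words)"
  by code_simp

section \<open>Transport to arbitrary symbols\<close>

lemma posset_123: "posset {1, 2, 3}"
  by (simp add: posset_def)

abbreviation sperms3 :: "int list set" where
  "sperms3 \<equiv> sperms {1, 2, 3} []"

lemma card_sperms3: "finite sperms3" "card sperms3 = 48"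
  using card_sperms[OF posset_123, of "[]"] by (simp_all add: eval_nat_numeral)

lemma is_sperm3_iff: "is_sperm3 u \<longleftrightarrow> u \<in> sperms3"
proof
  assume u: "is_sperm3 u"
  have "card (abs ` set u) = 3"
    using u distinct_card[of "map abs u"] by (simp add: is_sperm3_def)
  moreover have "abs ` set u \<subseteq> {1, 2, 3}" using u by (auto simp: is_sperm3_def list_all_iff)
  ultimately have "abs ` set u = {1, 2, 3}" by (intro card_subset_eq) auto
  then have "u @ [] \<in> sperms3" using u by (intro spermsI) (simp_all add: is_sperm3_def)
  then show "u \<in> sperms3" by simp
next
  assume "u \<in> sperms3"
  then obtain v where v: "u = v @ []" "distinct (map abs v)" "abs ` set v = {1, 2, 3}"
    "length v = card {1, 2, 3::int}"
    by (rule spermsE[OF _ posset_123])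
  then show "is_sperm3 u" unfolding is_sperm3_def list_all_iff by auto
qed

lemma id_sperms3: "[1, 2, 3] \<in> sperms3"
  unfolding is_sperm3_iff[symmetric] by (simp add: is_sperm3_def)

lemma length_sperms3: "u \<in> sperms3 \<Longrightarrow> length u = 3"
  unfolding is_sperm3_iff[symmetric] by (simp add: is_sperm3_def)

lemma spr_sperms3: "u \<in> sperms3 \<Longrightarrow> k \<le> 3 \<Longrightarrow> spr k u \<in> sperms3"
  using spr_sperms[OF posset_123] by simp

lemma walk_props:
  assumes "s \<in> sperms3" and "list_all (\<lambda>k. k \<in> {1, 2, 3}) ks"
  shows "walk ks s \<noteq> [] \<and> hd (walk ks s) = s \<and> set (walk ks s) \<subseteq> sperms3
    \<and> successively (padj {} 3) (walk ks s)"
  using assms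
proof (induction ks arbitrary: s)
  case (Cons k ks)
  have s': "spr k s \<in> sperms3" using Cons.prems by (intro spr_sperms3) auto
  have "padj {} 3 s (spr k s)" using Cons.prems length_sperms3[of s] unfolding padj_def by auto
  with Cons.IH[OF s'] Cons.prems show ?case by (auto simp: successively_Cons)
qed simp

lemma good_walkD:
  assumes "good_walk W s ks" "set W \<subseteq> sperms3" "s \<in> sperms3"
  shows "hpath (padj {} 3) (sperms3 - set W) s (last (walk ks s))"
proof -
  let ?p = "walk ks s"
  have d: "distinct (W @ ?p)" "length (W @ ?p) = 48" "list_all (\<lambda>k. k \<in> {1, 2, 3}) ks"
    using assms(1) unfolding good_walk_def by blast+
  have p: "?p \<noteq> []" "hd ?p = s" "set ?p \<subseteq> sperms3" "successively (padj {} 3) ?p"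
    using walk_props[OF assms(3) d(3)] by blast+
  have "card (set (W @ ?p)) = card sperms3" using distinct_card[OF d(1)] d(2) card_sperms3 by simp
  moreover have "set (W @ ?p) \<subseteq> sperms3" using assms(2) p(3) by simp
  ultimately have "set (W @ ?p) = sperms3" using card_sperms3(1) by (intro card_subset_eq)
  then have "set ?p = sperms3 - set W" using d(1) by auto
  with p d(1) show ?thesis by (intro hpathI[of ?p]) simp_all
qed

lemma closes_padj:
  assumes "closes s w" "last (walk w s) \<in> sperms3"
  shows "padj {} 3 (last (walk w s)) s"
  using assms length_sperms3[OF assms(2)] unfolding closes_def padj_def by auto

text \<open>
  The signed renaming that sends \<open>[1, 2, 3]\<close> to the first three entries of \<open>v\<close>. It acts on symbols, whereas
  the reversals act on positions, so the two commute, and everything computed at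
  \<open>[1, 2, 3]\<close> holds at \<open>v\<close>.\<close>

definition rename :: "int list \<Rightarrow> int \<Rightarrow> int" where
  "rename v i = sgn i * v ! (nat \<bar>i\<bar> - 1)"

definition transport :: "int list \<Rightarrow> int list \<Rightarrow> int list \<Rightarrow> int list" where
  "transport z v x = map (rename v) x @ z"

locale base =
  fixes A :: "int set" and z v :: "int list"
  assumes A: "posset A" "card A = 3" and v: "v \<in> sperms A z"
begin

lemma rename_uminus: "rename v (- i) = - rename v i"
  by (simp add: rename_def sgn_if)

lemma transport_spr:
  assumes "x \<in> sperms3" "k \<le> 3"
  shows "transport z v (spr k x) = spr k (transport z v x)"
proof -
  have "k \<le> length x" using length_sperms3 assms by simp
  then show ?thesis
    by (simp add: transport_def signed_prefix_reversal_def rename_uminus o_def take_map drop_map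
        rev_map)
qed

lemma rename_abs:
  assumes "\<bar>i\<bar> \<in> {1, 2, 3}"
  shows "\<bar>rename v i\<bar> = \<bar>v ! (nat \<bar>i\<bar> - 1)\<bar>" "nat \<bar>i\<bar> - 1 < card A" "\<bar>rename v i\<bar> \<in> A"
proof -
  show *: "\<bar>rename v i\<bar> = \<bar>v ! (nat \<bar>i\<bar> - 1)\<bar>" "nat \<bar>i\<bar> - 1 < card A"
    using assms A(2) by (auto simp: rename_def abs_mult)
  show "\<bar>rename v i\<bar> \<in> A" unfolding *(1) by (rule sperms_nth_abs[OF A(1) v *(2)])
qed

lemma rename_inj:
  assumes "\<bar>i\<bar> \<in> {1, 2, 3}" "\<bar>j\<bar> \<in> {1, 2, 3}" "rename v i = rename v j"
  shows "i = j"
proof -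
  have "nat \<bar>i\<bar> - 1 = nat \<bar>j\<bar> - 1"
    using sperms_nth_neq[OF A(1) v, of "nat \<bar>i\<bar> - 1" "nat \<bar>j\<bar> - 1"] rename_abs[OF assms(1)]
      rename_abs[OF assms(2)] assms(3) by metis
  then have a: "\<bar>i\<bar> = \<bar>j\<bar>" using assms(1,2) by auto
  have "i = j \<or> i = - j" using a by linarith
  moreover have "rename v j \<noteq> 0"
  proof -
    have "v ! (nat \<bar>j\<bar> - 1) \<noteq> 0"
      using sperms_nth_abs(2)[OF A(1) v] rename_abs(2)[OF assms(2)] by blast
    then show ?thesis using rename_abs(1)[OF assms(2)] by linarith
  qed
  ultimately show ?thesis using assms(3) rename_uminus[of j] by auto
qed

lemma rename_uminus_one: "rename v (- 1) = out v"
  by (simp add: rename_def out_def)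

lemma transport_in: "x \<in> sperms3 \<Longrightarrow> transport z v x \<in> sperms A z"
proof -
  assume "x \<in> sperms3"
  then have x: "length x = 3" "distinct (map abs x)" "\<And>i. i \<in> set x \<Longrightarrow> \<bar>i\<bar> \<in> {1, 2, 3}"
    unfolding is_sperm3_iff[symmetric] is_sperm3_def list_all_iff by blast+
  have "inj_on abs (set x)" using x(2) by (simp add: distinct_map)
  have "inj_on (\<lambda>i. \<bar>rename v i\<bar>) (set x)"
  proof (rule inj_onI)
    fix i j assume i: "i \<in> set x" "j \<in> set x" "\<bar>rename v i\<bar> = \<bar>rename v j\<bar>"
    then have "rename v i = rename v j \<or> rename v i = rename v (- j)"
      unfolding rename_uminus by linarith
    then have "i = j \<or> i = - j"
      using rename_inj[of i j] rename_inj[of i "- j"] x(3)[OF i(1)] x(3)[OF i(2)] by auto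
    then have "\<bar>i\<bar> = \<bar>j\<bar>" by auto
    then show "i = j" using \<open>inj_on abs (set x)\<close> i(1,2) by (auto dest: inj_onD)
  qed
  then have d: "distinct (map abs (map (rename v) x))"
    using x(2) by (simp add: distinct_map o_def)
  have "abs ` set (map (rename v) x) \<subseteq> A" using x(3) rename_abs(3) by auto
  moreover have "card (abs ` set (map (rename v) x)) = 3" using distinct_card[OF d] x(1) by (simp add: image_image)
  ultimately have "abs ` set (map (rename v) x) = A"
    using A posset_finite by (intro card_subset_eq) auto
  with d show ?thesis unfolding transport_def by (rule spermsI)
qed

lemma transport_inj: "inj_on (transport z v) sperms3"
proof (rule inj_onI)
  fix x y assume "x \<in> sperms3" "y \<in> sperms3" and e: "transport z v x = transport z v y"
  then have x: "\<And>i. i \<in> set x \<Longrightarrow> \<bar>i\<bar> \<in> {1, 2, 3}" "\<And>i. i \<in> set y \<Longrightarrow> \<bar>i\<bar> \<in> {1, 2, 3}"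
    unfolding is_sperm3_iff[symmetric] is_sperm3_def list_all_iff by blast+
  have "inj_on (rename v) (set x \<union> set y)"
    using x rename_inj by (intro inj_onI) blast
  with e show "x = y" unfolding transport_def by (simp add: inj_on_map_eq_map)
qed

lemma transport_onto: "transport z v ` sperms3 = sperms A z"
proof (rule card_subset_eq)
  show "card (transport z v ` sperms3) = card (sperms A z)"
    using card_sperms[OF A(1), of z] A(2) card_sperms3 transport_inj
    by (simp add: card_image eval_nat_numeral)
qed (use transport_in card_sperms[OF A(1), of z] in auto)

lemma transport_id: "transport z v [1, 2, 3] = v"
proof -
  obtain u where u: "v = u @ z" "length u = 3"
    using v A by (auto elim: spermsE)
  then obtain p q r where "u = [p, q, r]" by (auto simp: numeral_3_eq_3 length_Suc_conv)
  then show ?thesis using u by (simp add: transport_def rename_def)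
qed

lemma transport_out: "x \<in> sperms3 \<Longrightarrow> out (transport z v x) = rename v (out x)"
  using length_sperms3[of x] by (simp add: out_def transport_def nth_append rename_uminus)

lemma transport_padj:
  assumes "padj {} 3 x y" "x \<in> sperms3"
  shows "padj {} 3 (transport z v x) (transport z v y)"
proof -
  obtain j where "j \<in> {1..3}" "y = spr j x" using assms(1) unfolding padj_def by blast
  then show ?thesis
    using transport_spr[OF assms(2), of j] length_sperms3[OF assms(2)]
    unfolding padj_def by (auto simp: transport_def)
qed

lemma transport_hpath:
  assumes "hpath (padj {} 3) (sperms3 - W) x y" "W \<subseteq> sperms3"
  shows "hpath (padj {} 3) (sperms A z - transport z v ` W) (transport z v x) (transport z v y)"
proof -
  obtain xs where xs: "xs \<noteq> []" "hd xs = x" "last xs = y" "distinct xs" "set xs = sperms3 - W"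
    "successively (padj {} 3) xs"
    using assms(1) by (rule hpathE)
  have "inj_on (transport z v) (set xs)" 
    unfolding xs(5) by (rule inj_on_subset[OF transport_inj]) blast
  moreover have "transport z v ` set xs = sperms A z - transport z v ` W"
    unfolding xs(5) using inj_on_image_set_diff[OF transport_inj, of sperms3 W] assms(2)
      transport_onto by simp
  moreover have "successively (padj {} 3) (map (transport z v) xs)"
    unfolding successively_map using xs(6)
    by (rule successively_mono) (use xs(5) transport_padj in auto)
  ultimately show ?thesis
    using xs(1-4) by (intro hpathI[of "map (transport z v) xs"])
      (simp_all add: hd_map last_map distinct_map)
qed

lemma from_v:
  assumes "y \<in> sperms A z" "y \<noteq> v"
  shows "hpath (padj {} 3) (sperms A z) v y"
proof -
  have w: "\<And>w. w \<in> set ham_words \<Longrightarrow> good_walk [] [1,2,3] w" "length ham_words = 47"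
    "distinct ([1,2,3] # map (\<lambda>w. last (walk w [1,2,3])) ham_words)"
    using ham_words unfolding list_all_iff by blast+
  let ?T = "(\<lambda>w. last (walk w [1,2,3])) ` set ham_words"
  have hp: "hpath (padj {} 3) sperms3 [1,2,3] (last (walk w [1,2,3]))" if "w \<in> set ham_words" for w
    using good_walkD[OF w(1)[OF that] _ id_sperms3] by simp
  have "card (insert [1,2,3] ?T) = 48"
    using distinct_card[OF w(3)] w(2) by simp
  moreover have "insert [1,2,3] ?T \<subseteq> sperms3"
    using id_sperms3 hpath_ends[OF hp] by (auto simp del: set_map)
  ultimately have T: "insert [1,2,3] ?T = sperms3"
    using card_sperms3 by (intro card_subset_eq) auto
  obtain x where x: "x \<in> sperms3" "y = transport z v x" using transport_onto assms(1) by blast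
  have "x \<noteq> [1,2,3]" using assms(2) transport_id x(2) by auto
  then have "x \<in> ?T" using T x(1) by blast
  then obtain w where w: "w \<in> set ham_words" "x = last (walk w [1,2,3])" by blast
  then have "hpath (padj {} 3) (sperms3 - {}) [1,2,3] x" using hp by simp
  from transport_hpath[OF this] show ?thesis using transport_id x(2) by simp
qed

lemma cycle_avoiding:
  assumes "W = {v} \<or> (\<exists>k \<in> {1..3}. W = {v, spr k v})"
  shows "hcycle (padj {} 3) (sperms A z - W)"
proof -
  have "\<exists>U s w. (U, s, w) \<in> set cycle_words \<and> W = transport z v ` set U \<and> set U \<subseteq> sperms3"
  proof -
    have m: "map fst cycle_words = [[[1,2,3]], [[1,2,3], spr 1 [1,2,3]], [[1,2,3], spr 2 [1,2,3]],
      [[1,2,3], spr 3 [1,2,3]]]"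
      using cycle_words by blast
    consider "W = {v}" | k where "k \<in> {1..3}" "W = {v, spr k v}" using assms by blast
    then show ?thesis
    proof cases
      case 1
      have "[[1,2,3]] \<in> set (map fst cycle_words)" unfolding m by auto
      then obtain s w where "([[1,2,3]], s, w) \<in> set cycle_words" by force
      moreover have "W = transport z v ` set [[1,2,3]]" using 1 transport_id by simp
      moreover have "set [[1,2,3]] \<subseteq> sperms3" using id_sperms3 by simp
      ultimately show ?thesis by blast
    next
      case 2
      have k: "k = 1 \<or> k = 2 \<or> k = 3" using 2(1) by auto
      then have "[[1,2,3], spr k [1,2,3]] \<in> set (map fst cycle_words)" unfolding m by auto
      then obtain s w where "([[1,2,3], spr k [1,2,3]], s, w) \<in> set cycle_words" by force
      moreover have "W = transport z v ` set [[1,2,3], spr k [1,2,3]]"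
        using 2 transport_id transport_spr[OF id_sperms3, of k] by simp
      moreover have "set [[1,2,3], spr k [1,2,3]] \<subseteq> sperms3"
        using id_sperms3 spr_sperms3[OF id_sperms3, of k] 2(1) by simp
      ultimately show ?thesis by blast
    qed
  qed
  then obtain U s w where u: "(U, s, w) \<in> set cycle_words" "W = transport z v ` set U"
    "set U \<subseteq> sperms3" by blast
  have g: "good_walk U s w" "s \<in> sperms3" "closes s w"
    using cycle_words u(1) unfolding list_all_iff is_sperm3_iff by blast+
  note h = good_walkD[OF g(1) u(3) g(2)]
  have l: "last (walk w s) \<in> sperms3" using hpath_ends[OF h] by blast
  note c = transport_padj[OF closes_padj[OF g(3) l] l]
  have "card W \<le> 2" using assms by (auto simp: card_insert_if)
  moreover have "finite W" using assms by auto
  moreover have "card (sperms A z) = 48"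
    using card_sperms[OF A(1), of z] A(2) by (simp add: eval_nat_numeral)
  ultimately have "3 \<le> card (sperms A z - W)"
    using diff_card_le_card_Diff[of W "sperms A z"] by simp
  with transport_hpath[OF h u(3)] c show ?thesis unfolding u(2) by (rule hpath_imp_hcycle)
qed

lemma cycle_avoiding_edge:
  assumes "k \<in> {1..3}"
  shows "hcycle (padj {{v, spr k v}} 3) (sperms A z)"
proof -
  have len: "length edge_cycle_words = 3" using edge_cycle_words by blast
  have "(k, edge_cycle_words ! (k - 1)) \<in> set (zip [1,2,3] edge_cycle_words)"
  proof -
    have "k = 1 \<or> k = 2 \<or> k = 3" using assms by auto
    then show ?thesis using len unfolding set_zip by (auto intro!: exI[of _ "k - 1"])
  qed
  then obtain w where w: "good_walk [] [1,2,3] w" "closes [1,2,3] w"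
    "spr k [1,2,3] \<notin> {walk w [1,2,3] ! 1, last (walk w [1,2,3])}"
    using edge_cycle_words unfolding list_all_iff by fast
  let ?p = "walk w [1,2,3]"
  let ?b = "spr k [1,2,3]"
  have d: "distinct ?p" "length ?p = 48" "list_all (\<lambda>k. k \<in> {1, 2, 3}) w"
    using w(1) unfolding good_walk_def by auto
  have p: "?p \<noteq> []" "hd ?p = [1,2,3]" "set ?p \<subseteq> sperms3" "successively (padj {} 3) ?p"
    using walk_props[OF id_sperms3 d(3)] by blast+
  have set: "set ?p = sperms3"
    using card_sperms3 p(3) distinct_card[OF d(1)] d(2) by (intro card_subset_eq) auto
  let ?q = "map (transport z v) ?p"
  obtain ys where ys: "?p = [1,2,3] # ys" using p(1,2) by (cases ?p) auto
  have yne: "ys \<noteq> []" using ys d(2) by auto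
  have tinj: "transport z v x = transport z v y \<longleftrightarrow> x = y" if "x \<in> sperms3" "y \<in> sperms3" for x y
    using transport_inj that by (auto dest: inj_onD)
  have b: "?b \<in> sperms3" using spr_sperms3[OF id_sperms3] assms by simp
  have tb: "transport z v ?b = spr k v" using transport_spr[OF id_sperms3, of k] assms transport_id by simp
  have step: "padj {{v, spr k v}} 3 (transport z v x) (transport z v y)"
    if "padj {} 3 x y" "x \<in> sperms3" "y \<in> sperms3" "{x, y} \<noteq> {[1,2,3], ?b}" for x y
  proof -
    have "{transport z v x, transport z v y} \<noteq> {v, spr k v}"
      using that tinj b id_sperms3 tb transport_id unfolding doubleton_eq_iff by metis
    then show ?thesis using transport_padj[OF that(1,2)] unfolding padj_def by auto
  qed
  have y: "[1,2,3] \<notin> set ys" "successively (padj {} 3) ys" "padj {} 3 [1,2,3] (hd ys)"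
    using d(1) p(4) ys yne by (auto simp: successively_Cons)
  have "hd ys \<noteq> ?b" using w(3) ys yne by (auto simp: hd_conv_nth)
  have ysub: "set ys \<subseteq> sperms3" using ys set by auto
  have "successively (padj {{v, spr k v}} 3) (map (transport z v) ys)"
    unfolding successively_map using y(2)
    by (rule successively_mono) (use step ysub y(1) in \<open>auto simp: doubleton_eq_iff\<close>)
  moreover have "padj {{v, spr k v}} 3 v (transport z v (hd ys))"
  proof -
    have "hd ys \<in> set ys" using yne by simp
    then have "hd ys \<in> sperms3" "hd ys \<noteq> [1,2,3]" using ysub y(1) by auto
    then show ?thesis
      using step[OF y(3) id_sperms3] \<open>hd ys \<noteq> ?b\<close> transport_id
      by (simp add: doubleton_eq_iff)
  qed
  ultimately have s: "successively (padj {{v, spr k v}} 3) ?q"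
    using ys yne by (simp add: successively_Cons hd_map transport_id)
  have l: "last ?p \<in> sperms3" using p by auto
  have "last ys \<noteq> [1,2,3]" using y(1) yne last_in_set by metis
  then have "last ?p \<noteq> ?b" "last ?p \<noteq> [1,2,3]" using w(3) ys yne by auto
  then have "padj {{v, spr k v}} 3 (transport z v (last ?p)) (transport z v [1,2,3])"
    using closes_padj[OF w(2) l] l id_sperms3 by (intro step) (auto simp: doubleton_eq_iff)
  moreover have "last ?q = transport z v (last ?p)" using p(1) by (simp add: last_map)
  moreover have "hd ?q = transport z v [1,2,3]" using p(1,2) by (simp add: hd_map)
  ultimately have c: "padj {{v, spr k v}} 3 (last ?q) (hd ?q)" by simp
  have "distinct ?q" using d(1) transport_inj set by (simp add: distinct_map)
  moreover have "set ?q = sperms A z" using set transport_onto by simp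
  ultimately show ?thesis unfolding hcycle_def using s c d(2) by (intro exI[of _ ?q]) simp
qed

lemma rename_onto:
  assumes "g \<in> labels A"
  obtains i where "\<bar>i\<bar> \<in> {1, 2, 3}" "rename v i = g"
proof -
  have "(\<lambda>i. \<bar>rename v i\<bar>) ` {1, 2, 3} = A"
  proof (rule card_subset_eq)
    have "inj_on (\<lambda>i. \<bar>rename v i\<bar>) {1, 2, 3}"
    proof (rule inj_onI)
      fix i j :: int assume i: "i \<in> {1, 2, 3}" "j \<in> {1, 2, 3}" "\<bar>rename v i\<bar> = \<bar>rename v j\<bar>"
      then have "rename v i = rename v j \<or> rename v i = rename v (- j)"
        unfolding rename_uminus by linarith
      then have "i = j \<or> i = - j" using rename_inj[of i j] rename_inj[of i "- j"] i by auto
      then show "i = j" using i by auto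
    qed
    then show "card ((\<lambda>i. \<bar>rename v i\<bar>) ` {1, 2, 3}) = card A" using A(2) by (simp add: card_image)
    show "(\<lambda>i. \<bar>rename v i\<bar>) ` {1, 2, 3} \<subseteq> A" using rename_abs(3) by force
  qed (use A posset_finite in auto)
  moreover have "\<bar>g\<bar> \<in> A" using assms A(1) by (simp add: labels_iff)
  ultimately obtain i where i: "i \<in> {1, 2, 3}" "\<bar>g\<bar> = \<bar>rename v i\<bar>" by blast
  then have "rename v i = g \<or> rename v (- i) = g" unfolding rename_uminus by linarith
  then show thesis using that[of i] that[of "- i"] i(1) by auto
qed

text \<open>
  Stronger than Hamiltonicity: for three symbols the counting arguments that cut a cycle at a suitable
  place break down, and this replaces them.\<close>

lemma one_hole:
  assumes "g \<in> labels A" "h \<in> labels A" "g \<noteq> h" "g \<noteq> out v" "h \<noteq> out v"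
  obtains x y where "hpath (padj {} 3) (sperms A z - {v}) x y" "out x = g" "out y = h"
proof -
  obtain i where i: "\<bar>i\<bar> \<in> {1, 2, 3}" "rename v i = g" using rename_onto[OF assms(1)] .
  obtain j where j: "\<bar>j\<bar> \<in> {1, 2, 3}" "rename v j = h" using rename_onto[OF assms(2)] .
  have ne: "i \<noteq> j" "i \<noteq> - 1" "j \<noteq> - 1" using i j assms rename_uminus_one by auto
  let ?P = "[(1,2), (1,-2), (1,3), (1,-3), (2,-2), (2,3), (2,-3), (-2,3), (-2,-3), (3,-3)] :: (int \<times> int) list"
  have m: "map (\<lambda>(s, w). (- s ! 0, - last (walk w s) ! 0)) one_hole_words = ?P"
    and la: "\<And>s w. (s, w) \<in> set one_hole_words \<Longrightarrow> good_walk [[1,2,3]] s w \<and> s \<in> sperms3"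
    using one_hole_words unfolding list_all_iff is_sperm3_iff by (blast, blast)
  have ex: "\<exists>x y. hpath (padj {} 3) (sperms A z - {v}) x y \<and> out x = rename v p \<and> out y = rename v q"
    if pq: "(p, q) \<in> set ?P" for p q
  proof -
    have "(p, q) \<in> set (map (\<lambda>(s, w). (- s ! 0, - last (walk w s) ! 0)) one_hole_words)"
      unfolding m by (rule pq)
    then have "(p, q) \<in> (\<lambda>(s, w). (- s ! 0, - last (walk w s) ! 0)) ` set one_hole_words"
      by (simp only: set_map)
    then obtain s w where w: "(s, w) \<in> set one_hole_words" "p = out s" "q = out (last (walk w s))"
      unfolding out_def by (auto simp only: image_iff split: prod.splits)
    have g: "good_walk [[1,2,3]] s w" "s \<in> sperms3" using la[OF w(1)] by blast+
    have h: "hpath (padj {} 3) (sperms3 - {[1,2,3]}) s (last (walk w s))"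
      using good_walkD[OF g(1) _ g(2)] id_sperms3 by simp
    have l: "last (walk w s) \<in> sperms3" using hpath_ends[OF h] by blast
    have "hpath (padj {} 3) (sperms A z - {v}) (transport z v s) (transport z v (last (walk w s)))"
      using transport_hpath[OF h] id_sperms3 transport_id by simp
    moreover have "out (transport z v s) = rename v p" "out (transport z v (last (walk w s))) = rename v q"
      unfolding w(2,3) by (rule transport_out[OF g(2)] transport_out[OF l])+
    ultimately show ?thesis by blast
  qed
  have c: "i \<in> {1, 2, -2, 3, -3}" "j \<in> {1, 2, -2, 3, -3}" using i j ne by auto
  then have "(i, j) \<in> set ?P \<or> (j, i) \<in> set ?P"
    using ne(1) by (elim insertE emptyE) simp_all
  then show thesis
  proof
    assume "(i, j) \<in> set ?P"
    from ex[OF this] obtain x y where "hpath (padj {} 3) (sperms A z - {v}) x y"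
      "out x = rename v i" "out y = rename v j" by blast
    then show thesis using i(2) j(2) by (intro that) simp_all
  next
    assume "(j, i) \<in> set ?P"
    from ex[OF this] obtain x y where "hpath (padj {} 3) (sperms A z - {v}) x y"
      "out x = rename v j" "out y = rename v i" by blast
    then show thesis using i(2) j(2) hpath_rev[OF symp_padj] by (intro that) simp_all
  qed
qed

lemma two_holes:
  assumes "u \<in> sperms A z" "out u \<noteq> out v"
  obtains x y where "hpath (padj {} 3) (sperms A z - {v, u}) x y" "out x \<noteq> out y"
    "out x \<notin> {out v, out u}" "out y \<notin> {out v, out u}"
proof -
  have all: "\<And>u s w. (u, s, w) \<in> set two_hole_words \<Longrightarrow> good_walk [[1,2,3], u] s w \<and> s \<in> sperms3
      \<and> u \<in> sperms3 \<and> u ! 0 \<noteq> 1 \<and> s ! 0 \<noteq> last (walk w s) ! 0 \<and> s ! 0 \<notin> {1, u ! 0}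
      \<and> last (walk w s) ! 0 \<notin> {1, u ! 0}"
    and len: "length two_hole_words = 40" and dist: "distinct (map fst two_hole_words)"
    using two_hole_words unfolding list_all_iff is_sperm3_iff by (blast, blast, blast)
  obtain u' where u': "u' \<in> sperms3" "u = transport z v u'" using transport_onto assms(1) by blast
  have "out u' \<noteq> - 1" using assms(2) transport_out[OF u'(1)] u'(2) rename_uminus_one by auto
  have "fst ` set two_hole_words = sperms3 - {x \<in> sperms3. x ! 0 = 1}"
  proof (rule card_subset_eq)
    show "fst ` set two_hole_words \<subseteq> sperms3 - {x \<in> sperms3. x ! 0 = 1}" using all by force
    have "card {x \<in> sperms3. x ! 0 = 1} = 8"
      using card_head_class[OF posset_123, of 1 2 "[]"] by (simp add: labels_def eval_nat_numeral)
    then have "card (sperms3 - {x \<in> sperms3. x ! 0 = 1}) = 40"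
      using card_sperms3 by (subst card_Diff_subset) auto
    moreover have "card (fst ` set two_hole_words) = 40"
      using distinct_card[OF dist] len by simp
    ultimately show "card (fst ` set two_hole_words) = card (sperms3 - {x \<in> sperms3. x ! 0 = 1})"
      by simp
  qed (use card_sperms3 in simp)
  then have "u' \<in> fst ` set two_hole_words" using u'(1) \<open>out u' \<noteq> - 1\<close>
    by (simp add: out_def)
  then obtain q where q: "q \<in> set two_hole_words" "u' = fst q" by (rule imageE)
  obtain s w where "q = (u', s, w)" using q(2) by (metis prod.collapse)
  with q(1) have w: "(u', s, w) \<in> set two_hole_words" by simp
  note a = all[OF w]
  let ?t = "last (walk w s)"
  have h: "hpath (padj {} 3) (sperms3 - {[1,2,3], u'}) s ?t"
    using good_walkD[of "[[1,2,3], u']" s w] a id_sperms3 by simp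
  have t: "?t \<in> sperms3" using hpath_ends[OF h] by simp
  have "hpath (padj {} 3) (sperms A z - {v, u}) (transport z v s) (transport z v ?t)"
    using transport_hpath[OF h] id_sperms3 u' transport_id by simp
  moreover have r: "out (transport z v x) = out (transport z v y) \<longleftrightarrow> x ! 0 = y ! 0"
    if "x \<in> sperms3" "y \<in> sperms3" for x y
  proof -
    have "\<bar>out q\<bar> \<in> {1, 2, 3}" if "q \<in> sperms3" for q
      using sperms_nth_abs(1)[OF posset_123 that, of 0] by (simp add: out_def)
    then have "rename v (out x) = rename v (out y) \<longleftrightarrow> out x = out y"
      using rename_inj that by metis
    then show ?thesis using transport_out that by (simp add: out_def)
  qed
  have v: "v = transport z v [1,2,3]" using transport_id by simp
  have "out (transport z v s) \<noteq> out (transport z v ?t)"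
    using a r[of s ?t] t by blast
  moreover have "out (transport z v s) \<noteq> out u" "out (transport z v ?t) \<noteq> out u"
    unfolding u'(2) using a r[of s u'] r[of ?t u'] t by blast+
  moreover have "out (transport z v s) \<noteq> out v" "out (transport z v ?t) \<noteq> out v"
    using a r[of s "[1,2,3]"] r[of ?t "[1,2,3]"] t id_sperms3 unfolding transport_id by simp_all
  ultimately show thesis using that by blast
qed

end

section \<open>Faults\<close>

definition fault_family :: "int set \<Rightarrow> int list \<Rightarrow> int list set set \<Rightarrow> bool" where
  "fault_family A z M \<longleftrightarrow> finite M \<and> pairwise disjnt M
     \<and> (\<forall>e \<in> M. \<exists>v \<in> sperms A z. e = {v} \<or> (\<exists>k \<in> {1..card A}. e = {v, spr k v}))"

text \<open>
  The statement of the induction. Vertex faults have to be admitted because a pair that joins two copies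
  leaves a single vertex in each of them.\<close>

definition fault_tolerant :: "int set \<Rightarrow> int list \<Rightarrow> bool" where
  "fault_tolerant A z \<longleftrightarrow> (\<forall>M D. fault_family A z M \<and> finite D \<and> {} \<notin> D \<longrightarrow>
     (card M + card D + 2 \<le> card A \<longrightarrow> hcycle (padj D (card A)) (sperms A z - \<Union>M)) \<and>
     (card M + card D + 3 \<le> card A \<longrightarrow> (\<forall>x \<in> sperms A z - \<Union>M. \<forall>y \<in> sperms A z - \<Union>M.
        x \<noteq> y \<longrightarrow> hpath (padj D (card A)) (sperms A z - \<Union>M) x y)))"

lemma fault_tolerantD:
  assumes "fault_tolerant A z" "fault_family A z M" "finite D" "{} \<notin> D"
  shows "card M + card D + 2 \<le> card A \<Longrightarrow> hcycle (padj D (card A)) (sperms A z - \<Union>M)"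
    and "card M + card D + 3 \<le> card A \<Longrightarrow> x \<in> sperms A z - \<Union>M \<Longrightarrow> y \<in> sperms A z - \<Union>M
      \<Longrightarrow> x \<noteq> y \<Longrightarrow> hpath (padj D (card A)) (sperms A z - \<Union>M) x y"
  using assms unfolding fault_tolerant_def by simp_all

lemma fault_tolerant_base:
  assumes "posset A" "card A = 3"
  shows "fault_tolerant A z"
  unfolding fault_tolerant_def
proof (intro allI impI conjI ballI)
  fix M D :: "int list set set"
  assume "fault_family A z M \<and> finite D \<and> {} \<notin> D"
  then have M: "fault_family A z M" and D: "finite D" by blast+
  have finM: "finite M" using M by (simp add: fault_family_def)
  have b: "base A z v" if "v \<in> sperms A z" for v using assms that by unfold_locales
  have "sperms A z \<noteq> {}" using card_sperms[OF assms(1), of z] by auto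
  then obtain v0 where v0: "v0 \<in> sperms A z" by blast
  {
    assume "card M + card D + 2 \<le> card A"
    then have le: "card M + card D \<le> 1" using assms by simp
    consider (none) "M = {}" "D = {}" | (vert) e where "M = {e}" "D = {}" | (edge) d where "M = {}" "D = {d}"
    proof -
      consider "card M = 0" "card D = 0" | "card M = 1" "card D = 0" | "card M = 0" "card D = 1"
        using le by linarith
      then show thesis
      proof cases
        case 1
        then show ?thesis using none finM D by simp
      next
        case 2
        from 2(1) obtain e where "M = {e}" by (rule card_1_singletonE)
        then show ?thesis using vert 2(2) D by simp
      next
        case 3
        from 3(2) obtain d where "D = {d}" by (rule card_1_singletonE)
        then show ?thesis using edge 3(1) finM by simp
      qed
    qed
    then show "hcycle (padj D (card A)) (sperms A z - \<Union>M)"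
    proof cases
      case none
      have "hcycle (padj {{v0, spr 1 v0}} 3) (sperms A z)"
        by (rule base.cycle_avoiding_edge[OF b[OF v0]]) simp
      then have "hcycle (padj {} 3) (sperms A z)" by (rule hcycle_mono) (simp add: padj_def)
      then show ?thesis unfolding none assms(2) by simp
    next
      case vert
      then obtain v where v: "v \<in> sperms A z" "e = {v} \<or> (\<exists>k \<in> {1..3}. e = {v, spr k v})"
        using M assms(2) unfolding fault_family_def by auto
      from base.cycle_avoiding[OF b[OF v(1)] v(2)] show ?thesis unfolding vert assms(2) by simp
    next
      case edge
      show ?thesis
      proof (cases "\<exists>v \<in> sperms A z. \<exists>k \<in> {1..3}. d = {v, spr k v}")
        case True
        then obtain v k where v: "v \<in> sperms A z" "k \<in> {1..3}" "d = {v, spr k v}" by blast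
        from base.cycle_avoiding_edge[OF b[OF v(1)] v(2)] v(3) show ?thesis
          unfolding edge assms(2) by simp
      next
        case False
        have "hcycle (padj {{v0, spr 1 v0}} 3) (sperms A z)"
          by (rule base.cycle_avoiding_edge[OF b[OF v0]]) simp
        then have "hcycle (padj {d} 3) (sperms A z)"
        proof (rule hcycle_mono)
          fix u w assume u: "u \<in> sperms A z" "padj {{v0, spr 1 v0}} 3 u w"
          then obtain k where "k \<in> {1..3}" "w = spr k u" "3 \<le> length u" unfolding padj_def by blast
          moreover from this have "d \<noteq> {u, w}" using False u(1) by blast
          ultimately show "padj {d} 3 u w" unfolding padj_def by auto
        qed
        then show ?thesis unfolding edge assms(2) by simp
      qed
    qed
  }
  fix x y
  assume "card M + card D + 3 \<le> card A" "x \<in> sperms A z - \<Union>M" "y \<in> sperms A z - \<Union>M" "x \<noteq> y"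
  moreover from this have "M = {}" "D = {}" using assms finM D by auto
  ultimately show "hpath (padj D (card A)) (sperms A z - \<Union>M) x y"
    using base.from_v[OF b, of x y] assms(2) by simp
qed

section \<open>The decomposition into copies\<close>

text \<open>
  One step of the induction, from \<open>m\<close> to \<open>m + 1\<close> symbols.\<close>

locale copies =
  fixes A :: "int set" and z :: "int list" and m :: nat
    and M :: "int list set set" and D :: "int list set set"
  assumes A: "posset A" "card A = Suc m" and m3: "3 \<le> m"
    and M: "fault_family A z M" and D: "finite D" "{} \<notin> D"
    and IH: "\<And>i. i \<in> labels A \<Longrightarrow> fault_tolerant (A - {\<bar>i\<bar>}) (i # z)"
begin

text \<open>
  The fault-free part \<open>live i\<close> of a copy is the set of its vertices that are not deleted; \<open>inner\<close> and
  \<open>step\<close> are the surviving adjacencies inside copies and in the whole graph. The number \<open>load i\<close> counts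
  the faults that matter to copy \<open>i\<close>: the vertex faults that meet it and the faulty edges inside it.
  A vertex is \<open>free\<close> if its edge to another copy survives, and \<open>K\<close> is the number of edges
  between two copies that are joined.\<close>

definition "L = labels A"
definition "copy i = sperms (A - {\<bar>i\<bar>}) (i # z)"
definition "W = \<Union>M"
definition "live i = copy i - W"
definition "cross = spr (Suc m)"
definition "inner = padj D m"
definition "step = padj D (Suc m)"
definition "faults = card M + card D"
definition "touching i = {e \<in> M. e \<inter> copy i \<noteq> {}}"
definition "edges_in i = {d \<in> D. d \<subseteq> copy i}"
definition "load i = card (touching i) + card (edges_in i)"
definition "free x \<longleftrightarrow> cross x \<notin> W \<and> {x, cross x} \<notin> D"
definition "K = 2 ^ (m - 1) * (fact (m - 1) :: nat)"

lemma symp_step: "symp step" and symp_inner: "symp inner"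
  unfolding step_def inner_def by (rule symp_padj)+

lemma finM: "finite M"
  using M by (simp add: fault_family_def)

lemma finite_L: "finite L" and card_L: "card L = 2 * Suc m"
  unfolding L_def using finite_labels[OF A(1)] card_labels[OF A(1)] A(2) by auto

lemma L_uminus: "- i \<in> L \<longleftrightarrow> i \<in> L"
  unfolding L_def by (rule uminus_labels[OF A(1)])

lemma L_nonzero: "i \<in> L \<Longrightarrow> i \<noteq> - i"
  using label_nonzero[OF A(1)] unfolding L_def by fastforce

lemma posset_copy: "posset (A - {\<bar>i\<bar>})"
  using A(1) by (rule posset_remove)

lemma card_rest: "i \<in> L \<Longrightarrow> card (A - {\<bar>i\<bar>}) = m"
  using A unfolding L_def by (simp add: labels_iff posset_finite)

lemma copyD:
  assumes "i \<in> L" "x \<in> copy i"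
  shows "x \<in> sperms A z" "x ! m = i"
  using sperms_snocD[OF A(1) _ A(2)] assms unfolding L_def copy_def by blast+

lemma copyI:
  assumes "x \<in> sperms A z"
  shows "x ! m \<in> L" "x \<in> copy (x ! m)"
proof -
  show "x ! m \<in> L" unfolding L_def labels_iff[OF A(1)]
    using sperms_nth_abs(1)[OF A(1) assms] A(2) by simp
  show "x \<in> copy (x ! m)" unfolding copy_def by (rule sperms_snoc[OF A(1) assms A(2)])
qed

lemma copy_disjoint: "i \<in> L \<Longrightarrow> j \<in> L \<Longrightarrow> i \<noteq> j \<Longrightarrow> copy i \<inter> copy j = {}"
  using copyD(2) by blast

lemma sperms_eq: "sperms A z = (\<Union>i \<in> L. copy i)"
  using copyI copyD(1) by blast

lemma len: "x \<in> sperms A z \<Longrightarrow> Suc m \<le> length x"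
  using length_sperms[OF A(1)] A(2) by simp

lemma cross_facts:
  assumes "i \<in> L" "x \<in> copy i"
  shows "out x \<in> L" "out x \<noteq> i" "out x \<noteq> - i" "cross x \<in> copy (out x)" "out (cross x) = i"
    "cross (cross x) = x"
proof -
  note x = copyD[OF assms]
  have x0: "\<bar>x ! 0\<bar> \<in> A" using sperms_nth_abs(1)[OF A(1) x(1)] A(2) by simp
  then show "out x \<in> L" unfolding L_def labels_iff[OF A(1)] by (simp add: out_def)
  have "\<bar>x ! 0\<bar> \<noteq> \<bar>x ! m\<bar>" using sperms_nth_neq[OF A(1) x(1), of 0 m] A(2) m3 by simp
  then show "out x \<noteq> i" "out x \<noteq> - i" using x(2) by (auto simp: out_def)
  have c: "cross x \<in> sperms A z" unfolding cross_def using spr_sperms[OF A(1) x(1)] A(2) by simp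
  have "cross x ! m = out x" unfolding cross_def out_def using len[OF x(1)] by (subst nth_spr) auto
  then show "cross x \<in> copy (out x)" using copyI(2)[OF c] by simp
  show "out (cross x) = i" unfolding cross_def using out_spr[of "Suc m" x] len[OF x(1)] x(2) by simp
  show "cross (cross x) = x" unfolding cross_def using spr_spr[of "Suc m" x] len[OF x(1)] by simp
qed

lemma liveD: "x \<in> live i \<Longrightarrow> x \<in> copy i" "x \<in> live i \<Longrightarrow> x \<notin> W"
  unfolding live_def by blast+

lemma live_disjoint: "i \<in> L \<Longrightarrow> j \<in> L \<Longrightarrow> i \<noteq> j \<Longrightarrow> live i \<inter> live j = {}"
  using copy_disjoint unfolding live_def by blast

lemma inner_in:
  assumes "i \<in> L" "x \<in> copy i" "padj D' m x y"
  shows "y \<in> copy i" "out y \<noteq> out x"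
proof -
  obtain k where k: "k \<in> {1..m}" "y = spr k x" using assms(3) unfolding padj_def by blast
  show "y \<in> copy i" unfolding k(2) using k(1) spr_sperms[OF posset_copy] assms(2) card_rest[OF assms(1)]
    unfolding copy_def by simp
  note x = copyD[OF assms(1,2)]
  have "out y = x ! (k - 1)" unfolding k(2) using out_spr[of k x] k(1) len[OF x(1)] by simp
  moreover have "x ! (k - 1) \<noteq> - x ! 0"
  proof (cases "k = 1")
    case True
    then show ?thesis using sperms_nth_abs(2)[OF A(1) x(1), of 0] A(2) by auto
  next
    case False
    have "k - 1 < card A" "0 < card A" "k - 1 \<noteq> 0" using False A(2) k(1) by auto
    then have "\<bar>x ! (k - 1)\<bar> \<noteq> \<bar>x ! 0\<bar>" by (rule sperms_nth_neq[OF A(1) x(1)])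
    then show ?thesis by auto
  qed
  ultimately show "out y \<noteq> out x" by (simp add: out_def)
qed

text \<open>
  A reversal of length \<open>k\<close> brings the \<open>k\<close>-th symbol to the front, so different neighbours of a word start
  with symbols of different absolute values.\<close>

lemma inner_two:
  assumes "i \<in> L" "x \<in> copy i" "padj D' m x y" "padj D'' m x y'" "y \<noteq> y'"
  shows "out y \<noteq> out y'" "out y \<noteq> - out y'"
proof -
  obtain k where k: "k \<in> {1..m}" "y = spr k x" using assms(3) unfolding padj_def by blast
  obtain l where l: "l \<in> {1..m}" "y' = spr l x" using assms(4) unfolding padj_def by blast
  note x = copyD[OF assms(1,2)]
  have "out y = x ! (k - 1)" "out y' = x ! (l - 1)"
    unfolding k(2) l(2) using out_spr k(1) l(1) len[OF x(1)] by simp_all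
  moreover have "k \<noteq> l" using assms(5) k l by auto
  then have "k - 1 \<noteq> l - 1" using k(1) l(1) by simp linarith
  then have "\<bar>x ! (k - 1)\<bar> \<noteq> \<bar>x ! (l - 1)\<bar>"
    using k(1) l(1) A(2)
    by (intro sperms_nth_neq[OF A(1) x(1)]) auto
  ultimately show "out y \<noteq> out y'" "out y \<noteq> - out y'" by auto
qed

text \<open>
  If the words \<open>x\<close> and \<open>cross x\<close> had neighbours in their copies that lead to the same copy, then
  some symbol of \<open>x\<close> would have to be the negative of a symbol of \<open>x\<close>.\<close>

lemma inner_across:
  assumes "i \<in> L" "x \<in> copy i" "padj D' m x u" "padj D'' m (cross x) v"
  shows "out u \<noteq> out v"
proof -
  obtain k where k: "k \<in> {1..m}" "u = spr k x" using assms(3) unfolding padj_def by blast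
  obtain l where l: "l \<in> {1..m}" "v = spr l (cross x)" using assms(4) unfolding padj_def by blast
  note x = copyD[OF assms(1,2)]
  have u: "out u = x ! (k - 1)" unfolding k(2) using out_spr k(1) len[OF x(1)] by simp
  have "out v = cross x ! (l - 1)"
    unfolding l(2) using out_spr[of l "cross x"] l(1) len[OF x(1)] by (simp add: cross_def)
  also have "\<dots> = - x ! (m - (l - 1))"
    unfolding cross_def using l(1) len[OF x(1)] by (subst nth_spr) auto
  finally have v: "out v = - x ! (m - (l - 1))" .
  have b: "k - 1 < card A" "m - (l - 1) < card A" using k(1) A(2) by auto
  show ?thesis
  proof (cases "k - 1 = m - (l - 1)")
    case True
    then show ?thesis using u v sperms_nth_abs(2)[OF A(1) x(1) b(1)] by auto
  next
    case False
    then have "\<bar>x ! (k - 1)\<bar> \<noteq> \<bar>x ! (m - (l - 1))\<bar>" using sperms_nth_neq[OF A(1) x(1) b] by blast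
    then show ?thesis using u v by auto
  qed
qed

lemma inner_no_triangle:
  assumes "i \<in> L" "a \<in> copy i" "padj D1 m a b" "padj D2 m a x" "padj D3 m b x"
  shows False
proof -
  obtain k where k: "k \<in> {1..m}" "b = spr k a" using assms(3) unfolding padj_def by blast
  obtain l where l: "l \<in> {1..m}" "x = spr l a" using assms(4) unfolding padj_def by blast
  obtain j where j: "j \<in> {1..m}" "x = spr j b" using assms(5) unfolding padj_def by blast
  show False
    using spr_no_triangle[OF A(1) copyD(1)[OF assms(1,2)], of l j k] k l j A(2) by auto
qed

lemma M_cases:
  assumes "e \<in> M"
  obtains (single) i v where "i \<in> L" "v \<in> copy i" "e = {v}"
  | (inside) i v w where "i \<in> L" "v \<in> copy i" "w \<in> copy i" "padj {} m v w" "e = {v, w}"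
  | (across) i v where "i \<in> L" "v \<in> copy i" "e = {v, cross v}"
proof -
  obtain v where v: "v \<in> sperms A z" "e = {v} \<or> (\<exists>k \<in> {1..card A}. e = {v, spr k v})"
    using M assms unfolding fault_family_def by blast
  note c = copyI[OF v(1)]
  from v(2) consider "e = {v}" | k where "k \<in> {1..card A}" "e = {v, spr k v}" by blast
  then show thesis
  proof cases
    case 1
    then show ?thesis using single c by blast
  next
    case 2
    show ?thesis
    proof (cases "k = Suc m")
      case True
      then show ?thesis using across[OF c] 2 by (simp add: cross_def)
    next
      case False
      then have "padj {} m v (spr k v)" using 2 A(2) len[OF v(1)] unfolding padj_def by auto
      with c inner_in(1)[OF c this] show ?thesis using inside 2 by blast
    qed
  qed
qed

text \<open>
  The two vertices of a faulty pair inside a copy are neighbours there, hence lead to different copies.\<close>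

lemma M_one_per_class:
  assumes "e \<in> M" "i \<in> L" "x \<in> copy i" "y \<in> copy i" "x \<in> e" "y \<in> e" "out x = out y"
  shows "x = y"
  using assms(1)
proof (cases rule: M_cases)
  case (single j v)
  then show ?thesis using assms by blast
next
  case (inside j v w)
  then show ?thesis using assms(5-7) inner_in(2)[OF inside(1,2,4)] by auto
next
  case (across j v)
  have "cross v \<in> copy (out v)" "out v \<in> L" "out v \<noteq> j" using cross_facts[OF across(1,2)] by blast+
  then have "cross v ! m = out v" "v ! m = j" using copyD(2) across(1,2) by blast+
  moreover have "x ! m = i" "y ! m = i" using copyD(2)[OF assms(2)] assms(3,4) by blast+
  moreover have "x = v \<or> x = cross v" "y = v \<or> y = cross v" using across(3) assms(5,6) by blast+
  ultimately show ?thesis using \<open>out v \<noteq> j\<close> by auto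
qed

text \<open>
  A vertex fault that is not contained in one copy is an edge between two copies.\<close>

lemma M_cross_pair:
  assumes "e \<in> M" "i \<in> L" "x \<in> copy i" "x \<in> e" "y \<in> e" "y \<notin> copy i"
  shows "y = cross x" "e = {x, cross x}"
proof -
  have "y = cross x \<and> e = {x, cross x}"
    using assms(1)
  proof (cases rule: M_cases)
    case (single j v)
    then show ?thesis using assms(3-6) by blast
  next
    case (inside j v w)
    have "x ! m = i" using copyD(2)[OF assms(2,3)] .
    moreover have "x ! m = j" using copyD(2)[OF inside(1)] inside(2,3,5) assms(4) by blast
    ultimately have "j = i" by simp
    then show ?thesis using inside(2,3,5) assms(5,6) by blast
  next
    case (across j v)
    have "x \<noteq> y" using assms(3,6) by blast
    then have "x = v \<and> y = cross v \<or> x = cross v \<and> y = v" using across(3) assms(4,5) by blast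
    then show ?thesis using across(3) cross_facts(6)[OF across(1,2)] by (auto simp: insert_commute)
  qed
  then show "y = cross x" "e = {x, cross x}" by blast+
qed

lemma card_copy: "i \<in> L \<Longrightarrow> finite (copy i) \<and> card (copy i) = 2 * m * K"
proof -
  assume i: "i \<in> L"
  obtain m' where m': "m = Suc m'" using m3 by (cases m) auto
  have "2 * m * K = 2 ^ m * fact m" unfolding K_def by (simp add: m' algebra_simps)
  then show ?thesis using card_sperms[OF posset_copy, of i "i # z"] card_rest[OF i]
    by (simp add: copy_def)
qed

lemma finite_live: "i \<in> L \<Longrightarrow> finite (live i)"
  using card_copy unfolding live_def by blast

lemma K_large: "4 * (m - 1) \<le> K"
proof -
  obtain k where k: "m = k + 3" using m3 by (metis le_Suc_ex add.commute)
  have "4 * (k + 2) \<le> 2 ^ (k + 2) * (fact (k + 2) :: nat)"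
  proof -
    have "(4::nat) \<le> 2 ^ (k + 2)" by (induction k) auto
    moreover have "k + 2 \<le> (fact (k + 2) :: nat)" by (rule fact_ge_self)
    ultimately show ?thesis by (rule mult_le_mono)
  qed
  moreover have "m - 1 = k + 2" using k by simp
  ultimately show ?thesis unfolding K_def by simp
qed

lemma card_class:
  assumes "i \<in> L" "j \<in> L" "j \<noteq> i" "j \<noteq> - i"
  shows "card {x \<in> copy i. out x = j} = K"
proof -
  have j: "\<bar>j\<bar> \<in> A" "\<bar>j\<bar> \<noteq> \<bar>i\<bar>"
    using assms unfolding L_def labels_iff[OF A(1)] by auto
  then have h: "- j \<in> labels (A - {\<bar>i\<bar>})" using labels_iff[OF posset_copy] by simp
  have "{x \<in> copy i. out x = j} = {x \<in> copy i. x ! 0 = - j}" by (auto simp: out_def)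
  then show ?thesis
    using card_head_class[OF posset_copy h, of "m - 1" "i # z"] card_rest[OF assms(1)] m3
    by (simp add: copy_def K_def)
qed

lemma card_classes:
  assumes "i \<in> L" "finite X"
  shows "card {x \<in> copy i. out x \<in> X} \<le> card X * K"
proof -
  have fin: "finite (copy i)" using card_copy assms by blast
  have "{x \<in> copy i. out x \<in> X} = (\<Union>j \<in> X. {x \<in> copy i. out x = j})" by blast
  also have "card \<dots> \<le> (\<Sum>j \<in> X. card {x \<in> copy i. out x = j})"
    using assms(2) by (rule card_UN_le)
  also have "\<dots> \<le> (\<Sum>j \<in> X. K)"
  proof (rule sum_mono)
    fix j
    show "card {x \<in> copy i. out x = j} \<le> K"
    proof (cases "j \<in> L \<and> j \<noteq> i \<and> j \<noteq> - i")
      case True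
      then show ?thesis using card_class[OF assms(1), of j] by simp
    next
      case False
      then have "{x \<in> copy i. out x = j} = {}" using cross_facts(1-3)[OF assms(1)] by blast
      then show ?thesis by (metis card.empty le0)
    qed
  qed
  finally show ?thesis by simp
qed

lemma card_le_1I: "(\<And>x y. x \<in> S \<Longrightarrow> y \<in> S \<Longrightarrow> x = y) \<Longrightarrow> card S \<le> 1"
  by (metis One_nat_def card_le_Suc0_iff_eq card.infinite zero_le)

lemma card_UN_le_card:
  assumes "finite I" "\<And>i. i \<in> I \<Longrightarrow> card (f i) \<le> 1"
  shows "card (\<Union>i \<in> I. f i) \<le> card I"
proof -
  have "card (\<Union>i \<in> I. f i) \<le> (\<Sum>i \<in> I. card (f i))" using assms(1) by (rule card_UN_le)
  also have "\<dots> \<le> (\<Sum>i \<in> I. 1)" using assms(2) by (rule sum_mono)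
  finally show ?thesis by simp
qed

lemma free_cross:
  assumes "i \<in> L" "x \<in> live i" "free x"
  shows "step x (cross x)" "cross x \<in> live (out x)" "free (cross x)"
proof -
  note x = liveD[OF assms(2)] copyD[OF assms(1) liveD(1)[OF assms(2)]]
  note c = cross_facts[OF assms(1) x(1)]
  show "step x (cross x)"
    unfolding step_def padj_def using assms(3) len[OF x(3)] by (auto simp: free_def cross_def)
  show "cross x \<in> live (out x)" unfolding live_def using c(4) assms(3) by (simp add: free_def)
  show "free (cross x)" using assms(3) x(2) c(6) by (simp add: free_def insert_commute)
qed

text \<open>
  A fault destroys at most one of the \<open>K\<close> edges between two given copies: the two vertices of a faulty pair in
  one copy lead to different copies, and a pair in different copies is itself an edge
  between them.\<close>

lemma many_free_edges:
  assumes ij: "i \<in> L" "j \<in> L" "j \<noteq> i" "j \<noteq> - i" and Z: "finite Z" "card Z + faults < K"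
  obtains x where "x \<in> live i" "out x = j" "free x" "x \<notin> Z"
proof -
  let ?E = "{x \<in> copy i. out x = j}"
  let ?B = "{x \<in> ?E. x \<in> W \<or> cross x \<in> W \<or> {x, cross x} \<in> D}"
  have fin: "finite ?E" using card_copy[OF ij(1)] by simp
  have "?B \<subseteq> (\<Union>e \<in> M. {x \<in> ?E. x \<in> e \<or> cross x \<in> e}) \<union> (\<Union>d \<in> D. {x \<in> ?E. {x, cross x} = d})"
    unfolding W_def by blast
  moreover have "finite ((\<Union>e \<in> M. {x \<in> ?E. x \<in> e \<or> cross x \<in> e})
      \<union> (\<Union>d \<in> D. {x \<in> ?E. {x, cross x} = d}))"
    by (rule finite_subset[OF _ fin]) blast
  ultimately have "card ?B \<le> card ((\<Union>e \<in> M. {x \<in> ?E. x \<in> e \<or> cross x \<in> e})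
      \<union> (\<Union>d \<in> D. {x \<in> ?E. {x, cross x} = d}))"
    by (intro card_mono)
  also have "\<dots> \<le> card (\<Union>e \<in> M. {x \<in> ?E. x \<in> e \<or> cross x \<in> e})
      + card (\<Union>d \<in> D. {x \<in> ?E. {x, cross x} = d})"
    by (rule card_Un_le)
  also have "\<dots> \<le> card M + card D"
  proof (rule add_mono)
    show "card (\<Union>e \<in> M. {x \<in> ?E. x \<in> e \<or> cross x \<in> e}) \<le> card M"
    proof (rule card_UN_le_card[OF finM], rule card_le_1I)
      fix e x y
      assume e: "e \<in> M" and "x \<in> {x \<in> ?E. x \<in> e \<or> cross x \<in> e}" "y \<in> {x \<in> ?E. x \<in> e \<or> cross x \<in> e}"
      then have x: "x \<in> copy i" "out x = j" "x \<in> e \<or> cross x \<in> e"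
        and y: "y \<in> copy i" "out y = j" "y \<in> e \<or> cross y \<in> e" by blast+
      note cx = cross_facts[OF ij(1) x(1)] and cy = cross_facts[OF ij(1) y(1)]
      have nx: "cross x \<in> copy j" "cross x \<notin> copy i" and ny: "cross y \<in> copy j" "cross y \<notin> copy i"
        using cx(4) cy(4) x(2) y(2) copy_disjoint[OF ij(1,2)] ij(3) by auto
      consider "x \<in> e" "y \<in> e" | "x \<in> e" "cross y \<in> e" | "cross x \<in> e" "y \<in> e"
        | "cross x \<in> e" "cross y \<in> e" using x y by blast
      then show "x = y"
      proof cases
        case 1
        then show ?thesis using M_one_per_class[OF e ij(1) x(1) y(1)] x(2) y(2) by simp
      next
        case 2
        then have "cross y = cross x" using M_cross_pair(1)[OF e ij(1) x(1)] ny(2) by blast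
        then show ?thesis using cx(6) cy(6) by metis
      next
        case 3
        then have "cross x = cross y" using M_cross_pair(1)[OF e ij(1) y(1)] nx(2) by blast
        then show ?thesis using cx(6) cy(6) by metis
      next
        case 4
        then have "cross x = cross y"
          using M_one_per_class[OF e ij(2) nx(1) ny(1)] cx(5) cy(5) by simp
        then show ?thesis using cx(6) cy(6) by metis
      qed
    qed
    show "card (\<Union>d \<in> D. {x \<in> ?E. {x, cross x} = d}) \<le> card D"
    proof (rule card_UN_le_card[OF D(1)], rule card_le_1I)
      fix d x y
      assume "x \<in> {x \<in> ?E. {x, cross x} = d}" "y \<in> {x \<in> ?E. {x, cross x} = d}"
      then have x: "x \<in> copy i" "out x = j" "y \<in> copy i" "{x, cross x} = {y, cross y}" by auto
      have "cross x \<notin> copy i"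
        using cross_facts(4)[OF ij(1) x(1)] x(2) copy_disjoint[OF ij(1,2)] ij(3) by auto
      then show "x = y" using x(3,4) by (auto simp: doubleton_eq_iff)
    qed
  qed
  finally have B: "card ?B \<le> faults" by (simp add: faults_def)
  have "card (?B \<union> Z) < card ?E"
    using card_Un_le[of ?B Z] B Z(2) card_class[OF ij] by linarith
  moreover have "finite (?B \<union> Z)"
    using finite_subset[OF _ fin, of ?B] Z(1) by blast
  ultimately have "\<not> ?E \<subseteq> ?B \<union> Z"
    using card_mono[of "?B \<union> Z" ?E] by linarith
  then obtain x where "x \<in> ?E" "x \<notin> ?B" "x \<notin> Z" by blast
  then show thesis by (intro that[of x]) (simp_all add: live_def free_def)
qed

lemma card_touching_split: "card (touching i) + card {e \<in> M. e \<inter> copy i = {}} = card M"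
proof -
  have "card (touching i \<union> {e \<in> M. e \<inter> copy i = {}})
      = card (touching i) + card {e \<in> M. e \<inter> copy i = {}}"
    by (rule card_Un_disjoint) (use finM in \<open>auto simp: touching_def\<close>)
  moreover have "touching i \<union> {e \<in> M. e \<inter> copy i = {}} = M" unfolding touching_def by blast
  ultimately show ?thesis by simp
qed

lemma card_edges_split: "card (edges_in i) + card {d \<in> D. \<not> d \<subseteq> copy i} = card D"
proof -
  have "card (edges_in i \<union> {d \<in> D. \<not> d \<subseteq> copy i})
      = card (edges_in i) + card {d \<in> D. \<not> d \<subseteq> copy i}"
    by (rule card_Un_disjoint) (use D in \<open>auto simp: edges_in_def\<close>)
  moreover have "edges_in i \<union> {d \<in> D. \<not> d \<subseteq> copy i} = D" unfolding edges_in_def by blast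
  ultimately show ?thesis by simp
qed

lemma load_le_faults: "load i \<le> faults"
  using card_touching_split[of i] card_edges_split[of i] unfolding load_def faults_def by linarith

text \<open>
  A surviving vertex that cannot leave its copy is blocked by a fault that does not touch the copy, and
  every such fault blocks at most one vertex. This trade-off between blocked
  vertices and load keeps the later counts independent of the position of the faults.\<close>

lemma card_blocked:
  assumes "i \<in> L"
  shows "card {x \<in> live i. \<not> free x} + load i \<le> faults"
proof -
  let ?M = "{e \<in> M. e \<inter> copy i = {}}" and ?D = "{d \<in> D. \<not> d \<subseteq> copy i}"
  have fin: "finite (copy i)" using card_copy[OF assms] by simp
  have "{x \<in> live i. \<not> free x} \<subseteq>
    (\<Union>e \<in> ?M. {x \<in> copy i. cross x \<in> e}) \<union> (\<Union>d \<in> ?D. {x \<in> copy i. {x, cross x} = d})"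
  proof
    fix x assume "x \<in> {x \<in> live i. \<not> free x}"
    then have x: "x \<in> copy i" "x \<notin> W" "\<not> free x" using liveD by blast+
    note c = cross_facts[OF assms x(1)]
    have nc: "cross x \<notin> copy i" using c(1,2,4) copy_disjoint[OF assms c(1)] by auto
    show "x \<in> (\<Union>e \<in> ?M. {x \<in> copy i. cross x \<in> e}) \<union> (\<Union>d \<in> ?D. {x \<in> copy i. {x, cross x} = d})"
    proof (cases "cross x \<in> W")
      case True
      then obtain e where e: "e \<in> M" "cross x \<in> e" unfolding W_def by blast
      have "e \<inter> copy i = {}"
      proof (rule ccontr)
        assume "e \<inter> copy i \<noteq> {}"
        then obtain y where y: "y \<in> e" "y \<in> copy i" by blast
        have "cross x = cross y" using M_cross_pair(1)[OF e(1) assms y(2,1) e(2) nc] .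
        then have "x = y" using c(6) cross_facts(6)[OF assms y(2)] by metis
        then show False using y(1) e(1) x(2) unfolding W_def by blast
      qed
      then show ?thesis using e x(1) by blast
    next
      case False
      then have "{x, cross x} \<in> D" using x(3) by (simp add: free_def)
      then have "{x, cross x} \<in> ?D" using nc by blast
      then show ?thesis using x(1) by blast
    qed
  qed
  moreover have "finite ((\<Union>e \<in> ?M. {x \<in> copy i. cross x \<in> e})
      \<union> (\<Union>d \<in> ?D. {x \<in> copy i. {x, cross x} = d}))"
    by (rule finite_subset[OF _ fin]) blast
  ultimately have "card {x \<in> live i. \<not> free x} \<le>
    card ((\<Union>e \<in> ?M. {x \<in> copy i. cross x \<in> e}) \<union> (\<Union>d \<in> ?D. {x \<in> copy i. {x, cross x} = d}))"
    by (intro card_mono)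
  also have "\<dots> \<le> card (\<Union>e \<in> ?M. {x \<in> copy i. cross x \<in> e}) + card (\<Union>d \<in> ?D. {x \<in> copy i. {x, cross x} = d})"
    by (rule card_Un_le)
  also have "\<dots> \<le> card ?M + card ?D"
  proof (rule add_mono)
    show "card (\<Union>e \<in> ?M. {x \<in> copy i. cross x \<in> e}) \<le> card ?M"
    proof (rule card_UN_le_card, use finM in simp, rule card_le_1I)
      fix e x y
      assume "e \<in> ?M" "x \<in> {x \<in> copy i. cross x \<in> e}" "y \<in> {x \<in> copy i. cross x \<in> e}"
      then have e: "e \<in> M" "cross x \<in> e" "cross y \<in> e" and x: "x \<in> copy i" and y: "y \<in> copy i"
        and d: "e \<inter> copy i = {}" by blast+
      note cx = cross_facts[OF assms x] and cy = cross_facts[OF assms y]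
      have "cross y \<in> copy (out x)"
      proof (rule ccontr)
        assume "cross y \<notin> copy (out x)"
        then have "cross y = cross (cross x)" using M_cross_pair(1)[OF e(1) cx(1,4) e(2,3)] by blast
        then show False using cx(6) e(3) x d by auto
      qed
      then have "cross x = cross y"
        using M_one_per_class[OF e(1) cx(1,4) _ e(2,3)] cx(5) cy(5) by simp
      then show "x = y" using cx(6) cy(6) by metis
    qed
    show "card (\<Union>d \<in> ?D. {x \<in> copy i. {x, cross x} = d}) \<le> card ?D"
    proof (rule card_UN_le_card, use D in simp, rule card_le_1I)
      fix d x y
      assume "x \<in> {x \<in> copy i. {x, cross x} = d}" "y \<in> {x \<in> copy i. {x, cross x} = d}"
      then have x: "x \<in> copy i" "y \<in> copy i" "{x, cross x} = {y, cross y}" by auto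
      have "cross x \<notin> copy i"
        using cross_facts(1,2,4)[OF assms x(1)] copy_disjoint[OF assms] by blast
      then show "x = y" using x(2,3) by (auto simp: doubleton_eq_iff)
    qed
  qed
  finally show ?thesis
    using card_touching_split[of i] card_edges_split[of i] unfolding load_def faults_def by linarith
qed

lemma card_live:
  assumes "i \<in> L"
  shows "2 * m * K \<le> card (live i) + 2 * load i"
proof -
  have fin: "finite (copy i)" "card (copy i) = 2 * m * K" using card_copy[OF assms] by simp_all
  have e2: "card (e \<inter> copy i) \<le> 2" if "e \<in> M" for e
    using that
  proof (cases rule: M_cases)
    case (inside j v w)
    have "card {v, w} \<le> 2" by (simp add: card_insert_if)
    then show ?thesis unfolding inside(5) by (meson card_mono finite.emptyI finite.insertI inf_le1 le_trans)
  next
    case (across j v)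
    have "card {v, cross v} \<le> 2" by (simp add: card_insert_if)
    then show ?thesis unfolding across(3) by (meson card_mono finite.emptyI finite.insertI inf_le1 le_trans)
  next
    case (single j v)
    have "card {v} \<le> 2" by simp
    then show ?thesis unfolding single(3) by (meson card_mono finite.emptyI finite.insertI inf_le1 le_trans)
  qed
  have ft: "finite (touching i)" using finM by (simp add: touching_def)
  have "copy i \<inter> W = (\<Union>e \<in> touching i. e \<inter> copy i)" unfolding W_def touching_def by blast
  also have "card \<dots> \<le> (\<Sum>e \<in> touching i. card (e \<inter> copy i))" using ft by (rule card_UN_le)
  also have "\<dots> \<le> (\<Sum>e \<in> touching i. 2)" using e2 by (intro sum_mono) (simp add: touching_def)
  also have "\<dots> \<le> 2 * load i" by (simp add: load_def)
  finally have "card (copy i \<inter> W) \<le> 2 * load i" .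
  moreover have "card (live i) + card (copy i \<inter> W) = card (copy i)"
    unfolding live_def using fin(1) by (metis card_Diff_subset_Int card_mono finite_Int inf_le1
        le_add_diff_inverse2)
  ultimately show ?thesis using fin(2) by linarith
qed

lemma trace_family:
  assumes "i \<in> L" "M' \<subseteq> M"
  shows "fault_family (A - {\<bar>i\<bar>}) (i # z) ((\<lambda>e. e \<inter> copy i) ` {e \<in> M'. e \<inter> copy i \<noteq> {}})"
proof -
  let ?T = "(\<lambda>e. e \<inter> copy i) ` {e \<in> M'. e \<inter> copy i \<noteq> {}}"
  have "finite ?T" using finM assms(2) by (auto intro: finite_subset)
  moreover have "pairwise disjnt ?T"
  proof (rule pairwiseI)
    fix a b assume "a \<in> ?T" "b \<in> ?T" "a \<noteq> b"
    then obtain e e' where "e \<in> M" "e' \<in> M" "a = e \<inter> copy i" "b = e' \<inter> copy i" "e \<noteq> e'"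
      using assms(2) by auto
    moreover have "disjnt e e'" using M calculation unfolding fault_family_def pairwise_def by blast
    ultimately show "disjnt a b" unfolding disjnt_def by blast
  qed
  moreover have "\<exists>v \<in> copy i. a = {v} \<or> (\<exists>k \<in> {1..m}. a = {v, spr k v})" if "a \<in> ?T" for a
  proof -
    obtain e where e: "e \<in> M" "a = e \<inter> copy i" "a \<noteq> {}" using \<open>a \<in> ?T\<close> assms(2) by blast
    from e(1) show ?thesis
    proof (cases rule: M_cases)
      case (single j v)
      then show ?thesis using e by blast
    next
      case (inside j v w)
      have "i = j" using e inside copyD(2)[OF assms(1)] copyD(2)[OF inside(1)] by blast
      then have "a = {v, w}" using e inside by blast
      moreover obtain k where "k \<in> {1..m}" "w = spr k v" using inside(4) unfolding padj_def by blast
      ultimately show ?thesis using inside(2) \<open>i = j\<close> by blast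
    next
      case (across j v)
      have "out v \<in> L" "out v \<noteq> j" "cross v \<in> copy (out v)" using cross_facts[OF across(1,2)] by blast+
      then have "\<not> (v \<in> copy i \<and> cross v \<in> copy i)"
        using copyD(2)[OF assms(1)] copyD(2)[OF across(1,2)] copyD(2)[of "out v" "cross v"] by auto
      then have "a = {v} \<or> a = {cross v}" using e across(3) by blast
      then show ?thesis using e(2) by blast
    qed
  qed
  ultimately show ?thesis
    unfolding fault_family_def card_rest[OF assms(1)] copy_def[symmetric] by blast
qed

text \<open>
  The induction hypothesis for one copy, stated for arbitrary subfamilies of the faults
  since it is also used after putting a fault back.\<close>

lemma trace_tolerance:
  assumes i: "i \<in> L" and sub: "M' \<subseteq> M" "D' \<subseteq> D"
  defines "t \<equiv> card {e \<in> M'. e \<inter> copy i \<noteq> {}} + card {d \<in> D'. d \<subseteq> copy i}"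
  shows "t + 2 \<le> m \<Longrightarrow> hcycle (padj D' m) (copy i - \<Union>M')"
    and "t + 3 \<le> m \<Longrightarrow> x \<in> copy i - \<Union>M' \<Longrightarrow> y \<in> copy i - \<Union>M' \<Longrightarrow> x \<noteq> y \<Longrightarrow>
      hpath (padj D' m) (copy i - \<Union>M') x y"
proof -
  let ?T = "(\<lambda>e. e \<inter> copy i) ` {e \<in> M'. e \<inter> copy i \<noteq> {}}" and ?D = "{d \<in> D'. d \<subseteq> copy i}"
  have U: "copy i - \<Union>?T = copy i - \<Union>M'" by blast
  have "finite {e \<in> M'. e \<inter> copy i \<noteq> {}}" using finM sub by (auto intro: finite_subset)
  then have "card ?T \<le> card {e \<in> M'. e \<inter> copy i \<noteq> {}}" by (rule card_image_le)
  then have t: "card ?T + card ?D \<le> t" by (simp add: t_def)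
  have fd: "finite ?D" "{} \<notin> ?D" using D sub by (auto intro: finite_subset)
  note ft = fault_tolerantD[OF IH[OF i[unfolded L_def]] trace_family[OF i sub(1)] fd,
      unfolded card_rest[OF i] copy_def[symmetric] U]
  have mono: "padj D' m u v" if "padj ?D m u v" "u \<in> copy i - \<Union>M'" "v \<in> copy i - \<Union>M'" for u v
    using that unfolding padj_def by blast
  {
    assume "t + 2 \<le> m"
    then have "hcycle (padj ?D m) (copy i - \<Union>M')" using t by (intro ft(1)) simp
    then show "hcycle (padj D' m) (copy i - \<Union>M')" by (rule hcycle_mono) (rule mono)
  }
  {
    assume "t + 3 \<le> m" "x \<in> copy i - \<Union>M'" "y \<in> copy i - \<Union>M'" "x \<noteq> y"
    then have "hpath (padj ?D m) (copy i - \<Union>M') x y" using t by (intro ft(2)) simp_all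
    then show "hpath (padj D' m) (copy i - \<Union>M') x y" by (rule hpath_mono) (rule mono)
  }
qed

lemma live_connected:
  assumes "i \<in> L" "load i + 3 \<le> m" "x \<in> live i" "y \<in> live i" "x \<noteq> y"
  shows "hpath inner (live i) x y"
  using trace_tolerance(2)[of i M D x y] assms
  unfolding load_def touching_def edges_in_def inner_def live_def W_def by simp

lemma live_cycle:
  assumes "i \<in> L" "load i + 2 \<le> m"
  shows "hcycle inner (live i)"
  using trace_tolerance(1)[of i M D] assms
  unfolding load_def touching_def edges_in_def inner_def live_def W_def by simp

text \<open>
  Putting one fault back leaves one fault less to tolerate. As the vertex faults are disjoint, no
  other fault still covers a vertex that is put back.\<close>

lemma withdraw:
  assumes "i \<in> L" "e \<in> touching i"
  shows "load i + 1 \<le> m \<Longrightarrow> hcycle inner (live i \<union> (e \<inter> copy i))"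
    and "load i + 2 \<le> m \<Longrightarrow> x \<in> live i \<union> (e \<inter> copy i) \<Longrightarrow> y \<in> live i \<union> (e \<inter> copy i) \<Longrightarrow> x \<noteq> y \<Longrightarrow>
      hpath inner (live i \<union> (e \<inter> copy i)) x y"
proof -
  have e: "e \<in> M" "e \<inter> copy i \<noteq> {}" using assms(2) by (auto simp: touching_def)
  have U: "copy i - \<Union>(M - {e}) = live i \<union> (e \<inter> copy i)"
  proof -
    have "e \<inter> e' = {}" if "e' \<in> M" "e' \<noteq> e" for e'
      using M e(1) that unfolding fault_family_def pairwise_def disjnt_def by blast
    then have "\<Union>M - e = \<Union>(M - {e})" using e(1) by blast
    then show ?thesis unfolding live_def W_def by blast
  qed
  have "{e' \<in> M - {e}. e' \<inter> copy i \<noteq> {}} = touching i - {e}" unfolding touching_def by blast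
  moreover have "finite (touching i)" using finM by (simp add: touching_def)
  ultimately have c: "card {e' \<in> M - {e}. e' \<inter> copy i \<noteq> {}} + 1 = card (touching i)"
    using assms(2) by (metis add.commute card_Suc_Diff1 plus_1_eq_Suc)
  note t = trace_tolerance[OF assms(1), of "M - {e}" D, unfolded U]
  {
    assume "load i + 1 \<le> m"
    then show "hcycle inner (live i \<union> (e \<inter> copy i))"
      using t(1) c unfolding inner_def load_def edges_in_def by simp
  }
  {
    assume "load i + 2 \<le> m" "x \<in> live i \<union> (e \<inter> copy i)" "y \<in> live i \<union> (e \<inter> copy i)" "x \<noteq> y"
    then show "hpath inner (live i \<union> (e \<inter> copy i)) x y"
      using t(2)[of x y] c unfolding inner_def load_def edges_in_def by simp
  }
qed

lemma inner_step: "x \<in> sperms A z \<Longrightarrow> inner x y \<Longrightarrow> step x y"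
  unfolding inner_def step_def by (erule padj_mono) (simp_all add: len)

lemma inner_hpath:
  assumes "i \<in> L" "S \<subseteq> copy i" "hpath inner S x y"
  shows "hpath step S x y"
  using assms(3)
proof (rule hpath_mono)
  fix u v assume "u \<in> S" "inner u v"
  then show "step u v" using copyD(1)[OF assms(1)] assms(2) inner_step[of u v] by blast
qed

lemma inner_facts:
  assumes "i \<in> L" "x \<in> copy i" "inner x y"
  shows "y \<in> copy i" "out y \<noteq> out x"
  using inner_in[OF assms(1,2)] assms(3) unfolding inner_def by blast+

end

section \<open>Chains of copies\<close>

text \<open>
  The assumption on the number of faults is the one for Hamiltonicity; Hamiltonian connectedness
  allows one fault less.\<close>

locale few_faults = copies +
  assumes few: "faults < m"
begin

text \<open>
  By the induction hypothesis the good copies are Hamiltonian connected. A segment is a path whose two ends can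
  be left by a surviving edge to another copy.\<close>

definition "good i \<longleftrightarrow> i \<in> L \<and> load i + 3 \<le> m"
definition "exit x \<longleftrightarrow> free x \<and> (\<exists>i \<in> L. x \<in> live i)"
definition "seg Q x y \<longleftrightarrow> hpath step Q x y \<and> exit x \<and> exit y"
definition "region G = (\<Union>g \<in> G. live g)"

text \<open>
  A block can be traversed from any vertex of the copy \<open>l\<close> to any vertex of the copy \<open>q\<close>. Exempt are the vertices
  that are joined to vertices of the block itself: they may already serve as entrances within the
  block. Two blocks are connected through vertices that lead out of both, so the exemption never
  interferes when blocks are composed.\<close>

definition block :: "int list set \<Rightarrow> int \<Rightarrow> int \<Rightarrow> bool" where
  "block S l q \<longleftrightarrow> l \<in> L \<and> q \<in> L \<and> live l \<subseteq> S \<and> live q \<subseteq> S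
     \<and> (\<forall>x \<in> live l. \<forall>y \<in> live q. x \<noteq> y \<longrightarrow> cross x \<notin> S \<longrightarrow> cross y \<notin> S \<longrightarrow> hpath step S x y)"

lemma K_bounds: "faults + 3 < K" "m * K = (m - 1) * K + K"
proof -
  show "faults + 3 < K" using K_large few m3 by linarith
  show "m * K = (m - 1) * K + K" using m3 by (cases m) auto
qed

lemma goodL: "good i \<Longrightarrow> i \<in> L"
  by (simp add: good_def)

lemma card_live_large: "i \<in> L \<Longrightarrow> 4 < card (live i)"
proof -
  assume i: "i \<in> L"
  have "3 * K \<le> m * K" using m3 by (rule mult_le_mono1)
  then show ?thesis using card_live[OF i] load_le_faults[of i] K_bounds(1) by linarith
qed

lemma live_nonempty: "i \<in> L \<Longrightarrow> live i \<noteq> {}"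
  using card_live_large[of i] by auto

lemma live_subset_neq: "i \<in> L \<Longrightarrow> live i \<subseteq> S \<Longrightarrow> live j \<subseteq> T \<Longrightarrow> S \<inter> T = {} \<Longrightarrow> i \<noteq> j"
  using live_nonempty[of i] by blast

lemma good_hpath:
  assumes "good i" "x \<in> live i" "y \<in> live i" "x \<noteq> y"
  shows "hpath inner (live i) x y" "hpath step (live i) x y"
proof -
  show "hpath inner (live i) x y" using assms live_connected unfolding good_def by blast
  then show "hpath step (live i) x y"
    using assms(1) by (intro inner_hpath[OF goodL]) (auto simp: live_def)
qed

lemma exit_cross:
  assumes "exit x"
  shows "step x (cross x)" "step (cross x) x" "cross x \<in> live (out x)" "out x \<in> L"
    "cross (cross x) = x" "exit (cross x)"
proof -
  obtain i where i: "i \<in> L" "x \<in> live i" "free x" using assms unfolding exit_def by blast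
  note f = free_cross[OF i] and c = cross_facts[OF i(1) liveD(1)[OF i(2)]]
  show "step x (cross x)" "cross x \<in> live (out x)" by fact+
  show "step (cross x) x" using f(1) symp_step by (rule sympD[rotated])
  show "out x \<in> L" "cross (cross x) = x" by fact+
  show "exit (cross x)" unfolding exit_def using f c by blast
qed

lemma exit_out: "exit x \<Longrightarrow> x \<in> live i \<Longrightarrow> i \<in> L \<Longrightarrow> out x \<noteq> i \<and> out x \<noteq> - i \<and> out (cross x) = i"
  using cross_facts(2,3,5)[OF _ liveD(1)] by simp

lemma segD:
  assumes "seg Q x y"
  shows "hpath step Q x y" "exit x" "exit y" "x \<in> Q" "y \<in> Q"
proof -
  show h: "hpath step Q x y" and "exit x" "exit y" using assms by (auto simp: seg_def)
  show "x \<in> Q" "y \<in> Q" using hpath_ends[OF h] by simp_all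
qed

lemma seg_sym: "seg Q x y \<Longrightarrow> seg Q y x"
  unfolding seg_def by (simp add: hpath_rev[OF symp_step])

lemma card_forbidden:
  assumes "i \<in> L" "finite X"
  shows "card {x \<in> live i. out x \<in> X \<or> \<not> free x} + load i \<le> card X * K + faults"
proof -
  have fin: "finite (copy i)" using card_copy[OF assms(1)] by simp
  have "{x \<in> live i. out x \<in> X \<or> \<not> free x}
      \<subseteq> {x \<in> copy i. out x \<in> X} \<union> {x \<in> live i. \<not> free x}"
    unfolding live_def by blast
  then have "card {x \<in> live i. out x \<in> X \<or> \<not> free x}
      \<le> card ({x \<in> copy i. out x \<in> X} \<union> {x \<in> live i. \<not> free x})"
    using fin finite_live[OF assms(1)] by (intro card_mono) auto
  also have "\<dots> \<le> card {x \<in> copy i. out x \<in> X} + card {x \<in> live i. \<not> free x}" by (rule card_Un_le)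
  finally show ?thesis using card_classes[OF assms] card_blocked[OF assms(1)] by linarith
qed

text \<open>
  Cutting a path at an edge whose ends lead to two different copies outside \<open>X\<close>. The vertices that lead
  to a copy in \<open>X\<close>, or nowhere, must be too few to meet every edge of the path.\<close>

lemma break_path:
  assumes i: "i \<in> L" and h: "hpath inner (live i) s t"
    and c: "2 * card {x \<in> live i. out x \<in> X \<or> \<not> free x} + 1
      < card (live i) + of_bool (out s \<in> X) + of_bool (out t \<in> X)"
  obtains S1 S2 x y where "S1 \<union> S2 = live i" "S1 \<inter> S2 = {}" "hpath step S1 s x" "hpath step S2 y t"
    "x \<in> live i" "y \<in> live i" "exit x" "exit y" "out x \<noteq> out y" "out x \<notin> X" "out y \<notin> X"
proof -
  let ?B = "{x. out x \<in> X \<or> \<not> free x}"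
  have "?B \<inter> live i = {x \<in> live i. out x \<in> X \<or> \<not> free x}" by blast
  moreover have "of_bool (out s \<in> X) \<le> (of_bool (s \<in> ?B) :: nat)"
    "of_bool (out t \<in> X) \<le> (of_bool (t \<in> ?B) :: nat)" by auto
  ultimately have "2 * card (?B \<inter> live i) + 1 < card (live i) + of_bool (s \<in> ?B) + of_bool (t \<in> ?B)"
    using c by simp
  from hpath_break[OF h this] obtain S1 S2 x y where *: "S1 \<union> S2 = live i" "S1 \<inter> S2 = {}"
    "hpath inner S1 s x" "hpath inner S2 y t" "inner x y" "x \<notin> ?B" "y \<notin> ?B" .
  have xy: "x \<in> live i" "y \<in> live i" using *(1) hpath_ends[OF *(3)] hpath_ends[OF *(4)] by blast+
  have sub: "S1 \<subseteq> copy i" "S2 \<subseteq> copy i" using *(1) unfolding live_def by blast+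
  show thesis
  proof (rule that[OF *(1,2) inner_hpath[OF i sub(1) *(3)] inner_hpath[OF i sub(2) *(4)] xy])
    show "exit x" "exit y" unfolding exit_def using xy i *(6,7) by auto
    show "out x \<noteq> out y" using inner_facts(2)[OF i liveD(1)[OF xy(1)] *(5)] by simp
  qed (use *(6,7) in auto)
qed

text \<open>
  Each forbidden copy excludes \<open>K\<close> of the \<open>2 * m * K\<close> vertices, so up to \<open>m - 1\<close> copies may be forbidden.\<close>

lemma break_path_few:
  assumes "good i" "s \<in> live i" "t \<in> live i" "s \<noteq> t" "finite X" "card X \<le> m - 1"
  obtains S1 S2 x y where "S1 \<union> S2 = live i" "S1 \<inter> S2 = {}" "hpath step S1 s x" "hpath step S2 y t"
    "x \<in> live i" "y \<in> live i" "exit x" "exit y" "out x \<noteq> out y" "out x \<notin> X" "out y \<notin> X"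
proof (rule break_path[OF goodL[OF assms(1)] good_hpath(1)[OF assms(1-4)]])
  have "card X * K \<le> (m - 1) * K" using assms(6) by (rule mult_le_mono1)
  then show "2 * card {x \<in> live i. out x \<in> X \<or> \<not> free x} + 1
      < card (live i) + of_bool (out s \<in> X) + of_bool (out t \<in> X)"
    using card_forbidden[OF goodL[OF assms(1)] assms(5)] card_live[OF goodL[OF assms(1)]] K_bounds
    by linarith
qed

lemma break_cycle:
  assumes i: "i \<in> L" and h: "hcycle inner (live i)"
    and c: "2 * card {x \<in> live i. out x \<in> X \<or> \<not> free x} < card (live i)"
  obtains x y where "seg (live i) x y" "x \<in> live i" "y \<in> live i" "out x \<noteq> out y" "out x \<notin> X" "out y \<notin> X"
proof -
  let ?B = "{x. out x \<in> X \<or> \<not> free x}"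
  have "?B \<inter> live i = {x \<in> live i. out x \<in> X \<or> \<not> free x}" by blast
  then have "2 * card (?B \<inter> live i) < card (live i)" using c by simp
  from hcycle_break[OF h this] obtain x y where *: "hpath inner (live i) x y" "x \<noteq> y" "inner y x"
    "x \<notin> ?B" "y \<notin> ?B" .
  have xy: "x \<in> live i" "y \<in> live i" using hpath_ends[OF *(1)] by simp_all
  have "live i \<subseteq> copy i" unfolding live_def by blast
  from inner_hpath[OF i this *(1)] have "seg (live i) x y"
    unfolding seg_def exit_def using xy i *(4,5) by auto
  moreover have "out x \<noteq> out y" using inner_facts(2)[OF i liveD(1)[OF xy(2)] *(3)] by simp
  ultimately show thesis using that xy *(4,5) by simp
qed

lemma break_cycle_few:
  assumes "i \<in> L" "load i + 2 \<le> m" "finite X" "card X \<le> m - 1"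
  obtains x y where "seg (live i) x y" "x \<in> live i" "y \<in> live i" "out x \<noteq> out y" "out x \<notin> X" "out y \<notin> X"
proof (rule break_cycle[OF assms(1) live_cycle[OF assms(1,2)]])
  have "card X * K \<le> (m - 1) * K" using assms(4) by (rule mult_le_mono1)
  then show "2 * card {x \<in> live i. out x \<in> X \<or> \<not> free x} < card (live i)"
    using card_forbidden[OF assms(1,3)] card_live[OF assms(1)] K_bounds by linarith
qed

lemma obtain_edge:
  assumes "i \<in> L" "j \<in> L" "j \<noteq> i" "j \<noteq> - i"
  obtains x where "x \<in> live i" "out x = j" "exit x" "x \<noteq> s" "x \<noteq> t"
proof -
  have "card {s, t} \<le> 2" by (simp add: card_insert_if)
  then have "card {s, t} + faults < K" using K_bounds(1) by linarith
  from many_free_edges[OF assms _ this] obtain x where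
    "x \<in> live i" "out x = j" "free x" "x \<notin> {s, t}" by blast
  then show thesis using that assms(1) unfolding exit_def by blast
qed

lemma path_via:
  assumes "hpath step S s x" "exit x" "hpath step R (cross x) t" "S \<inter> R = {}"
  shows "hpath step (S \<union> R) s t"
  using hpath_join[OF assms(1) exit_cross(1)[OF assms(2)] assms(3,4)] .

lemma path_detour:
  assumes "hpath step S1 s x" "hpath step S2 y t" "exit x" "exit y"
    "hpath step R (cross x) (cross y)" "S1 \<inter> S2 = {}" "S1 \<inter> R = {}" "S2 \<inter> R = {}"
  shows "hpath step (S1 \<union> S2 \<union> R) s t"
proof -
  have "hpath step (S1 \<union> R) s (cross y)" using path_via[OF assms(1,3,5,7)] .
  from hpath_join[OF this exit_cross(2)[OF assms(4)] assms(2)] assms(6,8)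
  have "hpath step (S1 \<union> R \<union> S2) s t" by blast
  then show ?thesis by (simp add: Un_ac)
qed

lemma seg_close:
  assumes "seg Q x y" "hpath step R (cross x) (cross y)" "Q \<inter> R = {}" "3 \<le> card R"
  shows "hcycle step (Q \<union> R)"
proof -
  have R: "hpath step R (cross y) (cross x)" using assms(2) by (rule hpath_rev[OF symp_step])
  have h: "hpath step (Q \<union> R) x (cross x)"
    by (rule path_via[OF segD(1,3)[OF assms(1)] R assms(3)])
  have "finite (Q \<union> R)" using hpath_ends[OF h] by simp
  then have "card R \<le> card (Q \<union> R)" by (intro card_mono) auto
  with assms(4) have "3 \<le> card (Q \<union> R)" by linarith
  from hpath_imp_hcycle[OF h exit_cross(2)[OF segD(2)[OF assms(1)]] this] show ?thesis .
qed

lemma blockD: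
  assumes "block S l q"
  shows "l \<in> L" "q \<in> L" "live l \<subseteq> S" "live q \<subseteq> S"
  using assms unfolding block_def by simp_all

lemma block_hpath:
  assumes "block S l q" "x \<in> live l" "y \<in> live q" "x \<noteq> y" "cross x \<notin> S" "cross y \<notin> S"
  shows "hpath step S x y"
  using assms unfolding block_def by simp

lemma block_good: "good i \<Longrightarrow> block (live i) i i"
  unfolding block_def using good_hpath(2) goodL by auto

lemma block_sym: "block S l q \<Longrightarrow> block S q l"
  unfolding block_def by (auto intro: hpath_rev[OF symp_step])

lemma block_join:
  assumes S: "block S l a" and T: "block T b q" and disj: "S \<inter> T = {}" and ab: "a \<noteq> - b"
  shows "block (S \<union> T) l q"
proof -
  note s = blockD[OF S] and t = blockD[OF T]
  have "a \<noteq> b" using live_subset_neq[OF s(2,4) t(3) disj] .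
  then obtain w where w: "w \<in> live a" "out w = b" "exit w"
    using obtain_edge[OF s(2) t(1)] ab by (metis minus_minus)
  note c = exit_cross[OF w(3)]
  have cw: "cross w \<in> T" "w \<in> S" using c(3) w(1,2) s(4) t(3) by auto
  have "hpath step (S \<union> T) x y"
    if "x \<in> live l" "y \<in> live q" "cross x \<notin> S \<union> T" "cross y \<notin> S \<union> T" for x y
  proof -
    have "x \<noteq> w" "cross w \<noteq> y" using that cw c(5) by auto
    have "hpath step S x w" using block_hpath[OF S that(1) w(1) \<open>x \<noteq> w\<close>] that(3) cw disj by blast
    moreover have "cross (cross w) \<notin> T" using c(5) cw(2) disj by auto
    then have "hpath step T (cross w) y"
      using block_hpath[OF T _ that(2) \<open>cross w \<noteq> y\<close>] c(3) w(2) that(4) by simp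
    ultimately show ?thesis using path_via[OF _ w(3)] disj by blast
  qed
  then show ?thesis unfolding block_def using s t by blast
qed

text \<open>
  A segment can be traversed only from end to end, so it is used as a detour between the two copies
  to which its ends lead.\<close>

lemma block_seg:
  assumes S: "block S l (out x)" and T: "block T (out y) q" and Q: "seg Q x y"
    and disj: "S \<inter> T = {}" "S \<inter> Q = {}" "T \<inter> Q = {}"
  shows "block (S \<union> Q \<union> T) l q"
proof -
  note s = blockD[OF S] and t = blockD[OF T] and g = segD[OF Q]
  note cx = exit_cross[OF g(2)] and cy = exit_cross[OF g(3)]
  have "hpath step (S \<union> Q \<union> T) u v"
    if u: "u \<in> live l" "v \<in> live q" "cross u \<notin> S \<union> Q \<union> T" "cross v \<notin> S \<union> Q \<union> T" for u v
  proof -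
    have ne: "u \<noteq> cross x" "cross y \<noteq> v" using u cx(5) cy(5) g(4,5) by auto
    have "x \<notin> S" "y \<notin> T" using g(4,5) disj by auto
    have 1: "hpath step S u (cross x)"
      using block_hpath[OF S u(1) cx(3) ne(1)] u(3) cx(5) \<open>x \<notin> S\<close> by simp
    have 2: "hpath step T (cross y) v"
      using block_hpath[OF T cy(3) u(2) ne(2)] u(4) cy(5) \<open>y \<notin> T\<close> by simp
    have 3: "hpath step (S \<union> Q) u y"
      by (rule hpath_join[OF 1 cx(2) g(1) disj(2)])
    show ?thesis by (rule path_via[OF 3 g(3) 2]) (use disj in blast)
  qed
  then show ?thesis unfolding block_def using s t by blast
qed

text \<open>
  Only antipodal copies are not joined. If the two ends of a block lie in different
  copies, then at least one of them is joined to any given copy outside the block.\<close>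

lemma block_merge:
  assumes S: "block S l q" "l \<noteq> q" and T: "block T a b" and disj: "S \<inter> T = {}"
  obtains l' q' where "l' \<noteq> q'" "block (S \<union> T) l' q'"
proof -
  note s = blockD[OF S(1)] and t = blockD[OF T]
  have ne: "l \<noteq> b" "q \<noteq> b"
    using live_subset_neq[OF s(1,3) t(4) disj] live_subset_neq[OF s(2,4) t(4) disj] .
  show thesis
  proof (cases "q = - a")
    case False
    from block_join[OF S(1) T disj this] ne show thesis using that by blast
  next
    case True
    then have "l \<noteq> - a" using S(2) by simp
    from block_join[OF block_sym[OF S(1)] T disj this] ne show thesis using that by blast
  qed
qed

lemma region_insert: "region (insert g G) = live g \<union> region G"
  by (simp add: region_def)

lemma region_Un: "region (G \<union> H) = region G \<union> region H"
  by (auto simp: region_def)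

lemma region_disjoint: "G \<subseteq> L \<Longrightarrow> H \<subseteq> L \<Longrightarrow> G \<inter> H = {} \<Longrightarrow> region G \<inter> region H = {}"
  unfolding region_def using live_disjoint by blast

lemma live_region_disjoint: "i \<in> L \<Longrightarrow> G \<subseteq> L \<Longrightarrow> i \<notin> G \<Longrightarrow> live i \<inter> region G = {}"
  unfolding region_def using live_disjoint by blast

lemma block_absorb:
  assumes "finite G" "\<forall>g \<in> G. good g" "S \<inter> region G = {}" "block S l q" "l \<noteq> q"
  obtains l' q' where "l' \<noteq> q'" "block (S \<union> region G) l' q'"
proof -
  have "\<exists>l' q'. l' \<noteq> q' \<and> block (S \<union> region G) l' q'"
    using assms(1-3)
  proof (induction G rule: finite_induct)
    case empty
    then show ?case using assms(4,5) by (auto simp: region_def)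
  next
    case (insert g G)
    then obtain l' q' where b: "l' \<noteq> q'" "block (S \<union> region G) l' q'"
      by (auto simp: region_insert)
    have "G \<subseteq> L" "g \<in> L" using insert.prems goodL by auto
    then have "(S \<union> region G) \<inter> live g = {}"
      using live_region_disjoint[of g G] insert by (auto simp: region_insert)
    moreover have "good g" using insert.prems(1) by blast
    ultimately obtain l2 q2 where "l2 \<noteq> q2" "block (S \<union> region G \<union> live g) l2 q2"
      using block_merge[OF b(2,1) block_good] by blast
    moreover have "S \<union> region G \<union> live g = S \<union> region (insert g G)"
      by (auto simp: region_insert)
    ultimately show ?case by auto
  qed
  then show thesis using that by blast
qed

lemma block_pair:
  assumes "good g" "good h" "g \<noteq> h" "g \<noteq> - h"
  shows "block (live g \<union> live h) g h"
  using block_join[OF block_good[OF assms(1)] block_good[OF assms(2)]]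
    live_disjoint[OF goodL goodL] assms by simp

lemma finish_aux:
  assumes B: "block S l q" and p: "good p" "good p'" "p \<noteq> p'"
    and disj: "S \<inter> live p = {}" "S \<inter> live p' = {}" and st: "s \<in> live p" "t \<in> live p'"
    and ne: "p \<noteq> - l" "p' \<noteq> - q"
  shows "hpath step (S \<union> live p \<union> live p') s t"
proof -
  note b = blockD[OF B] and pL = goodL[OF p(1)] goodL[OF p(2)]
  have "l \<noteq> p" "q \<noteq> p'"
    using live_subset_neq[OF b(1,3) order_refl disj(1)] live_subset_neq[OF b(2,4) order_refl disj(2)] .
  obtain x where x: "x \<in> live p" "out x = l" "exit x" "x \<noteq> s"
    using obtain_edge[OF pL(1) b(1)] \<open>l \<noteq> p\<close> ne by (metis minus_minus)
  obtain y where y: "y \<in> live p'" "out y = q" "exit y" "y \<noteq> t"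
    using obtain_edge[OF pL(2) b(2)] \<open>q \<noteq> p'\<close> ne by (metis minus_minus)
  have pp: "live p \<inter> live p' = {}" using live_disjoint[OF pL p(3)] .
  note cx = exit_cross[OF x(3)] and cy = exit_cross[OF y(3)]
  have "x \<noteq> y" using x(1) y(1) pp by blast
  then have "cross x \<noteq> cross y" using cx(5) cy(5) by metis
  moreover have "cross (cross x) \<notin> S" "cross (cross y) \<notin> S" using cx(5) cy(5) x(1) y(1) disj by auto
  ultimately have R: "hpath step S (cross x) (cross y)"
    using block_hpath[OF B] cx(3) cy(3) x(2) y(2) by simp
  have "hpath step (live p \<union> live p' \<union> S) s t"
    by (rule path_detour[OF good_hpath(2)[OF p(1) st(1) x(1)] good_hpath(2)[OF p(2) y(1) st(2)] x(3) y(3) R])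
      (use pp disj x(4) y(4) in auto)
  then show ?thesis by (simp add: Un_ac)
qed

text \<open>
  The ends of the block can be interchanged; in one of the two positions neither \<open>p\<close> nor \<open>p'\<close> is antipodal to
  the end of the block next to it.\<close>

lemma block_finish:
  assumes B: "block S l q" "l \<noteq> q" and p: "good p" "good p'" "p \<noteq> p'"
    and disj: "S \<inter> live p = {}" "S \<inter> live p' = {}" and st: "s \<in> live p" "t \<in> live p'"
  shows "hpath step (S \<union> live p \<union> live p') s t"
proof (cases "p \<noteq> - l \<and> p' \<noteq> - q")
  case True
  then show ?thesis using finish_aux[OF B(1) p disj st] by blast
next
  case False
  then have "p \<noteq> - q" "p' \<noteq> - l" using B(2) p(3) by auto
  then show ?thesis using finish_aux[OF block_sym[OF B(1)] p disj st] by blast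
qed

lemma close_aux:
  assumes S: "block S l q" "l \<noteq> q" and T: "block T a b" "a \<noteq> b" and disj: "S \<inter> T = {}"
    and ne: "q \<noteq> - a" "b \<noteq> - l"
  shows "hcycle step (S \<union> T)"
proof -
  note s = blockD[OF S(1)] and t = blockD[OF T(1)]
  have "q \<noteq> a" "l \<noteq> b" using live_subset_neq[OF s(2,4) t(3) disj] live_subset_neq[OF s(1,3) t(4) disj] .
  obtain x where x: "x \<in> live q" "out x = a" "exit x"
    using obtain_edge[OF s(2) t(1)] \<open>q \<noteq> a\<close> ne by (metis minus_minus)
  obtain y where y: "y \<in> live b" "out y = l" "exit y"
    using obtain_edge[OF t(2) s(1)] \<open>l \<noteq> b\<close> ne by (metis minus_minus)
  note cx = exit_cross[OF x(3)] and cy = exit_cross[OF y(3)]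
  have m: "x \<in> S" "cross y \<in> S" "y \<in> T" "cross x \<in> T" using x y cx(3) cy(3) s t by auto
  have "cross y \<noteq> x" using live_disjoint[OF s(1,2) S(2)] cy(3) y(2) x(1) by auto
  moreover have "cross (cross y) \<notin> S" "cross x \<notin> S" using cy(5) m disj by auto
  ultimately have 1: "hpath step S (cross y) x" using block_hpath[OF S(1)] cy(3) y(2) x(1) by simp
  have "cross x \<noteq> y" using live_disjoint[OF t(1,2) T(2)] cx(3) x(2) y(1) by auto
  moreover have "cross (cross x) \<notin> T" "cross y \<notin> T" using cx(5) m disj by auto
  ultimately have 2: "hpath step T (cross x) y" using block_hpath[OF T(1)] cx(3) x(2) y(1) by simp
  have h: "hpath step (S \<union> T) (cross y) y" using path_via[OF 1 x(3) 2 disj] .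
  have "finite (S \<union> T)" using hpath_ends[OF h] by simp
  then have "card (live l) \<le> card (S \<union> T)" using s(3) by (intro card_mono) auto
  then have "3 \<le> card (S \<union> T)" using card_live_large[OF s(1)] by linarith
  from hpath_imp_hcycle[OF h cy(1) this] show ?thesis .
qed

lemma block_close:
  assumes S: "block S l q" "l \<noteq> q" and T: "block T a b" "a \<noteq> b" and disj: "S \<inter> T = {}"
  shows "hcycle step (S \<union> T)"
proof (cases "q \<noteq> - a \<and> b \<noteq> - l")
  case True
  then show ?thesis using close_aux[OF assms] by blast
next
  case False
  then have "q \<noteq> - b" "a \<noteq> - l" using S(2) T(2) by auto
  then show ?thesis using close_aux[OF S block_sym[OF T(1)] _ disj] T(2) by simp
qed

lemma two_compatible:
  assumes "3 \<le> card (I :: int set)"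
  obtains g h where "g \<in> I" "h \<in> I" "g \<noteq> h" "g \<noteq> - h"
proof -
  have fin: "finite I" using assms by (metis card.infinite not_numeral_le_zero)
  obtain g where g: "g \<in> I" using assms by force
  have "card {g, - g} < card I" using assms card_insert_le_m1[of 2 "{- g}" g] by simp
  then have "\<not> I \<subseteq> {g, - g}" using card_mono[of "{g, - g}" I] by auto
  then obtain h where "h \<in> I" "h \<noteq> g" "h \<noteq> - g" by blast
  then show thesis using that[of g h] g by auto
qed

lemma goodsL: "\<forall>g \<in> G. good g \<Longrightarrow> G \<subseteq> L"
  using goodL by blast

lemma finite_goods: "\<forall>g \<in> G. good g \<Longrightarrow> finite G"
  by (rule finite_subset[OF goodsL finite_L])

lemma block_path:
  assumes G: "\<forall>g \<in> G. good g" and B: "block S l q" "l \<noteq> q" "S \<inter> region G = {}"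
    and p: "p \<in> G" "p' \<in> G" "p \<noteq> p'" and st: "s \<in> live p" "t \<in> live p'"
  shows "hpath step (S \<union> region G) s t"
proof -
  let ?R = "G - {p, p'}"
  have R: "finite ?R" "\<forall>g \<in> ?R. good g" "S \<inter> region ?R = {}"
    using finite_goods[OF G] G B(3) by (auto simp: region_def)
  obtain l' q' where b: "l' \<noteq> q'" "block (S \<union> region ?R) l' q'"
    using block_absorb[OF R B(1,2)] .
  have d: "(S \<union> region ?R) \<inter> live p = {}" "(S \<union> region ?R) \<inter> live p' = {}"
    using live_region_disjoint[of p ?R] live_region_disjoint[of p' ?R] goodsL[OF G] p B(3)
    by (auto simp: region_def)
  have "hpath step (S \<union> region ?R \<union> live p \<union> live p') s t"
    by (rule block_finish[OF b(2,1) _ _ p(3) d st]) (use G p in auto)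
  moreover have "S \<union> region ?R \<union> live p \<union> live p' = S \<union> region G"
    using p by (auto simp: region_def)
  ultimately show ?thesis by simp
qed

text \<open>
  Besides the copies of the two ends there are at least three more, two of which are joined and
  form the block to which the rest is added.\<close>

lemma region_path:
  assumes G: "\<forall>g \<in> G. good g" and c: "5 \<le> card G"
    and p: "p \<in> G" "p' \<in> G" "p \<noteq> p'" and st: "s \<in> live p" "t \<in> live p'"
  shows "hpath step (region G) s t"
proof -
  have "card {p, p'} \<le> 2" by (simp add: card_insert_if)
  then have "3 \<le> card (G - {p, p'})"
    using c diff_card_le_card_Diff[of "{p, p'}" G] by simp
  then obtain g h where gh: "g \<in> G - {p, p'}" "h \<in> G - {p, p'}" "g \<noteq> h" "g \<noteq> - h"
    by (rule two_compatible)
  have b: "block (live g \<union> live h) g h" using block_pair gh G by simp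
  have "(live g \<union> live h) \<inter> region (G - {g, h}) = {}"
    using live_region_disjoint[of g "G - {g, h}"] live_region_disjoint[of h "G - {g, h}"] goodsL[OF G] gh
    by blast
  from block_path[OF _ b gh(3) this _ _ p(3) st] G gh p
  have "hpath step (live g \<union> live h \<union> region (G - {g, h})) s t" by simp
  moreover have "live g \<union> live h \<union> region (G - {g, h}) = region G"
    using gh by (auto simp: region_def)
  ultimately show ?thesis by simp
qed

text \<open>
  If both ends lie in one copy, a Hamiltonian path of this copy is cut at an edge whose ends lead to two other
  copies of the region, and the rest of the region is inserted there.\<close>

lemma region_connected:
  assumes G: "\<forall>g \<in> G. good g" and c: "card (L - G) \<le> 2"
    and st: "s \<in> region G" "t \<in> region G" "s \<noteq> t"
  shows "hpath step (region G) s t"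
proof -
  have GL: "G \<subseteq> L" using goodsL[OF G] .
  have "card (L - G) = card L - card G" 
    by (rule card_Diff_subset[OF finite_subset[OF GL finite_L] GL])
  then have c6: "6 \<le> card G" using c card_L m3 by arith
  obtain p p' where p: "p \<in> G" "s \<in> live p" "p' \<in> G" "t \<in> live p'"
    using st unfolding region_def by blast
  show ?thesis
  proof (cases "p = p'")
    case False
    then show ?thesis using region_path[OF G _ p(1,3) _ p(2,4)] c6 by simp
  next
    case True
    have gp: "good p" using G p(1) by blast
    have "finite (L - G)" "card (L - G) \<le> m - 1" using finite_L c m3 by auto
    from break_path_few[OF gp p(2) _ st(3) this] p(4) True
    obtain S1 S2 x y where b: "S1 \<union> S2 = live p" "S1 \<inter> S2 = {}" "hpath step S1 s x"
      "hpath step S2 y t" "x \<in> live p" "y \<in> live p" "exit x" "exit y" "out x \<noteq> out y"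
      "out x \<notin> L - G" "out y \<notin> L - G" by blast
    note cx = exit_cross[OF b(7)] and cy = exit_cross[OF b(8)]
    have o: "out x \<in> G - {p}" "out y \<in> G - {p}"
      using b(10,11) cx(4) cy(4) exit_out[OF b(7,5) goodL[OF gp]] exit_out[OF b(8,6) goodL[OF gp]]
      by blast+
    have "5 \<le> card (G - {p})" using c6 p(1) by simp
    then have R: "hpath step (region (G - {p})) (cross x) (cross y)"
      using region_path[OF _ _ o b(9) cx(3) cy(3)] G by simp
    have "live p \<inter> region (G - {p}) = {}" using live_region_disjoint GL p(1) by blast
    then have "hpath step (S1 \<union> S2 \<union> region (G - {p})) s t"
      using b(1) by (intro path_detour[OF b(3,4,7,8) R b(2)]) blast+
    moreover have "S1 \<union> S2 \<union> region (G - {p}) = region G"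
      using b(1) p(1) by (auto simp: region_def)
    ultimately show ?thesis by simp
  qed
qed

lemma seg_block:
  assumes "seg Q x y" "good (out x)" "good (out y)" "out x \<noteq> out y" "Q \<inter> live (out x) = {}"
    "Q \<inter> live (out y) = {}"
  shows "block (live (out x) \<union> Q \<union> live (out y)) (out x) (out y)"
  using block_seg[OF block_good[OF assms(2)] block_good[OF assms(3)] assms(1)]
    live_disjoint[OF goodL[OF assms(2)] goodL[OF assms(3)] assms(4)] assms(5,6) by blast

lemma seg_path:
  assumes G: "\<forall>g \<in> G. good g" and Q: "seg Q x y" "Q \<inter> region G = {}" "out x \<noteq> out y"
      "out x \<in> G - {p, p'}" "out y \<in> G - {p, p'}"
    and p: "p \<in> G" "p' \<in> G" "p \<noteq> p'" and st: "s \<in> live p" "t \<in> live p'"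
  shows "hpath step (region G \<union> Q) s t"
proof -
  let ?H = "G - {out x, out y}"
  have b: "block (live (out x) \<union> Q \<union> live (out y)) (out x) (out y)"
    using Q G by (intro seg_block) (auto simp: region_def)
  have "(live (out x) \<union> Q \<union> live (out y)) \<inter> region ?H = {}"
    using live_region_disjoint[of "out x" ?H] live_region_disjoint[of "out y" ?H] goodsL[OF G] Q
    by (auto simp: region_def)
  from block_path[OF _ b Q(3) this _ _ p(3) st] G p Q(4,5)
  have "hpath step (live (out x) \<union> Q \<union> live (out y) \<union> region ?H) s t" by simp
  moreover have "live (out x) \<union> Q \<union> live (out y) \<union> region ?H = region G \<union> Q"
    using Q(4,5) by (auto simp: region_def)
  ultimately show ?thesis by simp
qed

lemma chain_block:
  assumes Q1: "seg Q1 x1 y1" and Q2: "seg Q2 x2 y2" and sh: "out y1 = out x2"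
    and g: "good (out x1)" "good (out y1)" "good (out y2)"
    and ne: "out x1 \<noteq> out y1" "out x2 \<noteq> out y2" "out x1 \<noteq> out y2"
    and disj: "Q1 \<inter> Q2 = {}" "(Q1 \<union> Q2) \<inter> region {out x1, out y1, out y2} = {}"
  shows "block (Q1 \<union> Q2 \<union> region {out x1, out y1, out y2}) (out x1) (out y2)"
proof -
  have b: "block (live (out x1) \<union> Q1 \<union> live (out y1)) (out x1) (out x2)"
    using seg_block[OF Q1 g(1,2) ne(1)] disj(2) sh by (auto simp: region_def)
  have d: "live (out x1) \<inter> live (out y2) = {}" "live (out y1) \<inter> live (out y2) = {}"
    using live_disjoint[OF goodL goodL] g ne sh by auto
  have "block (live (out x1) \<union> Q1 \<union> live (out y1) \<union> Q2 \<union> live (out y2)) (out x1) (out y2)"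
    by (rule block_seg[OF b block_good[OF g(3)] Q2]) (use d disj in \<open>auto simp: region_def\<close>)
  moreover have "live (out x1) \<union> Q1 \<union> live (out y1) \<union> Q2 \<union> live (out y2)
      = Q1 \<union> Q2 \<union> region {out x1, out y1, out y2}" by (auto simp: region_def)
  ultimately show ?thesis by simp
qed

text \<open>
  If the segments lead to a common copy, it connects them; if not, they form two blocks, which merge.
  Only when both segments lead to the same two copies would the chain close too early.\<close>

lemma two_seg_block:
  assumes Q1: "seg Q1 x1 y1" and Q2: "seg Q2 x2 y2"
    and g: "good (out x1)" "good (out y1)" "good (out x2)" "good (out y2)"
    and ne: "out x1 \<noteq> out y1" "out x2 \<noteq> out y2" "{out x1, out y1} \<noteq> {out x2, out y2}"
    and disj: "Q1 \<inter> Q2 = {}" "(Q1 \<union> Q2) \<inter> region {out x1, out y1, out x2, out y2} = {}"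
  obtains l q where "l \<noteq> q" "block (Q1 \<union> Q2 \<union> region {out x1, out y1, out x2, out y2}) l q"
proof -
  let ?G = "{out x1, out y1, out x2, out y2}"
  note s1 = seg_sym[OF Q1] and s2 = seg_sym[OF Q2]
  have sub: "(Q1 \<union> Q2) \<inter> region H = {}" if "H \<subseteq> ?G" for H
  proof -
    have "region H \<subseteq> region ?G" unfolding region_def using that by (rule UN_mono) simp
    then show ?thesis using disj(2) by auto
  qed
  consider "out y1 = out x2" | "out y1 = out y2" | "out x1 = out x2" | "out x1 = out y2"
    | "{out x1, out y1} \<inter> {out x2, out y2} = {}" by simp metis
  then show thesis
  proof cases
    case 1
    then have e: "out x1 \<noteq> out y2" "?G = {out x1, out y1, out y2}" using ne by auto
    have "block (Q1 \<union> Q2 \<union> region {out x1, out y1, out y2}) (out x1) (out y2)"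
      by (rule chain_block[OF Q1 Q2 1 g(1,2,4) ne(1,2) e(1) disj(1) sub]) (use e in auto)
    then show ?thesis using that e by simp
  next
    case 2
    then have e: "out x1 \<noteq> out x2" "?G = {out x1, out y1, out x2}" using ne by auto
    have "block (Q1 \<union> Q2 \<union> region {out x1, out y1, out x2}) (out x1) (out x2)"
      by (rule chain_block[OF Q1 s2 2 g(1,2,3) ne(1) ne(2)[symmetric] e(1) disj(1) sub]) (use e in auto)
    then show ?thesis using that e by simp
  next
    case 3
    then have e: "out y1 \<noteq> out y2" "?G = {out y1, out x1, out y2}" using ne by auto
    have "block (Q1 \<union> Q2 \<union> region {out y1, out x1, out y2}) (out y1) (out y2)"
      by (rule chain_block[OF s1 Q2 3 g(2,1,4) ne(1)[symmetric] ne(2) e(1) disj(1) sub]) (use e in auto)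
    then show ?thesis using that e by simp
  next
    case 4
    then have e: "out y1 \<noteq> out x2" "?G = {out y1, out x1, out x2}" using ne by auto
    have "block (Q1 \<union> Q2 \<union> region {out y1, out x1, out x2}) (out y1) (out x2)"
      by (rule chain_block[OF s1 s2 4 g(2,1,3) ne(1)[symmetric] ne(2)[symmetric] e(1) disj(1) sub])
        (use e in auto)
    then show ?thesis using that e by simp
  next
    case 5
    have r: "region {out x1, out y1} \<inter> region {out x2, out y2} = {}"
      using 5 g goodL by (intro region_disjoint) auto
    have b1: "block (live (out x1) \<union> Q1 \<union> live (out y1)) (out x1) (out y1)"
      using disj(2) by (intro seg_block[OF Q1 g(1,2) ne(1)]) (auto simp: region_def)
    have b2: "block (live (out x2) \<union> Q2 \<union> live (out y2)) (out x2) (out y2)"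
      using disj(2) by (intro seg_block[OF Q2 g(3,4) ne(2)]) (auto simp: region_def)
    have "(live (out x1) \<union> Q1 \<union> live (out y1)) \<inter> (live (out x2) \<union> Q2 \<union> live (out y2)) = {}"
      using r disj unfolding region_def by blast
    from block_merge[OF b1 ne(1) b2 this] obtain l q where "l \<noteq> q"
      "block (live (out x1) \<union> Q1 \<union> live (out y1) \<union> (live (out x2) \<union> Q2 \<union> live (out y2))) l q" .
    moreover have "live (out x1) \<union> Q1 \<union> live (out y1) \<union> (live (out x2) \<union> Q2 \<union> live (out y2))
      = Q1 \<union> Q2 \<union> region ?G" by (auto simp: region_def)
    ultimately show ?thesis using that by simp
  qed
qed

lemma block_cycle:
  assumes B: "block S l q" "l \<noteq> q" and G: "\<forall>g \<in> G. good g" "S \<inter> region G = {}" "3 \<le> card G"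
  shows "hcycle step (S \<union> region G)"
proof -
  obtain g h where gh: "g \<in> G" "h \<in> G" "g \<noteq> h" "g \<noteq> - h" using two_compatible[OF G(3)] .
  have b: "block (live g \<union> live h) g h" using block_pair gh G(1) by simp
  let ?R = "G - {g, h}"
  have R: "finite ?R" "\<forall>g \<in> ?R. good g" using finite_goods[OF G(1)] G(1) by auto
  have d: "(live g \<union> live h) \<inter> region ?R = {}"
    using live_region_disjoint[of g ?R] live_region_disjoint[of h ?R] goodsL[OF G(1)] gh by blast
  obtain l' q' where b': "l' \<noteq> q'" "block (live g \<union> live h \<union> region ?R) l' q'"
    using block_absorb[OF R d b gh(3)] .
  have e: "live g \<union> live h \<union> region ?R = region G" using gh by (auto simp: region_def)
  show ?thesis using block_close[OF B b'(2,1)[unfolded e] G(2)] .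
qed

lemma blocks_cycle:
  assumes B: "block S l q" "l \<noteq> q" "block T a b" "a \<noteq> b" "S \<inter> T = {}"
    and G: "\<forall>g \<in> G. good g" "S \<inter> region G = {}" "T \<inter> region G = {}"
  shows "hcycle step (S \<union> T \<union> region G)"
proof -
  obtain l' q' where b': "l' \<noteq> q'" "block (S \<union> region G) l' q'"
    using block_absorb[OF finite_goods[OF G(1)] G(1,2) B(1,2)] .
  have "(S \<union> region G) \<inter> T = {}" using B(5) G(3) by blast
  from block_close[OF b'(2,1) B(3,4) this] show ?thesis by (simp add: Un_ac)
qed

lemma two_seg_cycle:
  assumes G: "\<forall>g \<in> G. good g" "6 \<le> card G"
    and Q1: "seg Q1 x1 y1" and Q2: "seg Q2 x2 y2"
    and o: "out x1 \<in> G" "out y1 \<in> G" "out x2 \<in> G" "out y2 \<in> G"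
    and ne: "out x1 \<noteq> out y1" "out x2 \<noteq> out y2" "{out x1, out y1} \<noteq> {out x2, out y2}"
    and disj: "Q1 \<inter> Q2 = {}" "(Q1 \<union> Q2) \<inter> region G = {}"
  shows "hcycle step (Q1 \<union> Q2 \<union> region G)"
proof -
  let ?O = "{out x1, out y1, out x2, out y2}"
  have OG: "?O \<subseteq> G" using o by simp
  have split: "region G = region ?O \<union> region (G - ?O)" using OG by (auto simp: region_def)
  show ?thesis
  proof (cases "{out x1, out y1} \<inter> {out x2, out y2} = {}")
    case True
    have r: "region {out x1, out y1} \<inter> region {out x2, out y2} = {}"
      using True OG goodsL[OF G(1)] by (intro region_disjoint) auto
    have b1: "block (live (out x1) \<union> Q1 \<union> live (out y1)) (out x1) (out y1)"
      using disj(2) o G(1) by (intro seg_block[OF Q1 _ _ ne(1)]) (auto simp: region_def)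
    have b2: "block (live (out x2) \<union> Q2 \<union> live (out y2)) (out x2) (out y2)"
      using disj(2) o G(1) by (intro seg_block[OF Q2 _ _ ne(2)]) (auto simp: region_def)
    have r2: "region ?O \<inter> region (G - ?O) = {}" using OG goodsL[OF G(1)] by (intro region_disjoint) auto
    have "hcycle step ((live (out x1) \<union> Q1 \<union> live (out y1)) \<union> (live (out x2) \<union> Q2 \<union> live (out y2))
        \<union> region (G - ?O))"
    proof (rule blocks_cycle[OF b1 ne(1) b2 ne(2)])
      show "(live (out x1) \<union> Q1 \<union> live (out y1)) \<inter> (live (out x2) \<union> Q2 \<union> live (out y2)) = {}"
        using r disj o unfolding region_def by blast
      show "\<forall>g\<in>G - ?O. good g" using G(1) by blast
      show "(live (out x1) \<union> Q1 \<union> live (out y1)) \<inter> region (G - ?O) = {}"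
        "(live (out x2) \<union> Q2 \<union> live (out y2)) \<inter> region (G - ?O) = {}"
        using r2 disj(2) split by (auto simp: region_def)
    qed
    moreover have "(live (out x1) \<union> Q1 \<union> live (out y1)) \<union> (live (out x2) \<union> Q2 \<union> live (out y2))
        \<union> region (G - ?O) = Q1 \<union> Q2 \<union> region G" unfolding split by (auto simp: region_def)
    ultimately show ?thesis by simp
  next
    case False
    then have c3: "card ?O \<le> 3" by (auto simp: card_insert_if)
    have d: "(Q1 \<union> Q2) \<inter> region ?O = {}" using disj(2) split by blast
    obtain l q where b: "l \<noteq> q" "block (Q1 \<union> Q2 \<union> region ?O) l q"
      using two_seg_block[OF Q1 Q2 _ _ _ _ ne disj(1) d] o G(1) by blast
    have "3 \<le> card (G - ?O)"
      using G(2) c3 diff_card_le_card_Diff[of ?O G] by simp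
    moreover have "(Q1 \<union> Q2 \<union> region ?O) \<inter> region (G - ?O) = {}"
      using disj(2) split region_disjoint[of ?O "G - ?O"] OG goodsL[OF G(1)] by blast
    ultimately have "hcycle step (Q1 \<union> Q2 \<union> region ?O \<union> region (G - ?O))"
      using G(1) by (intro block_cycle[OF b(2,1)]) auto
    then show ?thesis unfolding split by (simp add: Un_ac)
  qed
qed

lemma card_region_large:
  assumes "G \<subseteq> L" "g \<in> G"
  shows "3 \<le> card (region G)"
proof -
  have "finite (region G)" unfolding region_def
    using assms(1) finite_live finite_subset[OF assms(1) finite_L] by blast
  moreover have "live g \<subseteq> region G" using assms(2) by (auto simp: region_def)
  ultimately have "card (live g) \<le> card (region G)" by (rule card_mono)
  moreover have "g \<in> L" using assms by blast
  ultimately show ?thesis using card_live_large[of g] by linarith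
qed

end

context few_faults
begin

section \<open>Hamiltonian paths in the presence of faults\<close>

lemma concentrated_touch:
  assumes "load c = faults"
  shows "e \<in> M \<Longrightarrow> e \<inter> copy c \<noteq> {}" "d \<in> D \<Longrightarrow> d \<subseteq> copy c"
proof -
  have "card {e \<in> M. e \<inter> copy c = {}} = 0" "card {d \<in> D. \<not> d \<subseteq> copy c} = 0"
    using card_touching_split[of c] card_edges_split[of c] assms unfolding load_def faults_def
    by linarith+
  moreover have "finite {e \<in> M. e \<inter> copy c = {}}" "finite {d \<in> D. \<not> d \<subseteq> copy c}"
    using finM D(1) by simp_all
  ultimately have "{e \<in> M. e \<inter> copy c = {}} = {}" "{d \<in> D. \<not> d \<subseteq> copy c} = {}" by simp_all
  then show "e \<in> M \<Longrightarrow> e \<inter> copy c \<noteq> {}" "d \<in> D \<Longrightarrow> d \<subseteq> copy c" by blast+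
qed

lemma concentrated_exit_in:
  assumes "load c = faults" "c \<in> L" "x \<in> live c"
  shows "exit x"
proof -
  have "card {x \<in> live c. \<not> free x} = 0" using card_blocked[OF assms(2)] assms(1) by linarith
  then have "{x \<in> live c. \<not> free x} = {}" using finite_live[OF assms(2)] by simp
  then show ?thesis using assms unfolding exit_def by blast
qed

text \<open>
  If every fault touches the copy \<open>c\<close>, then a vertex outside \<open>c\<close> can only be blocked by a fault at the other end
  of its edge, which then lies in \<open>c\<close>.\<close>

lemma concentrated_exit:
  assumes "load c = faults" "c \<in> L" "i \<in> L" "x \<in> live i" "out x \<noteq> c"
  shows "exit x"
proof (cases "i = c")
  case True
  then show ?thesis using concentrated_exit_in assms by blast
next
  case False
  note x = liveD[OF assms(4)] and cf = cross_facts[OF assms(3) liveD(1)[OF assms(4)]]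
  have nc: "x \<notin> copy c" "cross x \<notin> copy c"
    using copy_disjoint[OF assms(3,2) False] copy_disjoint[OF cf(1) assms(2,5)] x cf(4) by blast+
  have "cross x \<notin> W"
  proof
    assume "cross x \<in> W"
    then obtain e where e: "e \<in> M" "cross x \<in> e" unfolding W_def by blast
    then obtain y where y: "y \<in> e" "y \<in> copy c" using concentrated_touch(1)[OF assms(1)] by blast
    have "cross x = cross y" using M_cross_pair(1)[OF e(1) assms(2) y(2,1) e(2) nc(2)] .
    then have "x = y" using cf(6) cross_facts(6)[OF assms(2) y(2)] by metis
    then show False using y(2) nc(1) by simp
  qed
  moreover have "{x, cross x} \<notin> D" using concentrated_touch(2)[OF assms(1)] nc by blast
  ultimately show ?thesis unfolding exit_def free_def using assms(3,4) by blast
qed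

text \<open>
  For three symbols the count behind \<open>break_cycle\<close> is too weak; the explicit paths around one missing
  vertex take its place.\<close>

lemma three_symbols_path:
  assumes m: "m = 3" and i: "i \<in> L" and w: "w \<in> copy i" "copy i \<inter> W = {w}" and D': "edges_in i = {}"
    and g: "g \<in> L" "g \<noteq> i" "g \<noteq> - i" "g \<noteq> out w" and h: "h \<in> L" "h \<noteq> i" "h \<noteq> - i" "h \<noteq> out w"
    and gh: "g \<noteq> h"
  obtains x y where "hpath step (live i) x y" "x \<in> live i" "y \<in> live i" "out x = g" "out y = h"
proof -
  have lab: "l \<in> labels (A - {\<bar>i\<bar>})" if "l \<in> L" "l \<noteq> i" "l \<noteq> - i" for l
    using that unfolding labels_iff[OF posset_copy] L_def labels_iff[OF A(1)]
    by (auto simp: abs_eq_iff)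
  interpret b: base "A - {\<bar>i\<bar>}" "i # z" w
    using posset_copy card_rest[OF i] w(1) m by unfold_locales (auto simp: copy_def)
  obtain x y where xy: "hpath (padj {} 3) (sperms (A - {\<bar>i\<bar>}) (i # z) - {w}) x y" "out x = g" "out y = h"
    using b.one_hole[OF lab[OF g(1-3)] lab[OF h(1-3)] gh g(4) h(4)] by blast
  have e: "sperms (A - {\<bar>i\<bar>}) (i # z) - {w} = live i"
    using w(2) unfolding copy_def[symmetric] live_def by blast
  have "hpath inner (live i) x y"
    using xy(1)[unfolded e]
  proof (rule hpath_mono)
    fix u v assume u: "u \<in> live i" "v \<in> live i" "padj {} 3 u v"
    have "{u, v} \<notin> D" using D' u(1,2) liveD(1) unfolding edges_in_def by blast
    then show "inner u v" using u(3) m unfolding inner_def padj_def by simp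
  qed
  then have h: "hpath step (live i) x y"
    by (intro inner_hpath[OF i]) (auto simp: live_def)
  from hpath_ends[OF this] xy(2,3) h show thesis using that by simp
qed

text \<open>
  The faults that touch two copies each; they are responsible for all configurations with
  several damaged copies.\<close>

definition "all_cross \<longleftrightarrow> D = {} \<and> (\<forall>e \<in> M. \<exists>i \<in> L. \<exists>v \<in> copy i. e = {v, cross v})"

lemma all_cross_exit:
  assumes "all_cross" "i \<in> L" "x \<in> live i"
  shows "exit x"
proof -
  note x = liveD[OF assms(3)] and cf = cross_facts[OF assms(2) liveD(1)[OF assms(3)]]
  have "cross x \<notin> W"
  proof
    assume "cross x \<in> W"
    then obtain e where e: "e \<in> M" "cross x \<in> e" unfolding W_def by blast
    then obtain j v where v: "j \<in> L" "v \<in> copy j" "e = {v, cross v}"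
      using assms(1) unfolding all_cross_def by blast
    have "x \<in> e"
    proof (cases "cross x = v")
      case True
      then show ?thesis using cf(6) v(3) by auto
    next
      case False
      then have "cross x = cross v" using e(2) v(3) by simp
      then have "x = v" using cf(6) cross_facts(6)[OF v(1,2)] by metis
      then show ?thesis using v(3) by simp
    qed
    then show False using e(1) x(2) unfolding W_def by blast
  qed
  then show ?thesis unfolding exit_def free_def using assms unfolding all_cross_def by blast
qed

lemma all_cross_load_one:
  assumes "all_cross" "i \<in> L" "load i = 1"
  obtains w where "w \<in> copy i" "copy i \<inter> W = {w}"
proof -
  have "card (touching i) = 1" using assms(1,3) unfolding load_def edges_in_def all_cross_def by simp
  then obtain e where e: "touching i = {e}" by (rule card_1_singletonE)
  then have eM: "e \<in> M" "e \<inter> copy i \<noteq> {}" unfolding touching_def by blast+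
  then obtain j v where v: "j \<in> L" "v \<in> copy j" "e = {v, cross v}"
    using assms(1) unfolding all_cross_def by blast
  note cf = cross_facts[OF v(1,2)]
  have "copy i \<inter> W = e \<inter> copy i" using e unfolding touching_def W_def by blast
  moreover obtain w where w: "w \<in> e" "w \<in> copy i" using eM(2) by blast
  moreover have "e \<inter> copy i = {w}"
  proof -
    have "\<not> (v \<in> copy i \<and> cross v \<in> copy i)"
      using copyD(2)[OF assms(2)] copyD(2)[OF v(1,2)] copyD(2)[OF cf(1,4)] cf(2) by metis
    then show ?thesis using w v(3) by blast
  qed
  ultimately show thesis using that by simp
qed

text \<open>
  If the deleted vertices of the copy lead to copies that are forbidden anyway, they do not count twice, and four
  forbidden copies can be afforded for four and more symbols.\<close>

lemma all_cross_seg: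
  assumes ac: "all_cross" and i: "i \<in> L" "1 \<le> load i" "load i + 2 \<le> m"
    and X: "finite X" "card X \<le> 4" "\<And>w. w \<in> copy i \<Longrightarrow> w \<in> W \<Longrightarrow> out w \<in> X"
  obtains x y where "seg (live i) x y" "x \<in> live i" "y \<in> live i" "out x \<noteq> out y" "out x \<notin> X" "out y \<notin> X"
proof (cases "m = 3")
  case True
  then have "load i = 1" using i by simp
  then obtain w where w: "w \<in> copy i" "copy i \<inter> W = {w}" using all_cross_load_one[OF ac i(1)] by blast
  have ow: "out w \<in> X" using X(3) w by blast
  \<comment> \<open>The copy \<open>i\<close> is joined to six others, and at most four of them are forbidden.\<close>
  let ?C = "L - {i, - i}"
  have "card ?C = 6" using finite_L card_L True i(1) L_uminus L_nonzero[OF i(1)]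
    by (subst card_Diff_subset) auto
  then have "2 \<le> card (?C - X)" using diff_card_le_card_Diff[OF X(1), of ?C] X(2) by linarith
  moreover have "finite (?C - X)" using finite_L by blast
  ultimately obtain g h where gh: "g \<in> ?C - X" "h \<in> ?C - X" "g \<noteq> h"
    using card_le_Suc0_iff_eq[of "?C - X"] by (metis not_less_eq_eq numeral_2_eq_2)
  have "edges_in i = {}" using ac unfolding all_cross_def edges_in_def by simp
  then obtain x y where xy: "hpath step (live i) x y" "x \<in> live i" "y \<in> live i" "out x = g" "out y = h"
    using three_symbols_path[OF True i(1) w _ _ _ _ _ _ _ _ _ gh(3)] gh ow by blast
  then have "seg (live i) x y" unfolding seg_def using all_cross_exit[OF ac i(1)] by blast
  then show ?thesis using that xy gh by simp
next
  case False
  then have m4: "4 \<le> m" using m3 by simp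
  have fin: "finite (copy i)" "card (copy i) = 2 * m * K" using card_copy[OF i(1)] by simp_all
  let ?H = "copy i \<inter> W"
  have "touching i \<noteq> {}" using i(2) ac unfolding load_def edges_in_def all_cross_def by auto
  then have "?H \<noteq> {}" unfolding touching_def W_def by blast
  then have h: "1 \<le> card ?H" using fin(1) by (simp add: Suc_leI card_gt_0_iff)
  have "{x \<in> live i. out x \<in> X \<or> \<not> free x} = {x \<in> copy i. out x \<in> X} - ?H"
    using all_cross_exit[OF ac i(1)] unfolding exit_def live_def by blast
  moreover have "?H \<subseteq> {x \<in> copy i. out x \<in> X}" using X(3) by blast
  ultimately have 1: "card {x \<in> live i. out x \<in> X \<or> \<not> free x} + card ?H = card {x \<in> copy i. out x \<in> X}"
    using fin(1) by (simp add: card_Diff_subset card_mono)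
  have "card {x \<in> copy i. out x \<in> X} \<le> card X * K" using card_classes[OF i(1) X(1)] .
  also have "\<dots> \<le> m * K" using X(2) m4 by (intro mult_le_mono1) simp
  finally have 2: "card {x \<in> copy i. out x \<in> X} \<le> m * K" .
  have "live i = copy i - ?H" unfolding live_def by blast
  then have "card (live i) + card ?H = card (copy i)" using fin(1) by (simp add: card_Diff_subset card_mono)
  then have "2 * card {x \<in> live i. out x \<in> X \<or> \<not> free x} < card (live i)"
    using 1 2 h fin(2) by linarith
  then show ?thesis using break_cycle[OF i(1) live_cycle[OF i(1,3)]] that by blast
qed

text \<open>
  Two copies are traversed together through an edge \<open>{x, cross x}\<close>: the path in \<open>p\<close> is cut next to \<open>x\<close>, the cycle
  in \<open>c\<close> next to \<open>cross x\<close>. The two ends that arise lead to different copies whatever the choice of the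
  neighbours, so this choice can be used to avoid one more copy \<open>f\<close>.\<close>

lemma bridge:
  assumes p: "good p" and c: "c \<in> L" "hcycle inner (live c)" and pc: "p \<noteq> c" "p \<noteq> - c"
    and st: "s \<in> live p" "t \<in> live p" "s \<noteq> t"
  obtains S1 S2 s' t' u v where "s' = s \<and> t' = t \<or> s' = t \<and> t' = s" "S1 \<union> S2 = live p \<union> live c"
    "S1 \<inter> S2 = {}" "hpath step S1 s' u" "hpath step S2 v t'" "u \<in> live p" "v \<in> live c"
    "out u \<noteq> f" "out v \<noteq> f" "out u \<noteq> out v" "out u \<noteq> c" "out v \<noteq> p"
proof -
  have pL: "p \<in> L" using goodL[OF p] .
  obtain x where x: "x \<in> live p" "out x = c" "exit x" "x \<noteq> s" "x \<noteq> t"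
    using obtain_edge[OF pL c(1), of s t] pc by (metis minus_minus)
  note cx = exit_cross[OF x(3)]
  have zc: "cross x \<in> live c" using cx(3) x(2) by simp
  have sub: "live p \<subseteq> copy p" "live c \<subseteq> copy c" unfolding live_def by blast+
  have disj: "live p \<inter> live c = {}" using live_disjoint[OF pL c(1) pc(1)] .
  have xc: "x \<in> copy p" "cross x \<in> copy c" using x(1) zc sub by blast+
  obtain S1 S2 u1 u2 where S: "S1 \<union> S2 = live p - {x}" "S1 \<inter> S2 = {}" "hpath inner S1 s u1"
    "hpath inner S2 u2 t" "inner u1 x" "inner x u2"
    using hpath_remove_inner[OF good_hpath(1)[OF p st] x(1,4,5)] by blast
  have u1x: "inner x u1" using S(5) symp_inner by (rule sympD[rotated])
  have u: "u1 \<in> S1" "u2 \<in> S2" using hpath_ends[OF S(3)] hpath_ends[OF S(4)] by simp_all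
  have ul: "u1 \<in> live p" "u2 \<in> live p" using u S(1) by blast+
  have "u1 \<noteq> u2" using u S(2) by blast
  then have ou: "out u1 \<noteq> out u2"
    using inner_two(1)[OF pL xc(1)] u1x S(6) unfolding inner_def by blast
  have uc: "out u1 \<noteq> c" "out u2 \<noteq> c"
    using inner_facts(2)[OF pL xc(1) u1x] inner_facts(2)[OF pL xc(1) S(6)] x(2) by simp_all
  obtain v1 v2 where v: "v1 \<noteq> v2" "inner (cross x) v1" "inner (cross x) v2"
    "hpath inner (live c) (cross x) v1" "hpath inner (live c) (cross x) v2"
    using hcycle_from[OF symp_inner c(2) zc] by blast
  have "out v1 \<noteq> out v2"
    using inner_two(1)[OF c(1) xc(2)] v(1-3) unfolding inner_def by blast
  then obtain v where v': "inner (cross x) v" "hpath inner (live c) (cross x) v" "out v \<noteq> f"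
    using v by metis
  have vl: "v \<in> live c" using hpath_ends[OF v'(2)] by simp
  have ox: "out (cross x) = p" using cross_facts(5)[OF pL xc(1)] .
  have vp: "out v \<noteq> p" using inner_facts(2)[OF c(1) xc(2) v'(1)] ox by simp
  have across: "out w \<noteq> out v" if "inner x w" for w
    using inner_across[OF pL xc(1)] that v'(1) unfolding inner_def by blast
  have hv: "hpath step (live c) v (cross x)"
    using inner_hpath[OF c(1) sub(2) v'(2)] by (rule hpath_rev[OF symp_step])
  have sS: "S1 \<subseteq> copy p" "S2 \<subseteq> copy p" using S(1) sub by blast+
  note h1 = inner_hpath[OF pL sS(1) S(3)] and h2 = inner_hpath[OF pL sS(2) S(4)]
  have xS: "x \<notin> S1" "x \<notin> S2" using S(1) by blast+
  have st2: "step x u2" "step x u1" using inner_step copyD(1)[OF pL xc(1)] S(6) u1x by blast+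
  consider "out u1 \<noteq> f" | "out u2 \<noteq> f" using ou by metis
  then show thesis
  proof cases
    case 1
    have "hpath step (insert x S2) x t" using hpath_Cons[of step, OF st2(1) h2 xS(2)] .
    then have "hpath step (live c \<union> insert x S2) v t"
      by (rule hpath_join[OF hv cx(2)]) (use S(1) x(1) disj in blast)
    moreover have "S1 \<union> (live c \<union> insert x S2) = live p \<union> live c" using S(1) x(1) by blast
    moreover have "S1 \<inter> (live c \<union> insert x S2) = {}" using S(1,2) xS disj by blast
    ultimately show ?thesis
      using that[of s t S1 "live c \<union> insert x S2" u1 v] h1 ul vl 1 v'(3) across[OF u1x] uc vp by blast
  next
    case 2
    have "hpath step (insert x S1) x s"
      using hpath_Cons[of step, OF st2(2) hpath_rev[OF symp_step h1] xS(1)] .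
    then have "hpath step (live c \<union> insert x S1) v s"
      by (rule hpath_join[OF hv cx(2)]) (use S(1) x(1) disj in blast)
    moreover have "S2 \<union> (live c \<union> insert x S1) = live p \<union> live c" using S(1) x(1) by blast
    moreover have "S2 \<inter> (live c \<union> insert x S1) = {}" using S(1,2) xS disj by blast
    ultimately show ?thesis
      using that[of t s S2 "live c \<union> insert x S1" u2 v] hpath_rev[OF symp_step h2] ul vl 2 v'(3)
        across[OF S(6)] uc vp by blast
  qed
qed

lemma bridge_path:
  assumes p: "good p" and c: "c \<in> L" "hcycle inner (live c)" and pc: "p \<noteq> c" "p \<noteq> - c"
    and st: "s \<in> live p" "t \<in> live p" "s \<noteq> t"
    and disj: "R \<inter> live p = {}" "R \<inter> live c = {}"
    and ex: "\<And>x. x \<in> live p \<Longrightarrow> out x \<noteq> c \<Longrightarrow> exit x" "\<And>x. x \<in> live c \<Longrightarrow> exit x"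
    and R: "\<And>u v. u \<in> live p \<Longrightarrow> v \<in> live c \<Longrightarrow> exit u \<Longrightarrow> exit v \<Longrightarrow> out u \<noteq> f \<Longrightarrow> out v \<noteq> f
      \<Longrightarrow> out u \<noteq> out v \<Longrightarrow> out u \<noteq> c \<Longrightarrow> out v \<noteq> p \<Longrightarrow> hpath step R (cross u) (cross v)"
  shows "hpath step (live p \<union> live c \<union> R) s t"
proof -
  obtain S1 S2 s' t' u v where b: "s' = s \<and> t' = t \<or> s' = t \<and> t' = s" "S1 \<union> S2 = live p \<union> live c"
    "S1 \<inter> S2 = {}" "hpath step S1 s' u" "hpath step S2 v t'" "u \<in> live p" "v \<in> live c"
    "out u \<noteq> f" "out v \<noteq> f" "out u \<noteq> out v" "out u \<noteq> c" "out v \<noteq> p"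
    using bridge[OF p c pc st] .
  note e = ex(1)[OF b(6,11)] ex(2)[OF b(7)]
  have h: "hpath step (S1 \<union> S2 \<union> R) s' t'"
    by (rule path_detour[OF b(4,5) e R[OF b(6,7) e b(8-12)] b(3)]) (use b(2) disj in blast)+
  from b(1) show ?thesis
  proof
    assume "s' = s \<and> t' = t"
    then show ?thesis using h b(2) by simp
  next
    assume "s' = t \<and> t' = s"
    then show ?thesis using hpath_rev[OF symp_step h] b(2) by simp
  qed
qed

lemma regionE:
  assumes "x \<in> region G"
  obtains g where "g \<in> G" "x \<in> live g"
  using assms unfolding region_def by blast

lemma region_remove: "c \<in> G \<Longrightarrow> region G = live c \<union> region (G - {c})"
  by (auto simp: region_def)

lemma cross_in_region: "exit x \<Longrightarrow> out x \<in> G \<Longrightarrow> cross x \<in> region G"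
  using exit_cross(3) unfolding region_def by blast

lemma cross_eq_iff: "exit x \<Longrightarrow> exit y \<Longrightarrow> cross x = cross y \<longleftrightarrow> x = y"
  using exit_cross(5) by metis

text \<open>
  One copy \<open>c\<close> is only Hamiltonian. An end in \<open>c\<close> starts along its cycle; if both ends are elsewhere, the cut cycle is
  inserted as a segment. If the ends share a copy \<open>p\<close>, this copy has to be cut as well: \<open>c\<close> is
  bridged to \<open>p\<close> if the two are joined, and otherwise no path out of \<open>p\<close> interferes with \<open>c\<close>.\<close>

lemma lone_connected:
  assumes c: "c \<in> L" "load c = faults" "load c + 2 \<le> m" and G: "\<forall>g \<in> L - {c}. good g"
    and st: "s \<in> region L" "t \<in> region L" "s \<noteq> t"
  shows "hpath step (region L) s t"
proof -
  let ?G = "L - {c}"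
  have c1: "card (L - ?G) \<le> 2" using c(1) by (simp add: Diff_Diff_Int)
  have reg: "region L = live c \<union> region ?G" using region_remove[OF c(1)] .
  have disj: "live c \<inter> region ?G = {}" using live_region_disjoint[OF c(1), of ?G] by blast
  have ex: "exit x" "out x \<in> ?G" if "x \<in> live c" for x
  proof -
    show "exit x" using concentrated_exit_in[OF c(2,1) that] .
    then show "out x \<in> ?G" using exit_out[OF _ that c(1)] exit_cross(4) by blast
  qed
  have cyc: "hcycle inner (live c)" using live_cycle c by blast
  have sub: "live c \<subseteq> copy c" unfolding live_def by blast
  have one: "hpath step (region L) s t" if s: "s \<in> live c" and t: "t \<in> region ?G" for s t
  proof -
    obtain x y where x: "x \<noteq> y" "hpath inner (live c) s x" "hpath inner (live c) s y"
      using hcycle_from[OF symp_inner cyc s] by blast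
    have xl: "x \<in> live c" "y \<in> live c" using hpath_ends[OF x(2)] hpath_ends[OF x(3)] by simp_all
    have "cross x \<noteq> cross y" using cross_eq_iff ex(1) xl x(1) by blast
    then obtain w where w: "hpath inner (live c) s w" "w \<in> live c" "cross w \<noteq> t"
      using x xl by metis
    have "hpath step (region ?G) (cross w) t"
      using region_connected[OF G c1 _ t w(3)] cross_in_region ex w(2) by blast
    then show ?thesis
      using path_via[OF inner_hpath[OF c(1) sub w(1)] ex(1)[OF w(2)] _ disj] reg by simp
  qed
  obtain p p' where p: "p \<in> L" "s \<in> live p" "p' \<in> L" "t \<in> live p'"
    using st by (auto elim!: regionE)
  consider "s \<in> live c" "t \<in> live c" | "s \<in> live c" "t \<in> region ?G" | "t \<in> live c" "s \<in> region ?G"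
    | "p \<noteq> c" "p' \<noteq> c" using st reg p by blast
  then show ?thesis
  proof cases
    case 1
    obtain S1 S2 x y where S: "S1 \<union> S2 = live c" "S1 \<inter> S2 = {}" "hpath inner S1 s x" "hpath inner S2 y t"
      using hcycle_split[OF symp_inner cyc 1 st(3)] by blast
    have xy: "x \<in> S1" "y \<in> S2" using hpath_ends[OF S(3)] hpath_ends[OF S(4)] by simp_all
    have xl: "x \<in> live c" "y \<in> live c" "x \<noteq> y" using xy S(1,2) by blast+
    have "cross x \<noteq> cross y" using cross_eq_iff ex(1) xl by blast
    then have R: "hpath step (region ?G) (cross x) (cross y)"
      using region_connected[OF G c1] cross_in_region ex xl by blast
    have sS: "S1 \<subseteq> copy c" "S2 \<subseteq> copy c" using S(1) sub by blast+
    have "hpath step (S1 \<union> S2 \<union> region ?G) s t"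
      by (rule path_detour[OF inner_hpath[OF c(1) sS(1) S(3)] inner_hpath[OF c(1) sS(2) S(4)]
            ex(1)[OF xl(1)] ex(1)[OF xl(2)] R S(2)]) (use S(1) disj in blast)+
    then show ?thesis using S(1) reg by simp
  next
    case 2
    then show ?thesis by (rule one)
  next
    case 3
    then show ?thesis using one hpath_rev[OF symp_step] by blast
  next
    case 4
    have m1: "2 \<le> m - 1" using m3 by simp
    show ?thesis
    proof (cases "p = p'")
      case False
      have "card {p, p'} \<le> m - 1" using m1 by (simp add: card_insert_if)
      then obtain x y where xy: "seg (live c) x y" "x \<in> live c" "y \<in> live c" "out x \<noteq> out y"
        "out x \<notin> {p, p'}" "out y \<notin> {p, p'}"
        using break_cycle_few[OF c(1,3), of "{p, p'}"] by blast
      have "hpath step (region ?G \<union> live c) s t"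
        by (rule seg_path[OF G xy(1) disj xy(4) _ _ _ _ False p(2,4)]) (use xy ex 4 p in auto)
      then show ?thesis using reg by (simp add: Un_commute)
    next
      case True
      have gp: "good p" using G p(1) 4 by blast
      let ?H = "L - {c} - {p}"
      have H: "\<forall>g \<in> ?H. good g" using G by blast
      have regH: "region ?G = live p \<union> region ?H" using region_remove[of p ?G] p(1) 4 by blast
      have dH: "region ?H \<inter> live p = {}" "region ?H \<inter> live c = {}"
        using live_region_disjoint[OF p(1), of ?H] live_region_disjoint[OF c(1), of ?H] by blast+
      have "card ?H = card L - 2" using c(1) p(1) 4 finite_L by simp
      then have c5: "5 \<le> card ?H" using card_L m3 by simp
      show ?thesis
      proof (cases "p = - c")
        case False
        have "hpath step (live p \<union> live c \<union> region ?H) s t"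
        proof (rule bridge_path[OF gp c(1) cyc 4(1) False p(2) _ st(3) dH])
          show "exit x" if "x \<in> live p" "out x \<noteq> c" for x
            using concentrated_exit[OF c(2,1) p(1) that] .
          fix u v assume uv: "u \<in> live p" "v \<in> live c" "exit u" "exit v" "out u \<noteq> out v" "out u \<noteq> c" "out v \<noteq> p"
          have "out u \<in> ?H" "out v \<in> ?H"
            using uv exit_out[OF uv(3,1) p(1)] exit_out[OF uv(4,2) c(1)] exit_cross(4) by blast+
          then show "hpath step (region ?H) (cross u) (cross v)"
            using region_path[OF H c5] uv(3-5) exit_cross(3) by blast
        qed (use p True ex in auto)
        then show ?thesis using reg regH by (simp add: Un_ac)
      next
        case pc: True
        have "t \<in> live p" "card ({} :: int set) \<le> m - 1" using p(4) True by simp_all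
        from break_path_few[OF gp p(2) this(1) st(3) finite.emptyI this(2)]
        obtain S1 S2 x y where b: "S1 \<union> S2 = live p" "S1 \<inter> S2 = {}" "hpath step S1 s x"
          "hpath step S2 y t" "x \<in> live p" "y \<in> live p" "exit x" "exit y" "out x \<noteq> out y" .
        have o: "out x \<in> ?H" "out y \<in> ?H"
          using exit_out[OF b(7,5) p(1)] exit_out[OF b(8,6) p(1)] exit_cross(4)[OF b(7)]
            exit_cross(4)[OF b(8)] pc by auto
        have "card {out x, out y} \<le> m - 1" using m1 by (simp add: card_insert_if)
        then obtain u v where uv: "seg (live c) u v" "u \<in> live c" "v \<in> live c" "out u \<noteq> out v"
          "out u \<notin> {out x, out y}" "out v \<notin> {out x, out y}"
          using break_cycle_few[OF c(1,3), of "{out x, out y}"] by blast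
        have uH: "out u \<in> ?H" "out v \<in> ?H"
          using ex[OF uv(2)] ex[OF uv(3)] exit_out[OF _ uv(2) c(1)] exit_out[OF _ uv(3) c(1)] pc by auto
        have "hpath step (region ?H \<union> live c) (cross x) (cross y)"
          by (rule seg_path[OF H uv(1) _ uv(4) _ _ o b(9) exit_cross(3)[OF b(7)] exit_cross(3)[OF b(8)]])
            (use uv uH dH in auto)
        then have "hpath step (S1 \<union> S2 \<union> (region ?H \<union> live c)) s t"
          by (rule path_detour[OF b(3,4,7,8) _ b(2)])
            (use b(1) dH live_disjoint[OF p(1) c(1) 4(1)] in blast)+
        then show ?thesis using reg regH b(1) by (simp add: Un_ac)
      qed
    qed
  qed
qed

text \<open>
  Two copies can both lose Hamiltonian connectedness only if every fault is a pair that joins them.\<close>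

definition "twin c c' \<longleftrightarrow> all_cross \<and> c \<in> L \<and> c' \<in> L \<and> c \<noteq> c' \<and> c \<noteq> - c'
  \<and> load c = faults \<and> load c' = faults \<and> 1 \<le> faults \<and> faults + 2 \<le> m
  \<and> (\<forall>i \<in> L - {c, c'}. good i)
  \<and> (\<forall>w. w \<in> copy c \<longrightarrow> w \<in> W \<longrightarrow> out w = c') \<and> (\<forall>w. w \<in> copy c' \<longrightarrow> w \<in> W \<longrightarrow> out w = c)"

lemma twin_sym: "twin c c' \<Longrightarrow> twin c' c"
  unfolding twin_def by (auto simp: insert_commute)

lemma twinD:
  assumes "twin c c'"
  shows "all_cross" "c \<in> L" "c' \<in> L" "c \<noteq> c'" "c \<noteq> - c'" "load c = faults" "load c' = faults"
    "1 \<le> faults" "faults + 2 \<le> m" "\<forall>i \<in> L - {c, c'}. good i"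
    "\<And>w. w \<in> copy c \<Longrightarrow> w \<in> W \<Longrightarrow> out w = c'" "\<And>w. w \<in> copy c' \<Longrightarrow> w \<in> W \<Longrightarrow> out w = c"
  using assms unfolding twin_def by blast+

lemma twin_seg:
  assumes "twin c c'" "finite X" "card X \<le> 4" "c \<in> X"
  obtains x y where "seg (live c') x y" "x \<in> live c'" "y \<in> live c'" "out x \<noteq> out y" "out x \<notin> X" "out y \<notin> X"
    "out x \<in> L - {c, c'}" "out y \<in> L - {c, c'}"
proof -
  note t = twinD[OF assms(1)]
  have "1 \<le> load c'" "load c' + 2 \<le> m" using t(7-9) by simp_all
  then obtain x y where xy: "seg (live c') x y" "x \<in> live c'" "y \<in> live c'" "out x \<noteq> out y" "out x \<notin> X" "out y \<notin> X"
    using all_cross_seg[OF t(1,3) _ _ assms(2,3)] t(12) assms(4) by metis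
  have "out x \<in> L - {c, c'}" "out y \<in> L - {c, c'}"
    using xy(5,6) assms(4) exit_out[OF segD(2)[OF xy(1)] xy(2) t(3)] exit_out[OF segD(3)[OF xy(1)] xy(3) t(3)]
      exit_cross(4)[OF segD(2)[OF xy(1)]] exit_cross(4)[OF segD(3)[OF xy(1)]] by auto
  with xy that show thesis by blast
qed

lemma card_four: "card {a, b, c, d} \<le> 4" "card {a, b, c} \<le> 4" "card {a, b} \<le> 2"
  by (simp_all add: card_insert_if)

lemma card_minus_two: "card (L - (L - {a, b})) \<le> 2"
proof -
  have "L - (L - {a, b}) \<subseteq> {a, b}" by blast
  then have "card (L - (L - {a, b})) \<le> card {a, b}" by (intro card_mono) auto
  then show ?thesis using card_four(3)[of a b] by linarith
qed

text \<open>
  The copy \<open>c\<close> is left out; it has been traversed before or will be traversed later.\<close>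

lemma twin_path:
  assumes "twin c c'" and st: "s \<in> region (L - {c, c'})" "t \<in> region (L - {c, c'})" "s \<noteq> t"
  shows "hpath step (region (L - {c})) s t"
proof -
  note tw = twinD[OF assms(1)]
  let ?G = "L - {c, c'}"
  have reg: "region (L - {c}) = live c' \<union> region ?G"
    using region_remove[of c' "L - {c}"] tw(3,4) by (simp add: Diff_insert2[symmetric] insert_commute)
  have disj: "live c' \<inter> region ?G = {}" using live_region_disjoint[OF tw(3), of ?G] by blast
  obtain p p' where p: "p \<in> ?G" "s \<in> live p" "p' \<in> ?G" "t \<in> live p'"
    using st by (auto elim!: regionE)
  show ?thesis
  proof (cases "p = p'")
    case False
    obtain x y where xy: "seg (live c') x y" "out x \<noteq> out y" "out x \<notin> {p, p', c}" "out y \<notin> {p, p', c}"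
      "out x \<in> ?G" "out y \<in> ?G"
      using twin_seg[OF assms(1) _ card_four(2), of p p' c] by blast
    have "hpath step (region ?G \<union> live c') s t"
      by (rule seg_path[OF tw(10) xy(1) disj xy(2) _ _ p(1,3) False p(2,4)]) (use xy in auto)
    then show ?thesis using reg by (simp add: Un_commute)
  next
    case True
    have gp: "good p" using tw(10) p(1) by blast
    have pL: "p \<in> L" using p(1) by blast
    have "t \<in> live p" "finite {c, c'}" "card {c, c'} \<le> m - 1"
      using p(4) True card_four(3)[of c c'] m3 by (simp, simp, linarith)
    from break_path_few[OF gp p(2) this(1) st(3) this(2,3)] obtain S1 S2 x y where b: "S1 \<union> S2 = live p" "S1 \<inter> S2 = {}" "hpath step S1 s x"
      "hpath step S2 y t" "x \<in> live p" "y \<in> live p" "exit x" "exit y" "out x \<noteq> out y"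
      "out x \<notin> {c, c'}" "out y \<notin> {c, c'}" .
    let ?H = "?G - {p}"
    have H: "\<forall>g \<in> ?H. good g" using tw(10) by blast
    have o: "out x \<in> ?H" "out y \<in> ?H"
      using exit_out[OF b(7,5) pL] exit_out[OF b(8,6) pL] exit_cross(4)[OF b(7)]
        exit_cross(4)[OF b(8)] b(10,11) by auto
    obtain u v where uv: "seg (live c') u v" "out u \<noteq> out v" "out u \<notin> {out x, out y, c, p}"
      "out v \<notin> {out x, out y, c, p}" "out u \<in> ?G" "out v \<in> ?G"
      using twin_seg[OF assms(1) _ card_four(1), of "out x" "out y" c p] by blast
    have dH: "live c' \<inter> region ?H = {}" "live p \<inter> region ?H = {}" "live p \<inter> live c' = {}"
      using live_region_disjoint[OF tw(3), of ?H] live_region_disjoint[OF pL, of ?H]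
        live_disjoint[OF pL tw(3)] p(1) by auto
    have "hpath step (region ?H \<union> live c') (cross x) (cross y)"
      by (rule seg_path[OF H uv(1) dH(1) uv(2) _ _ o b(9) exit_cross(3)[OF b(7)] exit_cross(3)[OF b(8)]])
        (use uv in auto)
    then have "hpath step (S1 \<union> S2 \<union> (region ?H \<union> live c')) s t"
      by (rule path_detour[OF b(3,4,7,8) _ b(2)]) (use b(1) dH in blast)+
    moreover have "region ?G = live p \<union> region ?H" using region_remove[OF p(1)] .
    ultimately show ?thesis using reg b(1) by (simp add: Un_ac)
  qed
qed

lemma twin_fault:
  assumes "twin c c'"
  obtains w where "w \<in> copy c" "out w = c'" "touching c \<noteq> {}" "{w, cross w} \<in> touching c"
    "{w, cross w} \<inter> copy c = {w}" "w \<notin> live c"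
proof -
  note tw = twinD[OF assms]
  have "card (touching c) \<noteq> 0" using tw(1,6,8) unfolding load_def edges_in_def all_cross_def by simp
  then obtain e where e: "e \<in> touching c" by (metis card.empty ex_in_conv)
  then obtain w where w: "w \<in> e" "w \<in> copy c" "e \<in> M" unfolding touching_def by blast
  then have wW: "w \<in> W" unfolding W_def by blast
  have ow: "out w = c'" using tw(11)[OF w(2) wW] .
  note cf = cross_facts[OF tw(2) w(2)]
  obtain j v where v: "j \<in> L" "v \<in> copy j" "e = {v, cross v}"
    using w(3) tw(1) unfolding all_cross_def by blast
  have ee: "e = {w, cross w}"
  proof (cases "w = v")
    case True
    then show ?thesis using v by simp
  next
    case False
    then have "w = cross v" using w(1) v(3) by simp
    then show ?thesis using v cross_facts(6)[OF v(1,2)] by auto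
  qed
  have "cross w \<notin> copy c" using cf(4) ow copy_disjoint[OF tw(2,3,4)] by auto
  then have "e \<inter> copy c = {w}" using ee w(2) by auto
  moreover have "w \<notin> live c" using wW unfolding live_def by blast
  ultimately show thesis using that[of w] w ow e ee by auto
qed

text \<open>
  With one of its deleted vertices \<open>w\<close> put back, a twin is Hamiltonian connected. A path through \<open>w\<close> falls apart at
  neighbours of \<open>w\<close>, and these do not lead to the other twin because \<open>w\<close> does.\<close>

lemma twin_relaxed:
  assumes "twin c c'"
  obtains w where "w \<in> copy c" "out w = c'" "w \<notin> live c"
    "\<And>x y. x \<in> insert w (live c) \<Longrightarrow> y \<in> insert w (live c) \<Longrightarrow> x \<noteq> y \<Longrightarrow> hpath inner (insert w (live c)) x y"
proof -
  note tw = twinD[OF assms]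
  obtain w where w: "w \<in> copy c" "out w = c'" "{w, cross w} \<in> touching c"
    "{w, cross w} \<inter> copy c = {w}" "w \<notin> live c"
    using twin_fault[OF assms] by blast
  have "load c + 2 \<le> m" using tw(6,9) by simp
  from withdraw(2)[OF tw(2) w(3) this, unfolded w(4)]
  have "hpath inner (insert w (live c)) x y"
    if "x \<in> insert w (live c)" "y \<in> insert w (live c)" "x \<noteq> y" for x y
    using that by simp
  with w that show thesis by blast
qed

lemma twin_from:
  assumes "twin c c'" "s \<in> live c"
  obtains x where "hpath step (live c) s x" "x \<in> live c" "exit x" "out x \<in> L - {c, c'}"
proof -
  note tw = twinD[OF assms(1)]
  obtain w where w: "w \<in> copy c" "out w = c'" "w \<notin> live c"
    "\<And>x y. x \<in> insert w (live c) \<Longrightarrow> y \<in> insert w (live c) \<Longrightarrow> x \<noteq> y \<Longrightarrow> hpath inner (insert w (live c)) x y"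
    using twin_relaxed[OF assms(1)] by blast
  have "w \<noteq> s" using w(3) assms(2) by blast
  then have "hpath inner (insert w (live c)) w s" using w(4) assms(2) by simp
  then obtain x where x: "inner w x" "hpath inner (insert w (live c) - {w}) x s"
    using \<open>w \<noteq> s\<close> by (rule hpath_uncons)
  have e: "insert w (live c) - {w} = live c" using w(3) by blast
  have xl: "x \<in> live c" using hpath_ends[OF x(2)] e by simp
  have sub: "live c \<subseteq> copy c" unfolding live_def by blast
  have h: "hpath step (live c) s x"
    using inner_hpath[OF tw(2) sub x(2)[unfolded e]] by (rule hpath_rev[OF symp_step])
  have ex: "exit x" using all_cross_exit[OF tw(1,2) xl] .
  have "out x \<noteq> c'" using inner_facts(2)[OF tw(2) w(1) x(1)] w(2) by simp
  then have "out x \<in> L - {c, c'}" using exit_out[OF ex xl tw(2)] exit_cross(4)[OF ex] by blast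
  with h xl ex that show thesis by blast
qed

text \<open>
  Both ends lie in the copy \<open>p\<close>: one twin is bridged to \<open>p\<close>, the other is inserted as a segment.\<close>

lemma twin_same_copy:
  assumes "twin c c'" and p: "p \<in> L - {c, c'}" "p \<noteq> - c" and st: "s \<in> live p" "t \<in> live p" "s \<noteq> t"
  shows "hpath step (region L) s t"
proof -
  note tw = twinD[OF assms(1)]
  let ?G = "L - {c, c'}" and ?H = "L - {c, c'} - {p}"
  have pL: "p \<in> L" "good p" "p \<noteq> c" "p \<noteq> c'" using p tw(10) by blast+
  have H: "\<forall>g \<in> ?H. good g" using tw(10) by blast
  have dH: "live c' \<inter> region ?H = {}" "live p \<inter> region ?H = {}" "live c \<inter> region ?H = {}"
    using live_region_disjoint[OF tw(3), of ?H] live_region_disjoint[OF pL(1), of ?H]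
      live_region_disjoint[OF tw(2), of ?H] by auto
  have d: "live p \<inter> live c' = {}" "live c \<inter> live c' = {}"
    using live_disjoint[OF pL(1) tw(3) pL(4)] live_disjoint[OF tw(2,3,4)] .
  have ex: "exit x" if "x \<in> live i" "i \<in> L" for x i using all_cross_exit[OF tw(1) that(2,1)] .
  have "hpath step (live p \<union> live c \<union> (region ?H \<union> live c')) s t"
  proof (rule bridge_path[where f = c', OF pL(2) tw(2) _ pL(3) p(2) st])
    show "hcycle inner (live c)" using live_cycle[OF tw(2)] tw(6,9) by simp
    show "(region ?H \<union> live c') \<inter> live p = {}" "(region ?H \<union> live c') \<inter> live c = {}"
      using dH d by blast+
    fix u v assume uv: "u \<in> live p" "v \<in> live c" "exit u" "exit v" "out u \<noteq> c'" "out v \<noteq> c'"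
      "out u \<noteq> out v" "out u \<noteq> c" "out v \<noteq> p"
    have o: "out u \<in> ?H" "out v \<in> ?H"
      using uv exit_out[OF uv(3,1) pL(1)] exit_out[OF uv(4,2) tw(2)] exit_cross(4) by blast+
    obtain x y where xy: "seg (live c') x y" "out x \<noteq> out y" "out x \<notin> {out u, out v, c, p}"
      "out y \<notin> {out u, out v, c, p}" "out x \<in> ?G" "out y \<in> ?G"
      using twin_seg[OF assms(1) _ card_four(1), of "out u" "out v" c p] by blast
    show "hpath step (region ?H \<union> live c') (cross u) (cross v)"
      by (rule seg_path[OF H xy(1) dH(1) xy(2) _ _ o uv(7) exit_cross(3)[OF uv(3)] exit_cross(3)[OF uv(4)]])
        (use xy in auto)
  qed (use ex pL tw in auto)
  moreover have "live p \<union> live c \<union> (region ?H \<union> live c') = region L"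
  proof -
    have "L = {p, c, c'} \<union> ?H" using pL(1) tw(2,3) by blast
    then have "region L = region {p, c, c'} \<union> region ?H" using region_Un by metis
    then show ?thesis by (simp add: region_def Un_ac)
  qed
  ultimately show ?thesis by simp
qed

lemma twin_connected:
  assumes tw0: "twin c c'" and st: "s \<in> region L" "t \<in> region L" "s \<noteq> t"
  shows "hpath step (region L) s t"
proof -
  let ?G = "L - {c, c'}"
  have reg: "region L = live a \<union> live b \<union> region (L - {a, b})" if "twin a b" for a b
  proof -
    have "L = {a, b} \<union> (L - {a, b})" using twinD(2,3)[OF that] by blast
    then have "region L = region {a, b} \<union> region (L - {a, b})" using region_Un by metis
    then show ?thesis by (simp add: region_def)
  qed
  have reg1: "region L = live a \<union> region (L - {a})" if "twin a b" for a b
    using region_remove[OF twinD(2)[OF that]] .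
  have cG: "card (L - (L - {a, b})) \<le> 2" for a b using card_minus_two .
  \<comment> \<open>One end in a damaged copy, the other in a sound one.\<close>
  have one: "hpath step (region L) s t"
    if tw: "twin a b" and s: "s \<in> live a" and t: "t \<in> region (L - {a, b})" for a b s t
  proof -
    note T = twinD[OF tw]
    have sub: "live a \<subseteq> copy a" unfolding live_def by blast
    have ex: "exit x" if "x \<in> live a" for x using all_cross_exit[OF T(1,2) that] .
    have cyc: "hcycle inner (live a)" using live_cycle[OF T(2)] T(6,9) by simp
    obtain x y where x: "x \<noteq> y" "inner s x" "inner s y" "hpath inner (live a) s x" "hpath inner (live a) s y"
      using hcycle_from[OF symp_inner cyc s] by blast
    have xl: "x \<in> live a" "y \<in> live a" using hpath_ends[OF x(4)] hpath_ends[OF x(5)] by simp_all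
    have oxy: "out x \<noteq> out y"
      using inner_two(1)[OF T(2), of s] s sub x(1-3) unfolding inner_def by blast
    have cxy: "cross x \<noteq> cross y" using cross_eq_iff ex xl x(1) by blast
    have da: "live a \<inter> region (L - {a}) = {}" using live_region_disjoint[OF T(2), of "L - {a}"] by blast
    have go: "hpath step (region L) s t"
      if u: "u \<in> live a" "hpath inner (live a) s u" "out u \<noteq> b" "cross u \<noteq> t" for u
    proof -
      have "out u \<in> L - {a, b}" using exit_out[OF ex u(1) T(2)] exit_cross(4)[OF ex] u(1,3) by blast
      then have "hpath step (region (L - {a})) (cross u) t"
        by (intro twin_path[OF tw cross_in_region[OF ex[OF u(1)]] t u(4)])
      then show ?thesis
        using path_via[OF inner_hpath[OF T(2) sub u(2)] ex[OF u(1)] _ da] reg1[OF tw] by simp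
    qed
    have through: "hpath step (region L) s t"
      if u: "u \<in> live a" "hpath inner (live a) s u" "out u = b" and v: "v \<in> live a" "cross v = t" for u v
    proof -
      have "cross u \<in> live b" using exit_cross(3)[OF ex[OF u(1)]] u(3) by simp
      then obtain z where z: "hpath step (live b) (cross u) z" "z \<in> live b" "exit z" "out z \<in> L - {b, a}"
        using twin_from[OF twin_sym[OF tw]] by blast
      have dab: "live a \<inter> live b = {}" using live_disjoint[OF T(2-4)] .
      have "cross z \<noteq> t"
      proof
        assume "cross z = t"
        then have "z = v" using cross_eq_iff[OF z(3) ex[OF v(1)]] v(2) by simp
        then show False using z(2) v(1) dab by blast
      qed
      moreover have "out z \<in> L - {a, b}" using z(4) by blast
      ultimately have R: "hpath step (region (L - {a, b})) (cross z) t"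
        by (intro region_connected[OF T(10) cG cross_in_region[OF z(3)] t])
      have dd: "live b \<inter> region (L - {a, b}) = {}" "live a \<inter> region (L - {a, b}) = {}"
        using live_region_disjoint[OF T(3), of "L - {a, b}"] live_region_disjoint[OF T(2), of "L - {a, b}"]
        by blast+
      have "hpath step (live b \<union> region (L - {a, b})) (cross u) t"
        by (rule path_via[OF z(1,3) R dd(1)])
      then have "hpath step (live a \<union> (live b \<union> region (L - {a, b}))) s t"
        by (rule path_via[OF inner_hpath[OF T(2) sub u(2)] ex[OF u(1)]]) (use dd dab in blast)
      then show ?thesis using reg[OF tw] by (simp add: Un_ac)
    qed
    consider "out x \<noteq> b" "cross x \<noteq> t" | "out y \<noteq> b" "cross y \<noteq> t"
      | "out x = b" "cross y = t" | "out y = b" "cross x = t" using oxy cxy by metis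
    then show ?thesis
      by cases (use go[OF xl(1) x(4)] go[OF xl(2) x(5)] through[OF xl(1) x(4)] through[OF xl(2) x(5)] xl in blast)+
  qed
  have both: "hpath step (region L) s t" if tw: "twin a b" and s: "s \<in> live a" "t \<in> live a" "s \<noteq> t" for a b s t
  proof -
    note T = twinD[OF tw]
    have ex: "exit x" if "x \<in> live a" for x using all_cross_exit[OF T(1,2) that] .
    obtain w where w: "w \<in> copy a" "out w = b" "w \<notin> live a"
      "\<And>x y. x \<in> insert w (live a) \<Longrightarrow> y \<in> insert w (live a) \<Longrightarrow> x \<noteq> y \<Longrightarrow> hpath inner (insert w (live a)) x y"
      using twin_relaxed[OF tw] by blast
    have "hpath inner (insert w (live a)) s t" using w(4) s by simp
    moreover have "w \<noteq> s" "w \<noteq> t" using w(3) s by blast+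
    ultimately obtain S1 S2 x y where S: "S1 \<union> S2 = insert w (live a) - {w}" "S1 \<inter> S2 = {}"
      "hpath inner S1 s x" "hpath inner S2 y t" "inner x w" "inner w y"
      using hpath_remove_inner[of inner "insert w (live a)" s t w] by blast
    have e: "S1 \<union> S2 = live a" using S(1) w(3) by blast
    have xy: "x \<in> S1" "y \<in> S2" using hpath_ends[OF S(3)] hpath_ends[OF S(4)] by simp_all
    have xl: "x \<in> live a" "y \<in> live a" "x \<noteq> y" using xy e S(2) by blast+
    have wx: "inner w x" using S(5) symp_inner by (rule sympD[rotated])
    have "out x \<noteq> b" "out y \<noteq> b"
      using inner_facts(2)[OF T(2) w(1) wx] inner_facts(2)[OF T(2) w(1) S(6)] w(2) by simp_all
    then have o: "out x \<in> L - {a, b}" "out y \<in> L - {a, b}"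
      using exit_out[OF ex xl(1) T(2)] exit_out[OF ex xl(2) T(2)] exit_cross(4)[OF ex] xl by blast+
    have "cross x \<noteq> cross y" using cross_eq_iff ex xl by blast
    then have R: "hpath step (region (L - {a})) (cross x) (cross y)"
      by (intro twin_path[OF tw cross_in_region[OF ex[OF xl(1)] o(1)] cross_in_region[OF ex[OF xl(2)] o(2)]])
    have sS: "S1 \<subseteq> copy a" "S2 \<subseteq> copy a" using e unfolding live_def by blast+
    have da: "live a \<inter> region (L - {a}) = {}" using live_region_disjoint[OF T(2), of "L - {a}"] by blast
    have "hpath step (S1 \<union> S2 \<union> region (L - {a})) s t"
      by (rule path_detour[OF inner_hpath[OF T(2) sS(1) S(3)] inner_hpath[OF T(2) sS(2) S(4)]
            ex[OF xl(1)] ex[OF xl(2)] R S(2)]) (use e da in blast)+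
    then show ?thesis using e reg1[OF tw] by simp
  qed
  have split: "hpath step (region L) s t" if tw: "twin a b" and s: "s \<in> live a" "t \<in> live b" for a b s t
  proof -
    note T = twinD[OF tw]
    obtain x where x: "hpath step (live a) s x" "x \<in> live a" "exit x" "out x \<in> L - {a, b}"
      using twin_from[OF tw s(1)] .
    obtain y where y: "hpath step (live b) t y" "y \<in> live b" "exit y" "out y \<in> L - {b, a}"
      using twin_from[OF twin_sym[OF tw] s(2)] .
    have dd: "live b \<inter> region (L - {a, b}) = {}" "live a \<inter> region (L - {a, b}) = {}" "live a \<inter> live b = {}"
      using live_region_disjoint[OF T(3), of "L - {a, b}"] live_region_disjoint[OF T(2), of "L - {a, b}"]
        live_disjoint[OF T(2-4)] by blast+
    have "x \<noteq> y" using x(2) y(2) dd(3) by blast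
    then have "cross x \<noteq> cross y" using cross_eq_iff x(3) y(3) by blast
    moreover have "out y \<in> L - {a, b}" using y(4) by blast
    ultimately have R: "hpath step (region (L - {a, b})) (cross x) (cross y)"
      by (intro region_connected[OF T(10) cG cross_in_region[OF x(3,4)] cross_in_region[OF y(3)]])
    have "hpath step (live a \<union> live b \<union> region (L - {a, b})) s t"
      by (rule path_detour[OF x(1) hpath_rev[OF symp_step y(1)] x(3) y(3) R dd(3,2,1)])
    then show ?thesis using reg[OF tw] by simp
  qed
  note tw1 = twin_sym[OF tw0]
  note T = twinD[OF tw0]
  have ins: "L - {c', c} = ?G" by blast
  consider "s \<in> live c" "t \<in> live c" | "s \<in> live c'" "t \<in> live c'" | "s \<in> live c" "t \<in> live c'"
    | "s \<in> live c'" "t \<in> live c" | "s \<in> live c" "t \<in> region ?G" | "s \<in> live c'" "t \<in> region ?G"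
    | "t \<in> live c" "s \<in> region ?G" | "t \<in> live c'" "s \<in> region ?G" | "s \<in> region ?G" "t \<in> region ?G"
    using st(1,2) unfolding reg[OF tw0] by blast
  then show ?thesis
  proof cases
    case 1 then show ?thesis using both[OF tw0] st(3) by blast
  next
    case 2 then show ?thesis using both[OF tw1] st(3) by blast
  next
    case 3 then show ?thesis using split[OF tw0] by blast
  next
    case 4 then show ?thesis using split[OF tw1] by blast
  next
    case 5 then show ?thesis using one[OF tw0] by blast
  next
    case 6 then show ?thesis using one[OF tw1] ins by simp
  next
    case 7 then show ?thesis using one[OF tw0] hpath_rev[OF symp_step] by blast
  next
    case 8 then show ?thesis using one[OF tw1] ins hpath_rev[OF symp_step] by simp
  next
    case 9
    obtain p p' where p: "p \<in> ?G" "s \<in> live p" "p' \<in> ?G" "t \<in> live p'"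
      using 9 by (auto elim!: regionE)
    show ?thesis
    proof (cases "p = p'")
      case True
      show ?thesis
      proof (cases "p = - c")
        case False
        then show ?thesis using twin_same_copy[OF tw0 p(1) _ p(2) _ st(3)] p(4) True by blast
      next
        case pc: True
        then have "p \<noteq> - c'" "p \<in> L - {c', c}" using T(4) p(1) by auto
        then show ?thesis using twin_same_copy[OF tw1 _ _ p(2) _ st(3)] p(4) True by blast
      qed
    next
      case False
      have X1: "finite {p, p', c'}" "card {p, p', c'} \<le> 4" "c' \<in> {p, p', c'}"
        using card_four(2) by simp_all
      obtain x1 y1 where 1: "seg (live c) x1 y1" "out x1 \<noteq> out y1" "out x1 \<notin> {p, p', c'}"
        "out y1 \<notin> {p, p', c'}" "out x1 \<in> ?G" "out y1 \<in> ?G"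
        using twin_seg[OF tw1 X1] unfolding ins by metis
      have X2: "finite {p, p', c, out x1}" "card {p, p', c, out x1} \<le> 4" "c \<in> {p, p', c, out x1}"
        using card_four(1) by simp_all
      obtain x2 y2 where 2: "seg (live c') x2 y2" "out x2 \<noteq> out y2" "out x2 \<notin> {p, p', c, out x1}"
        "out y2 \<notin> {p, p', c, out x1}" "out x2 \<in> ?G" "out y2 \<in> ?G"
        using twin_seg[OF tw0 X2] by metis
      let ?O = "{out x1, out y1, out x2, out y2}"
      have OG: "?O \<subseteq> ?G" "p \<notin> ?O" "p' \<notin> ?O" using 1(3-6) 2(3-6) by auto
      have dd: "live c \<inter> region ?G = {}" "live c' \<inter> region ?G = {}" "live c \<inter> live c' = {}"
        using live_region_disjoint[OF T(2), of ?G] live_region_disjoint[OF T(3), of ?G]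
          live_disjoint[OF T(2-4)] by blast+
      have rG: "region ?G = region ?O \<union> region (?G - ?O)" using OG(1) by (auto simp: region_def)
      have g: "good (out x1)" "good (out y1)" "good (out x2)" "good (out y2)" using T(10) 1 2 by blast+
      have ne: "{out x1, out y1} \<noteq> {out x2, out y2}"
        using 2(3,4) by (simp add: doubleton_eq_iff)
      have OL: "?O \<subseteq> L" "c \<notin> ?O" "c' \<notin> ?O" using OG(1) by auto
      have "live c \<inter> region ?O = {}" "live c' \<inter> region ?O = {}"
        by (rule live_region_disjoint[OF T(2) OL(1,2)], rule live_region_disjoint[OF T(3) OL(1,3)])
      then have "(live c \<union> live c') \<inter> region ?O = {}" by (simp add: Int_Un_distrib2)
      then obtain l q where b: "l \<noteq> q" "block (live c \<union> live c' \<union> region ?O) l q"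
        by (rule two_seg_block[OF 1(1) 2(1) g 1(2) 2(2) ne dd(3)])
      have dO: "region ?O \<inter> region (?G - ?O) = {}" using OG(1) by (intro region_disjoint) auto
      have "hpath step (live c \<union> live c' \<union> region ?O \<union> region (?G - ?O)) s t"
      proof (rule block_path[OF _ b(2,1) _ _ _ False p(2,4)])
        show "(live c \<union> live c' \<union> region ?O) \<inter> region (?G - ?O) = {}" using dd(1,2) rG dO by blast
      qed (use T(10) p OG in auto)
      then show ?thesis using reg[OF tw0] rG by (simp add: Un_ac)
    qed
  qed
qed

text \<open>
  A copy that is not good is touched by all faults. Hence a second such copy forces every fault to join the
  two, and a third one is impossible.\<close>

theorem connected_step:
  assumes f: "faults + 2 \<le> m" and st: "s \<in> region L" "t \<in> region L" "s \<noteq> t"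
  shows "hpath step (region L) s t"
proof (cases "\<forall>i \<in> L. good i")
  case True
  then show ?thesis using region_connected[OF True _ st] by simp
next
  case False
  have bad: "load i = faults \<and> faults + 2 = m" if "i \<in> L" "\<not> good i" for i
    using that load_le_faults[of i] f unfolding good_def by linarith
  obtain c where c: "c \<in> L" "\<not> good c" using False by blast
  show ?thesis
  proof (cases "\<forall>i \<in> L - {c}. good i")
    case True
    then show ?thesis using lone_connected[OF c(1) _ _ True st] bad[OF c] by simp
  next
    case False
    then obtain c' where c': "c' \<in> L" "\<not> good c'" "c' \<noteq> c" by blast
    note b = bad[OF c] bad[OF c'(1,2)]
    have dis: "copy c \<inter> copy c' = {}" using copy_disjoint[OF c(1) c'(1)] c'(3) by blast
    have D0: "D = {}"
    proof (rule ccontr)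
      assume "D \<noteq> {}"
      then obtain d where "d \<in> D" by blast
      then have "d \<subseteq> copy c" "d \<subseteq> copy c'" "d \<noteq> {}" using concentrated_touch(2) b D(2) by blast+
      then show False using dis by blast
    qed
    have pair: "\<exists>v \<in> copy c. e = {v, cross v} \<and> cross v \<in> copy c'" if e: "e \<in> M" for e
    proof -
      obtain x y where x: "x \<in> e" "x \<in> copy c" and y: "y \<in> e" "y \<in> copy c'"
        using concentrated_touch(1)[OF _ e] b by blast
      have "y \<notin> copy c" using y(2) dis by blast
      from M_cross_pair[OF e c(1) x(2,1) y(1) this] x y show ?thesis by blast
    qed
    have ac: "all_cross" unfolding all_cross_def using D0 pair c(1) by blast
    have one: "1 \<le> faults" using b m3 by simp
    then have "M \<noteq> {}" using D0 unfolding faults_def by auto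
    then obtain e v where v: "e \<in> M" "v \<in> copy c" "e = {v, cross v}" "cross v \<in> copy c'"
      using pair by blast
    have "c' = out v" using cross_facts(1,4)[OF c(1) v(2)] v(4) copy_disjoint[OF _ c'(1)] by blast
    then have anti: "c \<noteq> - c'" using cross_facts(3)[OF c(1) v(2)] by auto
    have good: "good i" if i: "i \<in> L - {c, c'}" for i
    proof (rule ccontr)
      assume "\<not> good i"
      then have "e \<inter> copy i \<noteq> {}" using concentrated_touch(1)[OF _ v(1)] bad i by blast
      then show False using v copy_disjoint[OF c(1), of i] copy_disjoint[OF c'(1), of i] i by blast
    qed
    have o1: "out w = c'" if w: "w \<in> copy c" "w \<in> W" for w
    proof -
      obtain e where "e \<in> M" "w \<in> e" using w(2) unfolding W_def by blast
      then obtain x where x: "x \<in> copy c" "w \<in> {x, cross x}" "cross x \<in> copy c'" using pair by blast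
      then have "w = x" using w(1) dis by blast
      then show ?thesis using x(1,3) cross_facts(1,4)[OF c(1) x(1)] copy_disjoint[OF _ c'(1)] by blast
    qed
    have o2: "out w = c" if w: "w \<in> copy c'" "w \<in> W" for w
    proof -
      obtain e where "e \<in> M" "w \<in> e" using w(2) unfolding W_def by blast
      then obtain x where x: "x \<in> copy c" "w \<in> {x, cross x}" using pair by blast
      then have "w = cross x" using w(1) dis by blast
      then show ?thesis using cross_facts(5)[OF c(1) x(1)] by simp
    qed
    have "twin c c'"
      unfolding twin_def using ac c(1) c'(1,3) anti b one good o1 o2 by auto
    then show ?thesis using twin_connected st by blast
  qed
qed

end

section \<open>Hamiltonian cycles when all faults touch one copy\<close>

text \<open>
  At an end of the forbidden edge \<open>d\<close> the cycle uses two edges, and only one of them can be \<open>d\<close>. The path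
  starts there.\<close>

lemma hcycle_avoid_edge:
  assumes "symp r" "symp r'" "hcycle r S" and r': "\<And>x y. r x y \<Longrightarrow> {x, y} \<noteq> d \<Longrightarrow> r' x y"
  obtains x y where "hpath r' S x y" "x \<noteq> y"
proof (cases "S \<inter> d = {}")
  case True
  have "S \<noteq> {}" using assms(3) unfolding hcycle_def by auto
  then obtain s where "s \<in> S" by blast
  then obtain x where x: "hpath r S s x" using hcycle_from[OF assms(1,3)] by blast
  have h: "hpath r' S s x" using x
  proof (rule hpath_mono)
    fix u v assume "u \<in> S" "r u v"
    moreover from this True have "{u, v} \<noteq> d" by blast
    ultimately show "r' u v" using r' by blast
  qed
  have "s \<noteq> x"
  proof
    assume "s = x"
    then have "S = {s}" using hpath_same x by metis
    moreover have "3 \<le> card S" using assms(3) unfolding hcycle_def by (auto simp: distinct_card)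
    ultimately show False by simp
  qed
  with h show ?thesis using that by blast
next
  case False
  then obtain a where a: "a \<in> S" "a \<in> d" by blast
  obtain x y where xy: "x \<noteq> y" "hpath r (S - {a}) x y" "r a x" "r a y"
    using hcycle_remove[OF assms(1,3) a(1)] by blast
  have h: "hpath r' (S - {a}) x y" using xy(2)
  proof (rule hpath_mono)
    fix u v assume "u \<in> S - {a}" "v \<in> S - {a}" "r u v"
    moreover from this a(2) have "{u, v} \<noteq> d" by blast
    ultimately show "r' u v" using r' by blast
  qed
  have ne: "a \<noteq> x" "a \<noteq> y" using hpath_ends[OF h] by auto
  have S: "insert a (S - {a}) = S" using a(1) by blast
  have "{a, x} \<noteq> d \<or> {a, y} \<noteq> d" using xy(1) by (metis doubleton_eq_iff)
  then show ?thesis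
  proof
    assume "{a, x} \<noteq> d"
    then have "hpath r' (insert a (S - {a})) a y" using hpath_Cons[of r' a x] r' xy(3) h by blast
    then show ?thesis using that ne S by simp
  next
    assume "{a, y} \<noteq> d"
    then have "hpath r' (insert a (S - {a})) a x"
      using hpath_Cons[of r' a y] r' xy(4) hpath_rev[OF assms(2) h] by blast
    then show ?thesis using that ne S by simp
  qed
qed

context few_faults
begin

lemma seg_live_outs:
  assumes "seg Q x y" "x \<in> live i" "y \<in> live i" "i \<in> L"
  shows "out x \<in> L - {i}" "out y \<in> L - {i}" "out x \<noteq> - i" "out y \<noteq> - i"
  using exit_out[OF segD(2)[OF assms(1)] assms(2,4)] exit_out[OF segD(3)[OF assms(1)] assms(3,4)]
    exit_cross(4)[OF segD(2)[OF assms(1)]] exit_cross(4)[OF segD(3)[OF assms(1)]] by simp_all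

lemma card_minus_one: "card (L - (L - {a})) \<le> 2"
  using card_minus_two[of a a] by simp

lemma close_lone:
  assumes c: "c \<in> L" and G: "\<forall>g \<in> L - {c}. good g" and s: "seg (live c) x y" "x \<noteq> y"
  shows "hcycle step (region L)"
proof -
  have xy: "x \<in> live c" "y \<in> live c" using segD(4,5)[OF s(1)] .
  note o = seg_live_outs[OF s(1) xy c] and e = segD(2,3)[OF s(1)]
  have "cross x \<noteq> cross y" using cross_eq_iff e s(2) by blast
  then have R: "hpath step (region (L - {c})) (cross x) (cross y)"
    by (intro region_connected[OF G card_minus_one cross_in_region[OF e(1) o(1)] cross_in_region[OF e(2) o(2)]])
  have "live c \<inter> region (L - {c}) = {}" using live_region_disjoint[OF c, of "L - {c}"] by blast
  moreover have "3 \<le> card (region (L - {c}))" using card_region_large[of "L - {c}"] o(1) by blast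
  ultimately have "hcycle step (live c \<union> region (L - {c}))" using seg_close[OF s(1) R] by blast
  then show ?thesis using region_remove[OF c] by simp
qed

lemma close_two:
  assumes c: "c \<in> L" "c' \<in> L" "c \<noteq> c'" and G: "\<forall>g \<in> L - {c, c'}. good g"
    and s1: "seg (live c) x1 y1" "out x1 \<noteq> out y1" "out x1 \<noteq> c'" "out y1 \<noteq> c'"
    and s2: "seg (live c') x2 y2" "out x2 \<noteq> out y2" "out x2 \<noteq> c" "out y2 \<noteq> c"
    and ne: "{out x1, out y1} \<noteq> {out x2, out y2}"
  shows "hcycle step (region L)"
proof -
  let ?G = "L - {c, c'}"
  have o: "out x1 \<in> ?G" "out y1 \<in> ?G" "out x2 \<in> ?G" "out y2 \<in> ?G"
    using seg_live_outs[OF s1(1) segD(4,5)[OF s1(1)] c(1)] s1(3,4)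
      seg_live_outs[OF s2(1) segD(4,5)[OF s2(1)] c(2)] s2(3,4) by auto
  have "card ?G = card L - 2" using c finite_L by simp
  then have c6: "6 \<le> card ?G" using card_L m3 by simp
  have dd: "live c \<inter> region ?G = {}" "live c' \<inter> region ?G = {}" "live c \<inter> live c' = {}"
    using live_region_disjoint[OF c(1), of ?G] live_region_disjoint[OF c(2), of ?G]
      live_disjoint[OF c] by blast+
  have "hcycle step (live c \<union> live c' \<union> region ?G)"
    by (rule two_seg_cycle[OF G c6 s1(1) s2(1) o s1(2) s2(2) ne dd(3)]) (use dd in blast)
  moreover have "live c \<union> live c' \<union> region ?G = region L" using c by (auto simp: region_def)
  ultimately show ?thesis by simp
qed

lemma concentrated_break:
  assumes c: "c \<in> L" "load c = faults" and W: "W \<subseteq> copy c" and i: "good i" "i \<noteq> c"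
    and st: "s \<in> live i" "t \<in> live i" "s \<noteq> t" "out s = c" "out t = c"
    and X: "finite X" "card X \<le> 3" "c \<in> X"
  obtains S1 S2 x y where "S1 \<union> S2 = live i" "S1 \<inter> S2 = {}" "hpath step S1 s x" "hpath step S2 y t"
    "x \<in> live i" "y \<in> live i" "exit x" "exit y" "out x \<noteq> out y" "out x \<notin> X" "out y \<notin> X"
proof (rule break_path[OF goodL[OF i(1)] good_hpath(1)[OF i(1) st(1-3)]])
  have iL: "i \<in> L" using goodL[OF i(1)] .
  have l: "live i = copy i" using W copy_disjoint[OF iL c(1) i(2)] unfolding live_def by blast
  have "{x \<in> live i. out x \<in> X \<or> \<not> free x} = {x \<in> copy i. out x \<in> X}"
    using concentrated_exit[OF c(2,1) iL] X(3) unfolding exit_def l by blast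
  then have "card {x \<in> live i. out x \<in> X \<or> \<not> free x} \<le> card X * K"
    using card_classes[OF iL X(1)] by simp
  also have "\<dots> \<le> m * K" using X(2) m3 by (intro mult_le_mono1) simp
  finally show "2 * card {x \<in> live i. out x \<in> X \<or> \<not> free x} + 1
      < card (live i) + of_bool (out s \<in> X) + of_bool (out t \<in> X)"
    using card_copy[OF iL] st(4,5) X(3) l by simp
qed

text \<open>
  If both ends of a segment lead to the same copy, this copy is absorbed: its path between the two
  entrances closes the segment to a cycle, which is cut again elsewhere in that copy. As both
  entrances lead to the forbidden copy \<open>c\<close>, three forbidden copies can be afforded.\<close>

lemma loop_segment:
  assumes c: "c \<in> L" "load c = faults" "W \<subseteq> copy c" and Q: "seg Q x y" "Q \<subseteq> live c" "x \<noteq> y"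
    and i: "good (out x)" "out y = out x"
    and X: "finite X" "card X \<le> 3" "c \<in> X"
  obtains u v where "seg (live (out x) \<union> Q) u v" "u \<in> live (out x)" "v \<in> live (out x)"
    "out u \<noteq> out v" "out u \<notin> X" "out v \<notin> X"
proof -
  note e = segD[OF Q(1)]
  note cx = exit_cross[OF e(2)] and cy = exit_cross[OF e(3)]
  have xc: "x \<in> live c" "y \<in> live c" using e(4,5) Q(2) by blast+
  have oc: "out x \<noteq> c" using exit_out[OF e(2) xc(1) c(1)] by blast
  have o: "out (cross x) = c" "out (cross y) = c"
    using exit_out[OF e(2) xc(1) c(1)] exit_out[OF e(3) xc(2) c(1)] by blast+
  have cl: "cross x \<in> live (out x)" "cross y \<in> live (out x)" using cx(3) cy(3) i(2) by simp_all
  have ne: "cross x \<noteq> cross y" using cross_eq_iff[OF e(2,3)] Q(3) by simp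
  obtain S1 S2 u v where b: "S1 \<union> S2 = live (out x)" "S1 \<inter> S2 = {}" "hpath step S1 (cross x) u"
    "hpath step S2 v (cross y)" "u \<in> live (out x)" "v \<in> live (out x)" "exit u" "exit v"
    "out u \<noteq> out v" "out u \<notin> X" "out v \<notin> X"
    using concentrated_break[OF c i(1) oc cl ne o X] .
  have d: "live (out x) \<inter> Q = {}" using live_disjoint[OF cx(4) c(1) oc] Q(2) by blast
  have "hpath step (S1 \<union> Q) u y"
    by (rule hpath_join[OF hpath_rev[OF symp_step b(3)] cx(2) e(1)]) (use b(1) d in blast)
  then have "hpath step (S1 \<union> Q \<union> S2) u v"
    by (rule path_via[OF _ e(3) hpath_rev[OF symp_step b(4)]]) (use b(1,2) d in blast)
  moreover have "S1 \<union> Q \<union> S2 = live (out x) \<union> Q" using b(1) by blast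
  ultimately have "seg (live (out x) \<union> Q) u v" unfolding seg_def using b(7,8) by simp
  then show thesis using that b(5,6,9-11) by blast
qed

text \<open>
  The cycle made of a segment and the copy to which both of its ends lead passes every vertex \<open>w\<close> of that copy; its
  two neighbours lead to different copies, at most one of which is \<open>c\<close>.\<close>

lemma loop_arm:
  assumes c: "c \<in> L" and Q: "seg Q x y" "Q \<subseteq> live c" "x \<noteq> y"
    and i: "good (out x)" "out y = out x" and w: "w \<in> live (out x)" "out w \<noteq> c"
  obtains u where "hpath step (live (out x) \<union> Q) w u" "inner w u" "u \<in> live (out x)" "out u \<noteq> c"
proof -
  note e = segD[OF Q(1)]
  note cx = exit_cross[OF e(2)] and cy = exit_cross[OF e(3)]
  let ?i = "out x"
  have iL: "?i \<in> L" using cx(4) .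
  have xc: "x \<in> live c" "y \<in> live c" using e(4,5) Q(2) by blast+
  have oc: "?i \<noteq> c" using exit_out[OF e(2) xc(1) c] by blast
  have o: "out (cross x) = c" "out (cross y) = c"
    using exit_out[OF e(2) xc(1) c] exit_out[OF e(3) xc(2) c] by blast+
  have cl: "cross x \<in> live ?i" "cross y \<in> live ?i" using cx(3) cy(3) i(2) by simp_all
  have ne: "cross x \<noteq> cross y" using cross_eq_iff[OF e(2,3)] Q(3) by simp
  have wn: "w \<noteq> cross x" "w \<noteq> cross y" using w(2) o by auto
  obtain D1 D2 u1 u2 where D: "D1 \<union> D2 = live ?i - {w}" "D1 \<inter> D2 = {}" "hpath inner D1 (cross x) u1"
    "hpath inner D2 u2 (cross y)" "inner u1 w" "inner w u2"
    using hpath_remove_inner[OF good_hpath(1)[OF i(1) cl ne] w(1) wn] by blast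
  have u1w: "inner w u1" using D(5) symp_inner by (rule sympD[rotated])
  have sub: "D1 \<subseteq> copy ?i" "D2 \<subseteq> copy ?i" using D(1) unfolding live_def by blast+
  note h1 = inner_hpath[OF iL sub(1) D(3)] and h2 = inner_hpath[OF iL sub(2) D(4)]
  have wc: "w \<in> copy ?i" using liveD(1)[OF w(1)] .
  have stp: "step w u1" "step w u2" using inner_step copyD(1)[OF iL wc] u1w D(6) by blast+
  have u: "u1 \<in> D1" "u2 \<in> D2" using hpath_ends[OF D(3)] hpath_ends[OF D(4)] by simp_all
  have ul: "u1 \<in> live ?i" "u2 \<in> live ?i" "u1 \<noteq> u2" using u D(1,2) by blast+
  have ou: "out u1 \<noteq> out u2"
    using inner_two(1)[OF iL wc] u1w D(6) ul(3) unfolding inner_def by blast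
  have d: "live ?i \<inter> Q = {}" using live_disjoint[OF iL c oc] Q(2) by blast
  have wD: "w \<notin> D1" "w \<notin> D2" using D(1) by blast+
  \<comment> \<open>Both directions around the loop, from \<open>w\<close> to each of its two neighbours.\<close>
  have 1: "hpath step (live ?i \<union> Q) w u1"
  proof -
    have "hpath step (insert w D2) w (cross y)" by (rule hpath_Cons[OF stp(2) h2 wD(2)])
    then have "hpath step (insert w D2 \<union> Q) w x"
      by (rule hpath_join[OF _ cy(2) hpath_rev[OF symp_step e(1)]]) (use D(1) w(1) d in blast)
    then have "hpath step (insert w D2 \<union> Q \<union> D1) w u1"
      by (rule path_via[OF _ e(2) h1]) (use D(1,2) wD d in blast)
    moreover have "insert w D2 \<union> Q \<union> D1 = live ?i \<union> Q" using D(1) w(1) by blast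
    ultimately show ?thesis by simp
  qed
  have 2: "hpath step (live ?i \<union> Q) w u2"
  proof -
    have "hpath step (insert w D1) w (cross x)"
      by (rule hpath_Cons[OF stp(1) hpath_rev[OF symp_step h1] wD(1)])
    then have "hpath step (insert w D1 \<union> Q) w y"
      by (rule hpath_join[OF _ cx(2) e(1)]) (use D(1) w(1) d in blast)
    then have "hpath step (insert w D1 \<union> Q \<union> D2) w u2"
      by (rule path_via[OF _ e(3) hpath_rev[OF symp_step h2]]) (use D(1,2) wD d in blast)
    moreover have "insert w D1 \<union> Q \<union> D2 = live ?i \<union> Q" using D(1) w(1) by blast
    ultimately show ?thesis by simp
  qed
  show thesis
  proof (cases "out u1 = c")
    case False
    then show ?thesis using that 1 u1w ul(1) by blast
  next
    case True
    then show ?thesis using that 2 D(6) ul(2) ou by metis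
  qed
qed

lemma one_loop_cycle:
  assumes c: "c \<in> L" "load c = faults" "W \<subseteq> copy c" and G: "\<forall>g \<in> L - {c}. good g"
    and S: "S1 \<union> S2 = live c" "S1 \<inter> S2 = {}" "seg S1 x1 y1" "seg S2 x2 y2" "x1 \<noteq> y1"
    and o: "out y1 = out x1" "out x2 \<noteq> out y2" "out x2 \<noteq> out x1" "out y2 \<noteq> out x1"
  shows "hcycle step (region L)"
proof -
  let ?i = "out x1" and ?H = "L - {c, out x1}"
  note e1 = segD[OF S(3)] and e2 = segD[OF S(4)]
  have l: "x1 \<in> live c" "x2 \<in> live c" "y2 \<in> live c" using e1(4) e2(4,5) S(1) by blast+
  have i: "?i \<in> L" "?i \<noteq> c" using exit_out[OF e1(2) l(1) c(1)] exit_cross(4)[OF e1(2)] by blast+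
  have gi: "good ?i" using G i by blast
  have oH: "out x2 \<in> ?H" "out y2 \<in> ?H"
    using exit_out[OF e2(2) l(2) c(1)] exit_out[OF e2(3) l(3) c(1)] exit_cross(4)[OF e2(2)]
      exit_cross(4)[OF e2(3)] o(3,4) by auto
  have sub: "S1 \<subseteq> live c" using S(1) by blast
  have X: "finite {out x2, out y2, c}" "card {out x2, out y2, c} \<le> 3" "c \<in> {out x2, out y2, c}"
    by (simp_all add: card_insert_if)
  obtain u v where uv: "seg (live ?i \<union> S1) u v" "u \<in> live ?i" "v \<in> live ?i" "out u \<noteq> out v"
    "out u \<notin> {out x2, out y2, c}" "out v \<notin> {out x2, out y2, c}"
    using loop_segment[OF c S(3) sub S(5) gi o(1) X] .
  have uH: "out u \<in> ?H" "out v \<in> ?H"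
    using seg_live_outs[OF uv(1-3) i(1)] uv(5,6) by auto
  have H: "\<forall>g \<in> ?H. good g" using G by blast
  have d: "live ?i \<inter> region ?H = {}" "live c \<inter> region ?H = {}" "live ?i \<inter> live c = {}"
    using live_region_disjoint[OF i(1), of ?H] live_region_disjoint[OF c(1), of ?H]
      live_disjoint[OF i(1) c(1) i(2)] by blast+
  have "(live ?i \<union> S1) \<inter> region ?H = {}" using d sub by blast
  then have R: "hpath step (region ?H \<union> (live ?i \<union> S1)) (cross x2) (cross y2)"
    by (rule seg_path[OF H uv(1) _ uv(4) _ _ oH o(2) exit_cross(3)[OF e2(2)] exit_cross(3)[OF e2(3)]])
      (use uv uH in auto)
  have "finite (region ?H \<union> (live ?i \<union> S1))" using hpath_ends[OF R] by simp
  then have "card (live ?i) \<le> card (region ?H \<union> (live ?i \<union> S1))" by (intro card_mono) auto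
  then have c3: "3 \<le> card (region ?H \<union> (live ?i \<union> S1))" using card_live_large[OF i(1)] by linarith
  have "hcycle step (S2 \<union> (region ?H \<union> (live ?i \<union> S1)))"
    by (rule seg_close[OF S(4) R _ c3]) (use S(1,2) d in blast)
  moreover have "S2 \<union> (region ?H \<union> (live ?i \<union> S1)) = region L"
  proof -
    have "region L = live c \<union> (live ?i \<union> region ?H)" using c(1) i by (auto simp: region_def)
    then show ?thesis using S(1) by blast
  qed
  ultimately show ?thesis by simp
qed

text \<open>
  The faults cut \<open>c\<close> into two segments. Generically their four ends lead to copies through which
  the segments are connected to a cycle. Difficulties arise only when ends lead to the same copy: two ends of
  different segments are then connected inside this copy, and a segment with both ends at one copy absorbs
  it. If this happens to both segments, the two absorbed cycles are bridged at an edge between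
  the two absorbed copies.\<close>

lemma two_segments_cycle:
  assumes c: "c \<in> L" "load c = faults" "W \<subseteq> copy c" and G: "\<forall>g \<in> L - {c}. good g"
    and S: "S1 \<union> S2 = live c" "S1 \<inter> S2 = {}" "seg S1 x1 y1" "seg S2 x2 y2" "x1 \<noteq> y1" "x2 \<noteq> y2"
    and o: "out x1 \<noteq> out y2" "out x1 \<noteq> - out y2" "out y1 \<noteq> out x2"
  shows "hcycle step (region L)"
proof -
  note e1 = segD[OF S(3)] and e2 = segD[OF S(4)]
  have l: "x1 \<in> live c" "y1 \<in> live c" "x2 \<in> live c" "y2 \<in> live c"
    using e1(4,5) e2(4,5) S(1) by blast+
  have oG: "out x \<in> L - {c}" if "exit x" "x \<in> live c" for x
    using exit_out[OF that c(1)] exit_cross(4)[OF that(1)] by blast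
  note oo = oG[OF e1(2) l(1)] oG[OF e1(3) l(2)] oG[OF e2(2) l(3)] oG[OF e2(3) l(4)]
  have regc: "region L = live c \<union> region (L - {c})" using region_remove[OF c(1)] .
  have dc: "live c \<inter> region (L - {c}) = {}" using live_region_disjoint[OF c(1), of "L - {c}"] by blast
  consider (none) "out x1 \<noteq> out y1" "out x2 \<noteq> out y2" | (first) "out x1 = out y1" "out x2 \<noteq> out y2"
    | (second) "out x1 \<noteq> out y1" "out x2 = out y2" | (loops) "out x1 = out y1" "out x2 = out y2" by blast
  then show ?thesis
  proof cases
    case none
    show ?thesis
    proof (cases "{out x1, out y1} = {out x2, out y2}")
      case False
      have "card (L - {c}) = card L - 1" using c(1) finite_L by simp
      then have "6 \<le> card (L - {c})" using card_L m3 by simp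
      then have "hcycle step (S1 \<union> S2 \<union> region (L - {c}))"
        using two_seg_cycle[OF G _ S(3,4) oo none False S(2)] dc S(1) by simp
      then show ?thesis using S(1) regc by simp
    next
      case True
      \<comment> \<open>Both segments lead to the same two copies: one copy joins the segments.\<close>
      then have eq: "out x1 = out x2" "out y1 = out y2" using o none by (auto simp: doubleton_eq_iff)
      let ?i = "out y1" and ?H = "L - {c, out y1}"
      have i: "?i \<in> L" "?i \<noteq> c" "good ?i" using oo(2) G by blast+
      have "y1 \<noteq> y2" using e1(5) e2(5) S(2) by blast
      then have "cross y1 \<noteq> cross y2" using cross_eq_iff[OF e1(3) e2(3)] by simp
      then have "hpath step (live ?i) (cross y1) (cross y2)"
        using good_hpath(2)[OF i(3) exit_cross(3)[OF e1(3)]] exit_cross(3)[OF e2(3)] eq(2) by simp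
      moreover have d: "live ?i \<inter> live c = {}" using live_disjoint[OF i(1) c(1) i(2)] .
      ultimately have "hpath step (S1 \<union> S2 \<union> live ?i) x1 x2"
        by (intro path_detour[OF e1(1) hpath_rev[OF symp_step e2(1)] e1(3) e2(3) _ S(2)]) (use S(1) in blast)+
      then have Q: "seg (live c \<union> live ?i) x1 x2" unfolding seg_def using e1(2) e2(2) S(1) by simp
      have H: "\<forall>g \<in> ?H. good g" using G by blast
      have "x1 \<noteq> x2" using e1(4) e2(4) S(2) by blast
      then have "cross x1 \<noteq> cross x2" using cross_eq_iff[OF e1(2) e2(2)] by simp
      moreover have "out x1 \<in> ?H" "out x2 \<in> ?H" using oo(1) none(1) eq(1) by auto
      ultimately have R: "hpath step (region ?H) (cross x1) (cross x2)"
        by (intro region_connected[OF H card_minus_two cross_in_region[OF e1(2)] cross_in_region[OF e2(2)]])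
      have "(live c \<union> live ?i) \<inter> region ?H = {}"
        using live_region_disjoint[OF c(1), of ?H] live_region_disjoint[OF i(1), of ?H] by blast
      moreover have "3 \<le> card (region ?H)" using card_region_large[of ?H "out x1"] \<open>out x1 \<in> ?H\<close> by blast
      ultimately have "hcycle step (live c \<union> live ?i \<union> region ?H)" using seg_close[OF Q R] by blast
      moreover have "live c \<union> live ?i \<union> region ?H = region L" using c(1) i(1) by (auto simp: region_def)
      ultimately show ?thesis by simp
    qed
  next
    case first
    then show ?thesis using one_loop_cycle[OF c G S(1-5)] o by metis
  next
    case second
    have "S2 \<union> S1 = live c" "S2 \<inter> S1 = {}" using S(1,2) by blast+
    then show ?thesis using one_loop_cycle[OF c G _ _ S(4,3,6)] second o by metis
  next
    case loops
    let ?i = "out x1" and ?j = "out x2" and ?H = "L - {c, out x1, out x2}"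
    have ij: "?i \<noteq> ?j" "?i \<noteq> - ?j" using o loops by auto
    have iL: "?i \<in> L" "?i \<noteq> c" "good ?i" and jL: "?j \<in> L" "?j \<noteq> c" "good ?j"
      using oo(1,3) G by blast+
    obtain w where w: "w \<in> live ?j" "out w = ?i" "exit w"
      using obtain_edge[OF jL(1) iL(1) ij] by blast
    note cw = exit_cross[OF w(3)] and ow = exit_out[OF w(3,1) jL(1)]
    have zl: "cross w \<in> live ?i" "out (cross w) = ?j" using cw(3) w(2) ow by simp_all
    have s1: "S1 \<subseteq> live c" and s2: "S2 \<subseteq> live c" using S(1) by blast+
    obtain u where u: "hpath step (live ?j \<union> S2) w u" "inner w u" "u \<in> live ?j" "out u \<noteq> c"
      using loop_arm[OF c(1) S(4) s2 S(6) jL(3) loops(2)[symmetric] w(1)] w(2) iL(2) by metis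
    obtain v where v: "hpath step (live ?i \<union> S1) (cross w) v" "inner (cross w) v" "v \<in> live ?i" "out v \<noteq> c"
      using loop_arm[OF c(1) S(3) s1 S(5) iL(3) loops(1)[symmetric] zl(1)] zl(2) jL(2) by metis
    have ex: "exit u" "exit v"
      using concentrated_exit[OF c(2,1) jL(1) u(3,4)] concentrated_exit[OF c(2,1) iL(1) v(3,4)] .
    have wc: "w \<in> copy ?j" "cross w \<in> copy ?i" using liveD(1) w(1) zl(1) by blast+
    have ne: "out u \<noteq> out v"
      using inner_across[OF jL(1) wc(1)] u(2) v(2) unfolding inner_def by blast
    have "out u \<noteq> ?i" "out v \<noteq> ?j"
      using inner_facts(2)[OF jL(1) wc(1) u(2)] inner_facts(2)[OF iL(1) wc(2) v(2)] w(2) zl(2) by auto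
    then have oH: "out u \<in> ?H" "out v \<in> ?H"
      using exit_out[OF ex(1) u(3) jL(1)] exit_out[OF ex(2) v(3) iL(1)] exit_cross(4) ex u(4) v(4) by auto
    have dd: "live ?i \<inter> live ?j = {}" "live ?i \<inter> live c = {}" "live ?j \<inter> live c = {}"
      using live_disjoint[OF iL(1) jL(1) ij(1)] live_disjoint[OF iL(1) c(1) iL(2)]
        live_disjoint[OF jL(1) c(1) jL(2)] .
    have "hpath step ((live ?j \<union> S2) \<union> (live ?i \<union> S1)) u v"
      by (rule hpath_join[OF hpath_rev[OF symp_step u(1)] cw(1) v(1)]) (use dd S(2) s1 s2 in blast)
    then have Q: "seg ((live ?j \<union> S2) \<union> (live ?i \<union> S1)) u v" unfolding seg_def using ex by simp
    have H: "\<forall>g \<in> ?H. good g" using G by blast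
    have "card ?H = card L - 3" using c(1) iL jL ij(1) finite_L by simp
    then have "5 \<le> card ?H" using card_L m3 by simp
    then have R: "hpath step (region ?H) (cross u) (cross v)"
      by (intro region_path[OF H _ oH ne exit_cross(3)[OF ex(1)] exit_cross(3)[OF ex(2)]])
    have "((live ?j \<union> S2) \<union> (live ?i \<union> S1)) \<inter> region ?H = {}"
      using live_region_disjoint[OF c(1), of ?H] live_region_disjoint[OF iL(1), of ?H]
        live_region_disjoint[OF jL(1), of ?H] s1 s2 by blast
    moreover have "3 \<le> card (region ?H)" using card_region_large[of ?H "out u"] oH(1) by blast
    ultimately have "hcycle step (((live ?j \<union> S2) \<union> (live ?i \<union> S1)) \<union> region ?H)"
      using seg_close[OF Q R] by blast
    moreover have "((live ?j \<union> S2) \<union> (live ?i \<union> S1)) \<union> region ?H = region L"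
    proof -
      have "region L = live c \<union> (live ?i \<union> (live ?j \<union> region ?H))"
        using c(1) iL(1) jL(1) by (auto simp: region_def)
      then show ?thesis using S(1) by blast
    qed
    ultimately show ?thesis by simp
  qed
qed

text \<open>
  One fault of \<open>c\<close> is put back, so that the induction hypothesis provides a cycle, and taken out again. A faulty edge or
  a single vertex leaves a path, a faulty pair may leave two.\<close>

lemma concentrated_cycle:
  assumes c: "c \<in> L" "load c = faults" and f: "faults + 1 = m" and G: "\<forall>g \<in> L - {c}. good g"
  shows "hcycle step (region L)"
proof -
  have sub: "live c \<subseteq> copy c" unfolding live_def by blast
  have close: "hcycle step (region L)" if h: "hpath inner (live c) x y" "x \<noteq> y" for x y
  proof -
    have "x \<in> live c" "y \<in> live c" using hpath_ends[OF h(1)] by simp_all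
    then have "seg (live c) x y"
      unfolding seg_def using inner_hpath[OF c(1) sub h(1)] concentrated_exit_in[OF c(2,1)] by blast
    then show ?thesis using close_lone[OF c(1) G _ h(2)] by blast
  qed
  show ?thesis
  proof (cases "D = {}")
    case False
    then obtain d where d: "d \<in> D" by blast
    have "{d' \<in> D - {d}. d' \<subseteq> copy c} = edges_in c - {d}" "d \<in> edges_in c"
      using d concentrated_touch(2)[OF c(2) d] unfolding edges_in_def by blast+
    moreover have "finite (edges_in c)" using D(1) unfolding edges_in_def by simp
    ultimately have "card {d' \<in> D - {d}. d' \<subseteq> copy c} + 1 = card (edges_in c)"
      by (metis add.commute card_Suc_Diff1 plus_1_eq_Suc)
    then have "hcycle (padj (D - {d}) m) (live c)"
      using trace_tolerance(1)[OF c(1), of M "D - {d}"] c(2) f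
      unfolding load_def touching_def live_def W_def by simp
    then obtain x y where "hpath inner (live c) x y" "x \<noteq> y"
    proof (rule hcycle_avoid_edge[OF symp_padj symp_inner])
      fix u v assume "padj (D - {d}) m u v" "{u, v} \<noteq> d"
      then show "inner u v" unfolding inner_def padj_def by auto
    qed
    then show ?thesis by (rule close)
  next
    case D0: True
    have load: "load c + 1 \<le> m" using c(2) f by simp
    have touch: "touching c = M" using concentrated_touch(1)[OF c(2)] unfolding touching_def by blast
    show ?thesis
    proof (cases "\<exists>e \<in> M. \<exists>v. e \<inter> copy c = {v}")
      case True
      then obtain e v where e: "e \<in> M" "e \<inter> copy c = {v}" by blast
      have cyc: "hcycle inner (live c \<union> {v})"
        using withdraw(1)[OF c(1) _ load, of e] e touch by simp
      obtain x y where "x \<noteq> y" "hpath inner (live c \<union> {v} - {v}) x y"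
        using hcycle_remove[OF symp_inner cyc, of v] by blast
      moreover have "live c \<union> {v} - {v} = live c" using e unfolding live_def W_def by blast
      ultimately show ?thesis using close by simp
    next
      case False
      have ins: "\<exists>a \<in> copy c. \<exists>b \<in> copy c. padj {} m a b \<and> e = {a, b}" if e: "e \<in> M" for e
        using e
      proof (cases rule: M_cases)
        case (single i v)
        then have "e \<inter> copy c = {v}" using concentrated_touch(1)[OF c(2) e] by blast
        then show ?thesis using False e by blast
      next
        case (inside i v w)
        have "i = c"
        proof (rule ccontr)
          assume "i \<noteq> c"
          then have "copy i \<inter> copy c = {}" using copy_disjoint[OF inside(1) c(1)] by blast
          then show False using concentrated_touch(1)[OF c(2) e] inside by blast
        qed
        then show ?thesis using inside by blast
      next
        case (across i v)
        note cf = cross_facts[OF across(1,2)]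
        have "\<not> (v \<in> copy c \<and> cross v \<in> copy c)"
          using copyD(2)[OF c(1)] copyD(2)[OF across(1,2)] copyD(2)[OF cf(1,4)] cf(2) by metis
        then have "e \<inter> copy c = {v} \<or> e \<inter> copy c = {cross v}"
          using concentrated_touch(1)[OF c(2) e] across(3) by blast
        then show ?thesis using False e by blast
      qed
      then have Wc: "W \<subseteq> copy c" unfolding W_def by blast
      have "M \<noteq> {}" using f m3 D0 unfolding faults_def by auto
      then obtain e where e: "e \<in> M" by blast
      obtain a b where ab: "a \<in> copy c" "b \<in> copy c" "padj {} m a b" "e = {a, b}" using ins[OF e] by blast
      have "e \<inter> copy c = {a, b}" using ab by blast
      then have cyc: "hcycle inner (live c \<union> {a, b})"
        using withdraw(1)[OF c(1) _ load, of e] e touch by simp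
      have nl: "a \<notin> live c" "b \<notin> live c" using e ab(4) unfolding live_def W_def by blast+
      have E: "live c \<union> {a, b} - {a, b} = live c" using nl by blast
      have "a \<noteq> b" using inner_in(2)[OF c(1) ab(1,3)] by blast
      have "card (live c) \<le> card (live c \<union> {a, b})" using finite_live[OF c(1)] by (intro card_mono) auto
      then have c4: "4 \<le> card (live c \<union> {a, b})" using card_live_large[OF c(1)] by linarith
      have "a \<in> live c \<union> {a, b}" "b \<in> live c \<union> {a, b}" by simp_all
      from symp_inner cyc this \<open>a \<noteq> b\<close> c4 show ?thesis
      proof (cases rule: hcycle_remove2)
        case (one x y)
        then show ?thesis using close E by simp
      next
        case (two S1 S2 x1 y1 x2 y2)
        have S: "S1 \<union> S2 = live c" using two(1) E by simp
        have sS: "S1 \<subseteq> copy c" "S2 \<subseteq> copy c" using S sub by blast+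
        have mem: "x1 \<in> S1" "y1 \<in> S1" "x2 \<in> S2" "y2 \<in> S2"
          using hpath_ends[OF two(3)] hpath_ends[OF two(4)] by simp_all
        have l: "x1 \<in> live c" "y1 \<in> live c" "x2 \<in> live c" "y2 \<in> live c" using mem S by blast+
        have s1: "seg S1 x1 y1" and s2: "seg S2 x2 y2"
          unfolding seg_def using inner_hpath[OF c(1) sS(1) two(3)] inner_hpath[OF c(1) sS(2) two(4)]
            concentrated_exit_in[OF c(2,1)] l by blast+
        have ne: "x1 \<noteq> y2" "y1 \<noteq> x2" using mem two(2) by blast+
        have tri: "x1 \<noteq> y1" "x2 \<noteq> y2"
          using inner_no_triangle[OF c(1) ab(1,3)] two(5-8) unfolding inner_def by blast+
        have o: "out x1 \<noteq> out y2" "out x1 \<noteq> - out y2" "out y1 \<noteq> out x2"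
          using inner_two[OF c(1) ab(1) _ _ ne(1)] inner_two(1)[OF c(1) ab(2) _ _ ne(2)] two(5-8)
          unfolding inner_def by blast+
        show ?thesis by (rule two_segments_cycle[OF c Wc G S two(2) s1 s2 tri o])
      qed
    qed
  qed
qed

section \<open>Hamiltonian cycles with several damaged copies\<close>

lemma load_sum:
  assumes "finite T" "T \<subseteq> L"
  shows "(\<Sum>i \<in> T. load i) = (\<Sum>e \<in> M. card {i \<in> T. e \<inter> copy i \<noteq> {}}) + (\<Sum>d \<in> D. card {i \<in> T. d \<subseteq> copy i})"
proof -
  have sw: "(\<Sum>i \<in> T. card {e \<in> N. P e i}) = (\<Sum>e \<in> N. card {i \<in> T. P e i})" if "finite N"
    for N :: "int list set set" and P
  proof -
    have "(\<Sum>i \<in> T. card {e \<in> N. P e i}) = (\<Sum>i \<in> T. \<Sum>e \<in> N. of_bool (P e i))"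
      using that by (simp add: Int_def)
    also have "\<dots> = (\<Sum>e \<in> N. \<Sum>i \<in> T. of_bool (P e i))" by (rule sum.swap)
    also have "\<dots> = (\<Sum>e \<in> N. card {i \<in> T. P e i})" using assms(1) by (simp add: Int_def)
    finally show ?thesis .
  qed
  show ?thesis
    unfolding load_def touching_def edges_in_def sum.distrib using sw[OF finM] sw[OF D(1)] by simp
qed

lemma touch_at_most_two:
  assumes "e \<in> M" "T \<subseteq> L" "finite T"
  shows "card {i \<in> T. e \<inter> copy i \<noteq> {}} \<le> 2"
proof -
  have at: "{i \<in> T. e \<inter> copy i \<noteq> {}} \<subseteq> (\<lambda>x. x ! m) ` e" using copyD(2) assms(2) by blast
  have "finite e \<and> card e \<le> 2" using assms(1) by (cases rule: M_cases) (auto simp: card_insert_if)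
  then have "card ((\<lambda>x. x ! m) ` e) \<le> 2" "finite ((\<lambda>x. x ! m) ` e)"
    using card_image_le[of e "\<lambda>x. x ! m"] by auto
  then show ?thesis using card_mono[OF _ at] by linarith
qed

lemma touch_two_across:
  assumes "e \<in> M" "i \<in> L" "j \<in> L" "i \<noteq> j" "e \<inter> copy i \<noteq> {}" "e \<inter> copy j \<noteq> {}"
  obtains v where "v \<in> copy i" "cross v \<in> copy j" "e = {v, cross v}" "out v = j"
proof -
  obtain x y where x: "x \<in> e" "x \<in> copy i" and y: "y \<in> e" "y \<in> copy j" using assms by blast
  have "y \<notin> copy i" using y copy_disjoint[OF assms(2-4)] by blast
  note p = M_cross_pair[OF assms(1,2) x(2,1) y(1) this]
  have "out x = j" using cross_facts(1,4)[OF assms(2) x(2)] p(1) y(2) copy_disjoint[OF _ assms(3)] by blast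
  then show thesis using that x p y by blast
qed

lemma edge_at_most_one:
  assumes "d \<in> D" "T \<subseteq> L" "finite T"
  shows "card {i \<in> T. d \<subseteq> copy i} \<le> 1"
proof (rule card_le_1I)
  fix i j assume "i \<in> {i \<in> T. d \<subseteq> copy i}" "j \<in> {i \<in> T. d \<subseteq> copy i}"
  moreover have "d \<noteq> {}" using assms(1) D(2) by blast
  ultimately show "i = j" using copy_disjoint[of i j] assms(2) by blast
qed

text \<open>
  Available for three symbols: the copy can be inserted between any two of the good copies \<open>G\<close> that are joined to it,
  so that only the arrangement of the labels remains to be found.\<close>

definition "pliable c G \<longleftrightarrow> (\<forall>g \<in> G. \<forall>h \<in> G. g \<noteq> h \<longrightarrow> g \<noteq> - c \<longrightarrow> h \<noteq> - c \<longrightarrow>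
   (\<exists>x y. seg (live c) x y \<and> out x = g \<and> out y = h))"

lemma pliableE:
  assumes "pliable c G" "g \<in> G" "h \<in> G" "g \<noteq> h" "g \<noteq> - c" "h \<noteq> - c"
  obtains x y where "seg (live c) x y" "out x = g" "out y = h"
  using assms unfolding pliable_def by blast

lemma pliableI:
  assumes m: "m = 3" and c: "c \<in> L" "w \<in> copy c" "copy c \<inter> W = {w}" "edges_in c = {}"
    and G: "G \<subseteq> L - {c}" "out w \<notin> G" and ex: "\<And>x. x \<in> live c \<Longrightarrow> out x \<in> G \<Longrightarrow> exit x"
  shows "pliable c G"
  unfolding pliable_def
proof (intro ballI impI)
  fix g h assume gh: "g \<in> G" "h \<in> G" "g \<noteq> h" "g \<noteq> - c" "h \<noteq> - c"
  have g: "g \<in> L" "g \<noteq> c" "g \<noteq> out w" and h: "h \<in> L" "h \<noteq> c" "h \<noteq> out w" using gh G by blast+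
  obtain x y where xy: "hpath step (live c) x y" "x \<in> live c" "y \<in> live c" "out x = g" "out y = h"
    using three_symbols_path[OF m c g(1,2) gh(4) g(3) h(1,2) gh(5) h(3) gh(3)] .
  then have "seg (live c) x y" unfolding seg_def using ex gh by simp
  then show "\<exists>x y. seg (live c) x y \<and> out x = g \<and> out y = h" using xy by blast
qed

text \<open>
  There are five good copies. The pliable \<open>c1\<close> connects two of them, and \<open>c3\<close> and \<open>c2\<close> connect the other three;
  the antipodes are avoided by reserving \<open>- c1\<close>, if it is good, for \<open>c2\<close>.\<close>

lemma three_damaged:
  assumes m: "m = 3" and c: "c1 \<in> L" "c2 \<in> L" "c3 \<in> L" "c1 \<noteq> c2" "c1 \<noteq> c3" "c2 \<noteq> c3"
    and G: "G = L - {c1, c2, c3}" "\<forall>g \<in> G. good g"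
    and s: "seg (live c3) x3 y3" "out x3 \<in> G" "out y3 \<in> G" "out x3 \<noteq> out y3"
    and p: "pliable c1 G" "pliable c2 G"
  shows "hcycle step (region L)"
proof -
  have finG: "finite G" using finite_L G(1) by simp
  have cG: "card G = 5" using G(1) c finite_L card_L m by simp
  let ?I = "G - {out x3, out y3}"
  have cI: "card ?I = 3" using s cG finG by simp
  have "\<exists>k \<in> ?I. k \<noteq> - c2 \<and> (- c1 \<in> ?I \<longrightarrow> k = - c1)"
  proof (cases "- c1 \<in> ?I")
    case True
    then show ?thesis using c(4) by (intro bexI[of _ "- c1"]) auto
  next
    case False
    have "\<not> ?I \<subseteq> {- c2}" using cI card_mono[of "{- c2}" ?I] by auto
    then show ?thesis using False by blast
  qed
  then obtain k where k: "k \<in> ?I" "k \<noteq> - c2" "- c1 \<in> ?I \<longrightarrow> k = - c1" by blast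
  have "card (?I - {k}) = 2" using cI k(1) finG by simp
  then obtain g h where gh: "?I - {k} = {g, h}" "g \<noteq> h" by (meson card_2_iff)
  then have ghG: "g \<in> G" "h \<in> G" "g \<noteq> - c1" "h \<noteq> - c1" using k(3) by blast+
  obtain x1 y1 where 1: "seg (live c1) x1 y1" "out x1 = g" "out y1 = h"
    using pliableE[OF p(1) ghG(1,2) gh(2) ghG(3,4)] .
  \<comment> \<open>Orient the third segment so that it starts at a copy joined to \<open>c2\<close>.\<close>
  obtain x y where 3: "seg (live c3) x y" "out x \<noteq> - c2" "out x \<noteq> out y" "{out x, out y} = {out x3, out y3}"
  proof (cases "out x3 = - c2")
    case True
    then show ?thesis using that[of y3 x3] seg_sym[OF s(1)] s(4) by auto
  next
    case False
    then show ?thesis using that[of x3 y3] s by auto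
  qed
  have xG: "out x \<in> G" "out y \<in> G" using 3(4) s(2,3) by (auto simp: doubleton_eq_iff)
  have kx: "k \<in> G" "k \<noteq> out x" "k \<noteq> out y" using k(1) 3(4) by blast+
  obtain x2 y2 where 2: "seg (live c2) x2 y2" "out x2 = k" "out y2 = out x"
    using pliableE[OF p(2) kx(1) xG(1) kx(2) k(2) 3(2)] .
  have dl: "live a \<inter> live b = {}" if "a \<in> L" "b \<in> L" "a \<noteq> b" for a b using live_disjoint[OF that] .
  have dG: "live a \<inter> region H = {}" if "a \<in> {c1, c2, c3}" "H \<subseteq> G" for a H
    using live_region_disjoint[of a H] that c G(1) by blast
  have kk: "{k, out x, out y} \<subseteq> G" using kx xG by blast
  have b1: "block (live c2 \<union> live c3 \<union> region {k, out x, out y}) k (out y)"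
    using chain_block[OF 2(1) 3(1), unfolded 2(2,3)] G(2) kx xG 3(3) dl[OF c(2,3,6)]
      dG[of c2, OF _ kk] dG[of c3, OF _ kk] by auto
  have gg: "{g, h} \<subseteq> G" using ghG by blast
  have b2: "block (live g \<union> live c1 \<union> live h) g h"
    using seg_block[OF 1(1), unfolded 1(2,3)] G(2) ghG(1,2) gh(2) dG[of c1, OF _ gg]
    by (auto simp: region_def)
  have dgh: "region {k, out x, out y} \<inter> region {g, h} = {}"
    using gh kk gg G(1) 3(4) by (intro region_disjoint) auto
  have "(live c2 \<union> live c3 \<union> region {k, out x, out y}) \<inter> (live g \<union> live c1 \<union> live h) = {}"
    using dgh dG[of c2, OF _ gg] dG[of c3, OF _ gg] dG[of c1, OF _ kk] dl[OF c(1,2,4)] dl[OF c(1,3,5)]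
    unfolding region_def by auto
  from block_close[OF b1 kx(3) b2 gh(2) this]
  have "hcycle step (live c2 \<union> live c3 \<union> region {k, out x, out y} \<union> (live g \<union> live c1 \<union> live h))" .
  moreover have "L = {c1, c2, c3} \<union> ({k, out x, out y} \<union> {g, h})"
  proof -
    have "G = {k, out x, out y} \<union> {g, h}" using gh(1) k(1) 3(4) xG by blast
    then show ?thesis using G(1) c by blast
  qed
  then have "region L = live c2 \<union> live c3 \<union> region {k, out x, out y} \<union> (live g \<union> live c1 \<union> live h)"
    by (auto simp: region_def)
  ultimately show ?thesis by simp
qed

text \<open>
  Four good and four pliable copies alternate around a ring. First \<open>c1\<close> and \<open>c2\<close> split the good copies into two pairs,
  with \<open>- c2\<close> on the side of \<open>c1\<close>; then \<open>c3\<close> and \<open>c4\<close> connect the two pairs.\<close>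

lemma four_damaged:
  assumes m: "m = 3" and c: "c1 \<in> L" "c2 \<in> L" "c3 \<in> L" "c4 \<in> L" "distinct [c1, c2, c3, c4]"
    and G: "G = L - {c1, c2, c3, c4}" "\<forall>g \<in> G. good g"
    and p: "pliable c1 G" "pliable c2 G" "pliable c3 G" "pliable c4 G"
  shows "hcycle step (region L)"
proof -
  have finG: "finite G" using finite_L G(1) by simp
  have cG: "card G = 4" using G(1) c finite_L card_L m by simp
  have ring: "hcycle step (region L)"
    if g: "G = {g1, g2, g3, g4}" "distinct [g1, g2, g3, g4]"
      and n: "g1 \<noteq> - c1" "g2 \<noteq> - c1" "g2 \<noteq> - c3" "g3 \<noteq> - c3" "g3 \<noteq> - c2" "g4 \<noteq> - c2" "g4 \<noteq> - c4" "g1 \<noteq> - c4"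
    for g1 g2 g3 g4
  proof -
    have gG: "g1 \<in> G" "g2 \<in> G" "g3 \<in> G" "g4 \<in> G" and gd: "g1 \<noteq> g2" "g1 \<noteq> g3" "g2 \<noteq> g3" "g3 \<noteq> g4" "g1 \<noteq> g4" "g2 \<noteq> g4"
      using g by auto
    obtain x1 y1 where 1: "seg (live c1) x1 y1" "out x1 = g1" "out y1 = g2"
      using pliableE[OF p(1) gG(1,2) gd(1) n(1,2)] .
    obtain x3 y3 where 3: "seg (live c3) x3 y3" "out x3 = g2" "out y3 = g3"
      using pliableE[OF p(3) gG(2,3) gd(3) n(3,4)] .
    obtain x2 y2 where 2: "seg (live c2) x2 y2" "out x2 = g3" "out y2 = g4"
      using pliableE[OF p(2) gG(3,4) gd(4) n(5,6)] .
    obtain x4 y4 where 4: "seg (live c4) x4 y4" "out x4 = g4" "out y4 = g1"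
      using pliableE[OF p(4) gG(4,1) gd(5)[symmetric] n(7,8)] .
    have dG: "live a \<inter> region H = {}" if "a \<in> {c1, c2, c3, c4}" "H \<subseteq> G" for a H
      using live_region_disjoint[of a H] that c G(1) by blast
    have cd: "c1 \<noteq> c2" "c1 \<noteq> c3" "c1 \<noteq> c4" "c2 \<noteq> c3" "c2 \<noteq> c4" "c3 \<noteq> c4" using c(5) by auto
    have gs: "{g1, g2, g3} \<subseteq> G" "{g4} \<subseteq> G" using gG by blast+
    have b: "block (live c1 \<union> live c3 \<union> region {g1, g2, g3}) g1 g3"
      using chain_block[OF 1(1) 3(1), unfolded 1(2,3) 3(2,3)] G(2) gG gd
        live_disjoint[OF c(1,3) cd(2)] dG[of c1, OF _ gs(1)] dG[of c3, OF _ gs(1)] by auto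
    have d4: "region {g1, g2, g3} \<inter> live g4 = {}"
      using live_region_disjoint[of g4 "{g1, g2, g3}"] gG G(1) gd by auto
    have d1: "live a \<inter> live g4 = {}" if "a \<in> {c1, c2, c3, c4}" for a
      using dG[OF that gs(2)] by (simp add: region_def)
    let ?B = "live c1 \<union> live c3 \<union> region {g1, g2, g3} \<union> live c2 \<union> live g4"
    have B: "block ?B g1 g4"
    proof (rule block_seg[of _ _ x2 _ y2, unfolded 2(2,3), OF b block_good 2(1)])
      show "good g4" using G(2) gG by blast
      show "(live c1 \<union> live c3 \<union> region {g1, g2, g3}) \<inter> live g4 = {}" using d4 d1 by blast
      show "(live c1 \<union> live c3 \<union> region {g1, g2, g3}) \<inter> live c2 = {}"
        using live_disjoint[OF c(1,2) cd(1)] live_disjoint[OF c(2,3) cd(4)] dG[of c2, OF _ gs(1)] by blast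
      show "live g4 \<inter> live c2 = {}" using d1 by blast
    qed
    note e4 = segD[OF 4(1)]
    note cx = exit_cross[OF e4(2)] and cy = exit_cross[OF e4(3)]
    have dB: "live c4 \<inter> ?B = {}"
      using live_disjoint[OF c(1,4) cd(3)] live_disjoint[OF c(2,4) cd(5)] live_disjoint[OF c(3,4) cd(6)]
        dG[of c4, OF _ gs(1)] d1[of c4] by blast
    have "live g1 \<inter> live g4 = {}" using d4 by (auto simp: region_def)
    then have "cross y4 \<noteq> cross x4" using cx(3) cy(3) 4(2,3) by auto
    moreover have "cross (cross y4) \<notin> ?B" "cross (cross x4) \<notin> ?B" using cx(5) cy(5) e4(4,5) dB by auto
    ultimately have R: "hpath step ?B (cross y4) (cross x4)"
      using block_hpath[OF B] cx(3) cy(3) 4(2,3) by simp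
    have "finite ?B" using hpath_ends[OF R] by simp
    then have "card (live g4) \<le> card ?B" by (intro card_mono) auto
    then have "3 \<le> card ?B" using card_live_large[of g4] gG(4) G(1) by auto
    then have "hcycle step (live c4 \<union> ?B)"
      using seg_close[OF seg_sym[OF 4(1)] R dB] by blast
    moreover have "live c4 \<union> ?B = region L"
    proof -
      have "L = {c1, c2, c3, c4} \<union> {g1, g2, g3, g4}" using G(1) c g(1) by blast
      then show ?thesis by (auto simp: region_def)
    qed
    ultimately show ?thesis by simp
  qed
  have two: "\<exists>a b. a \<in> G \<and> b \<in> G \<and> a \<noteq> b \<and> a \<noteq> - c1 \<and> b \<noteq> - c1 \<and> (- c2 \<in> G \<longrightarrow> a = - c2)"
  proof -
    have pick: "\<exists>b \<in> G. b \<noteq> p \<and> b \<noteq> q" for p q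
    proof -
      have "card {p, q} < card G" using card_four(3)[of p q] cG by linarith
      then have "\<not> G \<subseteq> {p, q}" using card_mono[of "{p, q}" G] by auto
      then show ?thesis by blast
    qed
    show ?thesis
    proof (cases "- c2 \<in> G")
      case True
      obtain b where "b \<in> G" "b \<noteq> - c1" "b \<noteq> - c2" using pick by blast
      then show ?thesis using True c(5) by (intro exI[of _ "- c2"] exI[of _ b]) auto
    next
      case False
      obtain a where "a \<in> G" "a \<noteq> - c1" using pick by blast
      moreover obtain b where "b \<in> G" "b \<noteq> - c1" "b \<noteq> a" using pick by blast
      ultimately show ?thesis using False by blast
    qed
  qed
  then obtain a b where ab: "a \<in> G" "b \<in> G" "a \<noteq> b" "a \<noteq> - c1" "b \<noteq> - c1" "- c2 \<in> G \<longrightarrow> a = - c2" by blast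
  have "card (G - {a, b}) = 2" using ab cG finG by simp
  then obtain d e where de: "G - {a, b} = {d, e}" "d \<noteq> e" by (meson card_2_iff)
  then have dG: "d \<in> G" "e \<in> G" "d \<noteq> a" "d \<noteq> b" "e \<noteq> a" "e \<noteq> b" by blast+
  have Ge: "G = {a, b, d, e}" using de(1) ab by blast
  have n2: "d \<noteq> - c2" "e \<noteq> - c2" using ab(6) dG by blast+
  have c34: "- c3 \<noteq> - c4" using c(5) by auto
  \<comment> \<open>It remains to connect the two pairs by \<open>c3\<close> and \<open>c4\<close>.\<close>
  have r1: "hcycle step (region L)" if "b \<noteq> - c3" "d \<noteq> - c3" "e \<noteq> - c4" "a \<noteq> - c4"
    by (rule ring[of a b d e]) (use Ge ab dG de(2) n2 that in auto)
  have r2: "hcycle step (region L)" if "b \<noteq> - c3" "e \<noteq> - c3" "d \<noteq> - c4" "a \<noteq> - c4"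
    by (rule ring[of a b e d]) (use Ge ab dG de(2) n2 that in auto)
  have r3: "hcycle step (region L)" if "a \<noteq> - c3" "d \<noteq> - c3" "e \<noteq> - c4" "b \<noteq> - c4"
    by (rule ring[of b a d e]) (use Ge ab dG de(2) n2 that in auto)
  have r4: "hcycle step (region L)" if "a \<noteq> - c3" "e \<noteq> - c3" "d \<noteq> - c4" "b \<noteq> - c4"
    by (rule ring[of b a e d]) (use Ge ab dG de(2) n2 that in auto)
  show ?thesis using r1 r2 r3 r4 ab(3) de(2) dG c34 by metis
qed

text \<open>
  Three copies, every two of which are joined by one of the three faults. The first two become segments with four
  different exits. The third avoids one exit of each, so that it extends one of the two blocks, connects them,
  or forms a third block.\<close>

lemma triangle_cycle:
  assumes m: "m = 4" and ac: "all_cross" and c: "c1 \<in> L" "c2 \<in> L" "c3 \<in> L" "c1 \<noteq> c2" "c1 \<noteq> c3" "c2 \<noteq> c3"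
    and l: "load c1 = 2" "load c2 = 2" "load c3 = 2"
    and G: "G = L - {c1, c2, c3}" "\<forall>g \<in> G. good g"
    and W: "\<And>w i. i \<in> {c1, c2, c3} \<Longrightarrow> w \<in> copy i \<Longrightarrow> w \<in> W \<Longrightarrow> out w \<in> {c1, c2, c3} - {i}"
  shows "hcycle step (region L)"
proof -
  have finG: "finite G" using finite_L G(1) by simp
  have cG: "card G = 7" using G(1) c finite_L card_L m by simp
  have get: "\<exists>x y. seg (live i) x y \<and> out x \<noteq> out y \<and> out x \<in> G - {a, b} \<and> out y \<in> G - {a, b}"
    if i: "i \<in> {c1, c2, c3}" for i a b
  proof -
    have iL: "i \<in> L" "1 \<le> load i" "load i + 2 \<le> m" using i c l m by auto
    have "card ({c1, c2, c3} - {i}) = 2" using i c by auto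
    then have c4: "card ({c1, c2, c3} - {i} \<union> {a, b}) \<le> 4"
      using card_Un_le[of "{c1, c2, c3} - {i}" "{a, b}"] card_four(3)[of a b] by linarith
    have "finite ({c1, c2, c3} - {i} \<union> {a, b})" by simp
    from all_cross_seg[OF ac iL this c4] W[OF i]
    obtain x y where xy: "seg (live i) x y" "x \<in> live i" "y \<in> live i" "out x \<noteq> out y"
      "out x \<notin> {c1, c2, c3} - {i} \<union> {a, b}" "out y \<notin> {c1, c2, c3} - {i} \<union> {a, b}" by blast
    have "out x \<in> G - {a, b}" "out y \<in> G - {a, b}"
      using seg_live_outs[OF xy(1-3) iL(1)] xy(5,6) G(1) by blast+
    then show ?thesis using xy(1,4) by blast
  qed
  obtain x1 y1 where 1: "seg (live c1) x1 y1" "out x1 \<noteq> out y1" "out x1 \<in> G" "out y1 \<in> G"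
    using get[of c1] by blast
  obtain x2 y2 where 2: "seg (live c2) x2 y2" "out x2 \<noteq> out y2" "out x2 \<in> G - {out x1, out y1}"
    "out y2 \<in> G - {out x1, out y1}"
    using get[of c2 "out x1" "out y1"] by blast
  obtain x y where 3: "seg (live c3) x y" "out x \<noteq> out y" "out x \<in> G - {out x1, out x2}"
    "out y \<in> G - {out x1, out x2}"
    using get[of c3 "out x1" "out x2"] by blast
  have dG: "live a \<inter> region H = {}" if "a \<in> {c1, c2, c3}" "H \<subseteq> G" for a H
    using live_region_disjoint[of a H] that c G(1) by blast
  have dl: "live a \<inter> live g = {}" if "a \<in> {c1, c2, c3}" "g \<in> G" for a g
    using dG[of a "{g}"] that by (simp add: region_def)
  have dg: "live g \<inter> live h = {}" if "g \<in> G" "h \<in> G" "g \<noteq> h" for g h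
    using live_disjoint[of g h] that G(1) by blast
  have dc: "live c1 \<inter> live c2 = {}" "live c1 \<inter> live c3 = {}" "live c2 \<inter> live c3 = {}"
    using live_disjoint c by blast+
  let ?B1 = "live (out x1) \<union> live c1 \<union> live (out y1)" and ?B2 = "live (out x2) \<union> live c2 \<union> live (out y2)"
  have b1: "block ?B1 (out x1) (out y1)"
    using 1 G(2) dl by (intro seg_block) auto
  have b2: "block ?B2 (out x2) (out y2)"
    using 2 G(2) dl by (intro seg_block) auto
  have oG: "out x1 \<in> G" "out y1 \<in> G" "out x2 \<in> G" "out y2 \<in> G" "out x \<in> G" "out y \<in> G"
    and on: "out x1 \<noteq> out x2" "out x1 \<noteq> out y2" "out y1 \<noteq> out x2" "out y1 \<noteq> out y2"
      "out x \<noteq> out x1" "out x \<noteq> out x2" "out y \<noteq> out x1" "out y \<noteq> out x2"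
    using 1 2 3 by auto
  have b12: "?B1 \<inter> ?B2 = {}"
    using dc(1) dl[of c1] dl[of c2] dg oG on by blast
  have regL: "region L = live c1 \<union> live c2 \<union> live c3 \<union> region G"
    using c G(1) by (auto simp: region_def)
  have b13: "?B1 \<inter> live c3 = {}" "?B2 \<inter> live c3 = {}" using dc dl[of c3] oG by blast+
  have split: "region G = region H \<union> region (G - H)" if "H \<subseteq> G" for H
    using that by (auto simp: region_def)
  \<comment> \<open>The third segment meets the first two blocks at most at their free ends.\<close>
  have both: "hcycle step (region L)"
    if s: "seg (live c3) u v" "out u = out y1" "out v = out y2" for u v
  proof -
    have B: "block (?B1 \<union> live c3 \<union> ?B2) (out x1) (out x2)"
      using block_seg[of ?B1 "out x1" u ?B2 v "out x2" "live c3"] b1 block_sym[OF b2] s b12 b13 by simp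
    let ?O = "{out x1, out y1, out x2, out y2}"
    have "card ?O \<le> 4" by (rule card_four)
    moreover have "card (G - ?O) = card G - card ?O" using oG finG by (intro card_Diff_subset) auto
    ultimately have "3 \<le> card (G - ?O)" using cG by linarith
    moreover have "(?B1 \<union> live c3 \<union> ?B2) \<inter> region (G - ?O) = {}"
      using dG[of c1 "G - ?O"] dG[of c2 "G - ?O"] dG[of c3 "G - ?O"]
        region_disjoint[of ?O "G - ?O"] oG G(1) by (auto simp: region_def)
    ultimately have "hcycle step (?B1 \<union> live c3 \<union> ?B2 \<union> region (G - ?O))"
      using block_cycle[OF B on(1)] G(2) by blast
    moreover have "?B1 \<union> live c3 \<union> ?B2 \<union> region (G - ?O) = region L"
      using regL split[of ?O] oG by (auto simp: region_def)
    ultimately show ?thesis by simp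
  qed
  have extend: "hcycle step (region L)"
    if s: "seg (live c3) u v" "out u = out b" and b: "block B (out a) (out b)" "block B' (out a') (out b')"
      "out a' \<noteq> out b'"
      and BB: "B = live (out a) \<union> live i \<union> live (out b)" "B' = live (out a') \<union> live j \<union> live (out b')"
      and ij: "{i, j} = {c1, c2}" "i \<noteq> j" and ab: "{out a, out b, out a', out b'} = {out x1, out y1, out x2, out y2}"
      and v: "out v \<in> G" "out v \<notin> {out a, out b, out a', out b'}" and d: "B \<inter> B' = {}"
    for u v a b a' b' i j B B'
  proof -
    have abG: "out a \<in> G" "out b \<in> G" "out a' \<in> G" "out b' \<in> G"
    proof -
      have "{out a, out b, out a', out b'} \<subseteq> G" unfolding ab using oG by simp
      then show "out a \<in> G" "out b \<in> G" "out a' \<in> G" "out b' \<in> G" by simp_all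
    qed
    have ic: "i \<in> {c1, c2, c3}" "j \<in> {c1, c2, c3}" using ij(1) by blast+
    have ic3: "live i \<inter> live c3 = {}" "live j \<inter> live c3 = {}"
      using ij(1) dc by (auto simp: doubleton_eq_iff)
    have dv: "B \<inter> live (out v) = {}" "B' \<inter> live (out v) = {}"
      unfolding BB using dl[OF ic(1) v(1)] dl[OF ic(2) v(1)] dg abG v by blast+
    have dB: "B \<inter> live c3 = {}" "B' \<inter> live c3 = {}"
      unfolding BB using ic3 dl[of c3] abG by blast+
    have gv: "good (out v)" using G(2) v(1) by blast
    have cv: "live (out v) \<inter> live c3 = {}" using dl[of c3, OF _ v(1)] by blast
    have B: "block (B \<union> live c3 \<union> live (out v)) (out a) (out v)"
      using block_seg[of B "out a" u "live (out v)" v "out v" "live c3"] b(1) s block_good[OF gv] dv dB cv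
      by simp
    let ?O = "{out a, out b, out a', out b', out v}"
    have OG: "?O \<subseteq> G" using abG v(1) by blast
    have r: "region ?O \<inter> region (G - ?O) = {}" using region_disjoint[of ?O "G - ?O"] OG G(1) by blast
    have i1: "(B \<union> live c3 \<union> live (out v)) \<inter> B' = {}" using d dB(2) dv(2) by blast
    have i2: "(B \<union> live c3 \<union> live (out v)) \<inter> region (G - ?O) = {}" "B' \<inter> region (G - ?O) = {}"
      unfolding BB using r dG[OF ic(1), of "G - ?O"] dG[OF ic(2), of "G - ?O"] dG[of c3 "G - ?O"]
      by (auto simp: region_def)
    have "out a \<noteq> out v" using v(2) by auto
    from blocks_cycle[OF B this b(2,3) i1 _ i2] G(2)
    have "hcycle step (B \<union> live c3 \<union> live (out v) \<union> B' \<union> region (G - ?O))" by blast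
    moreover have "B \<union> live c3 \<union> live (out v) \<union> B' \<union> region (G - ?O) = region L"
    proof -
      have "live i \<union> live j = live c1 \<union> live c2" using ij by (auto simp: doubleton_eq_iff)
      then show ?thesis unfolding regL split[OF OG] BB by (auto simp: region_def)
    qed
    ultimately show ?thesis by simp
  qed
  have none: "hcycle step (region L)"
    if n: "out x \<notin> {out y1, out y2}" "out y \<notin> {out y1, out y2}"
  proof -
    let ?B3 = "live (out x) \<union> live c3 \<union> live (out y)"
    have b3: "block ?B3 (out x) (out y)" using 3 G(2) dl by (intro seg_block) auto
    have d: "?B1 \<inter> ?B3 = {}" "?B2 \<inter> ?B3 = {}"
    proof -
      have e: "live g \<inter> live h = {}" if "g \<in> {out x1, out y1, out x2, out y2}" "h \<in> {out x, out y}" for g h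
        using that oG on n by (intro dg) auto
      have c: "live c1 \<inter> live h = {}" "live c2 \<inter> live h = {}" if "h \<in> {out x, out y}" for h
        using that oG dl[of c1 h] dl[of c2 h] by auto
      have c': "live g \<inter> live c3 = {}" if "g \<in> {out x1, out y1, out x2, out y2}" for g
        using that oG dl[of c3 g] by auto
      show "?B1 \<inter> ?B3 = {}" "?B2 \<inter> ?B3 = {}"
        using e c c' dc by (simp_all add: Int_Un_distrib Int_Un_distrib2)
    qed
    have "?B2 \<inter> ?B3 = {}" by fact
    from block_merge[OF b2 2(2) b3 this] obtain l q where lq: "l \<noteq> q" "block (?B2 \<union> ?B3) l q" .
    let ?O = "{out x1, out y1, out x2, out y2, out x, out y}"
    have OG: "?O \<subseteq> G" using oG by blast
    have r: "region ?O \<inter> region (G - ?O) = {}" using region_disjoint[of ?O "G - ?O"] OG G(1) by blast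
    have i1: "?B1 \<inter> (?B2 \<union> ?B3) = {}" using b12 d by blast
    have i2: "?B1 \<inter> region (G - ?O) = {}" "(?B2 \<union> ?B3) \<inter> region (G - ?O) = {}"
      using r dG[of c1 "G - ?O"] dG[of c2 "G - ?O"] dG[of c3 "G - ?O"] by (auto simp: region_def)
    from blocks_cycle[OF b1 1(2) lq(2,1) i1 _ i2] G(2)
    have "hcycle step (?B1 \<union> (?B2 \<union> ?B3) \<union> region (G - ?O))" by blast
    moreover have "?B1 \<union> (?B2 \<union> ?B3) \<union> region (G - ?O) = region L"
      unfolding regL split[OF OG] by (auto simp: region_def)
    ultimately show ?thesis by simp
  qed
  note s3 = seg_sym[OF 3(1)]
  have first: "hcycle step (region L)"
    if s: "seg (live c3) u v" "out u = out y1" and v: "out v \<in> G" "out v \<noteq> out x1" "out v \<noteq> out x2"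
      "out v \<noteq> out y1" "out v \<noteq> out y2" for u v
    by (rule extend[OF s b1 b2 2(2) refl refl _ c(4) refl v(1)]) (use v b12 in auto)
  have second: "hcycle step (region L)"
    if s: "seg (live c3) u v" "out u = out y2" and v: "out v \<in> G" "out v \<noteq> out x1" "out v \<noteq> out x2"
      "out v \<noteq> out y1" "out v \<noteq> out y2" for u v
    by (rule extend[OF s b2 b1 1(2) refl refl _ c(4)[symmetric] _ v(1)]) (use v b12 in auto)
  consider "out x = out y1" "out y = out y2" | "out y = out y1" "out x = out y2"
    | "out x = out y1" "out y \<noteq> out y2" | "out y = out y1" "out x \<noteq> out y2"
    | "out x = out y2" "out y \<noteq> out y1" | "out y = out y2" "out x \<noteq> out y1"
    | "out x \<notin> {out y1, out y2}" "out y \<notin> {out y1, out y2}" by blast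
  then show ?thesis
  proof cases
    case 1 then show ?thesis using both[OF 3(1)] by blast
  next
    case 2 then show ?thesis using both[OF s3] by blast
  next
    case 3 then show ?thesis using first[of x y] \<open>seg (live c3) x y\<close> oG on \<open>out x \<noteq> out y\<close> by metis
  next
    case 4 then show ?thesis using first[of y x] s3 oG on \<open>out x \<noteq> out y\<close> by metis
  next
    case 5 then show ?thesis using second[of x y] \<open>seg (live c3) x y\<close> oG on \<open>out x \<noteq> out y\<close> by metis
  next
    case 6 then show ?thesis using second[of y x] s3 oG on \<open>out x \<noteq> out y\<close> by metis
  next
    case 7 then show ?thesis using none by blast
  qed
qed

end

context few_faults
begin

lemma cycle_from_connected:
  assumes "\<And>s t. s \<in> region L \<Longrightarrow> t \<in> region L \<Longrightarrow> s \<noteq> t \<Longrightarrow> hpath step (region L) s t"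
  shows "hcycle step (region L)"
proof -
  have "3 \<le> card L" using card_L m3 by simp
  then obtain j i where ij: "j \<in> L" "i \<in> L" "j \<noteq> i" "j \<noteq> - i" by (rule two_compatible)
  obtain x where x: "x \<in> live i" "out x = j" "exit x" using obtain_edge[OF ij(2,1,3,4)] by blast
  note c = exit_cross[OF x(3)]
  have cl: "cross x \<in> live j" using c(3) x(2) by simp
  have r: "x \<in> region L" "cross x \<in> region L" using x(1) cl ij unfolding region_def by blast+
  have "x \<noteq> cross x" using x(1) cl live_disjoint[OF ij(2,1)] ij(3) by auto
  then have h: "hpath step (region L) x (cross x)" using assms r by blast
  have "3 \<le> card (region L)" using card_region_large[OF order_refl ij(2)] .
  from hpath_imp_hcycle[OF h c(2) this] show ?thesis .
qed

section \<open>The induction step for Hamiltonian cycles\<close>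

lemma relax_one:
  assumes c: "c \<in> L" "load c = faults" and f: "faults + 1 = m" and e: "e \<in> M" "e \<inter> copy c = {v}"
  obtains x y where "seg (live c) x y" "inner v x" "inner v y" "out x \<noteq> out y" "out x \<noteq> out v" "out y \<noteq> out v"
proof -
  have t: "e \<in> touching c" "load c + 1 \<le> m" using e c(2) f unfolding touching_def by auto
  have cyc: "hcycle inner (live c \<union> {v})" using withdraw(1)[OF c(1) t] e(2) by simp
  obtain x y where xy: "x \<noteq> y" "hpath inner (live c \<union> {v} - {v}) x y" "inner v x" "inner v y"
    using hcycle_remove[OF symp_inner cyc, of v] by blast
  have E: "live c \<union> {v} - {v} = live c" using e unfolding live_def W_def by blast
  have vc: "v \<in> copy c" using e(2) by blast
  have l: "x \<in> live c" "y \<in> live c" using hpath_ends[OF xy(2)] E by simp_all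
  have sub: "live c \<subseteq> copy c" unfolding live_def by blast
  have "seg (live c) x y" unfolding seg_def
    using inner_hpath[OF c(1) sub xy(2)[unfolded E]] concentrated_exit_in[OF c(2,1)] l by blast
  moreover have "out x \<noteq> out y"
    using inner_two(1)[OF c(1) vc _ _ xy(1)] xy(3,4) unfolding inner_def by blast
  ultimately show thesis
    using that xy(3,4) inner_facts(2)[OF c(1) vc xy(3)] inner_facts(2)[OF c(1) vc xy(4)] by blast
qed

text \<open>
  Both copies are cut at the ends of the same faulty pair. The neighbours of \<open>v\<close> and of \<open>cross v\<close> lead to
  different copies, so that the two segments cannot close a chain prematurely.\<close>

lemma damaged_pair_cycle:
  assumes c: "c \<in> L" "c' \<in> L" "c \<noteq> c'" and l: "load c = faults" and f: "faults + 1 = m"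
    and G: "\<forall>g \<in> L - {c, c'}. good g"
    and e: "{v, cross v} \<in> M" "v \<in> copy c" "cross v \<in> copy c'" "out v = c'"
  shows "hcycle step (region L)"
proof -
  have dis: "copy c \<inter> copy c' = {}" using copy_disjoint[OF c] .
  have t1: "{v, cross v} \<inter> copy c = {v}" and t2: "{v, cross v} \<inter> copy c' = {cross v}"
    using e(2,3) dis by auto
  have oc: "out (cross v) = c" using cross_facts(5)[OF c(1) e(2)] .
  obtain x y where x: "seg (live c) x y" "inner v x" "inner v y" "out x \<noteq> out y" "out x \<noteq> c'" "out y \<noteq> c'"
    using relax_one[OF c(1) l f e(1) t1] e(4) by metis
  obtain x2 y2 where 2: "seg (live c') x2 y2" "out x2 \<noteq> out y2" "out x2 \<noteq> c" "out y2 \<noteq> c"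
    "out x2 \<noteq> out x" "out y2 \<noteq> out x"
  proof (cases "load c' = faults")
    case True
    obtain x2 y2 where 2: "seg (live c') x2 y2" "inner (cross v) x2" "inner (cross v) y2" "out x2 \<noteq> out y2"
      "out x2 \<noteq> c" "out y2 \<noteq> c"
      using relax_one[OF c(2) True f e(1) t2] oc by metis
    have "out x \<noteq> out w" if "inner (cross v) w" for w
      using inner_across[OF c(1) e(2)] x(2) that unfolding inner_def by blast
    then show ?thesis using that 2 by metis
  next
    case False
    then have "load c' + 2 \<le> m" using load_le_faults[of c'] f by linarith
    moreover have "card {c, out x} \<le> m - 1" using card_four(3)[of c "out x"] m3 by linarith
    ultimately obtain x2 y2 where "seg (live c') x2 y2" "out x2 \<noteq> out y2" "out x2 \<notin> {c, out x}"
      "out y2 \<notin> {c, out x}" using break_cycle_few[OF c(2)] by (metis finite.emptyI finite_insert)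
    then show ?thesis using that by simp
  qed
  have ne: "{out x, out y} \<noteq> {out x2, out y2}" using 2(5,6) by (auto simp: doubleton_eq_iff)
  show ?thesis
    by (rule close_two[OF c G x(1,4,5,6) 2(1-4) ne])
qed

lemma three_touched: 
  assumes "e \<in> M" "i \<in> L" "j \<in> L" "k \<in> L" "i \<noteq> j" "i \<noteq> k" "j \<noteq> k"
    "e \<inter> copy i \<noteq> {}" "e \<inter> copy j \<noteq> {}" "e \<inter> copy k \<noteq> {}"
  shows False
proof -
  have "{l \<in> {i, j, k}. e \<inter> copy l \<noteq> {}} = {i, j, k}" using assms(8-10) by blast
  then have "card {i, j, k} \<le> 2" using touch_at_most_two[OF assms(1), of "{i, j, k}"] assms(2-4) by simp
  then show False using assms(5-7) by simp
qed

text \<open>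
  Counting the faults leaves only one possibility: three symbols and two faults, each joining \<open>c\<close> to
  one of the two other copies.\<close>

lemma damaged_star_cycle:
  assumes c: "c \<in> L" "c1 \<in> L" "c2 \<in> L" "c \<noteq> c1" "c \<noteq> c2" "c1 \<noteq> c2" and l: "load c = faults" and f: "faults + 1 = m"
    and bad: "\<not> good c1" "\<not> good c2"
  shows "hcycle step (region L)"
proof -
  have noedge: "edges_in i = {}" if "i \<in> L" "i \<noteq> c" for i
  proof -
    have "False" if d: "d \<in> D" "d \<subseteq> copy i" for d
    proof -
      have "copy c \<inter> copy i = {}" using copy_disjoint[OF c(1) \<open>i \<in> L\<close>] \<open>i \<noteq> c\<close> by blast
      then have "d = {}" using concentrated_touch(2)[OF l d(1)] d(2) by blast
      then show False using D(2) d(1) by simp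
    qed
    then show ?thesis unfolding edges_in_def by blast
  qed
  have li: "load i = card (touching i)" if "i \<in> L" "i \<noteq> c" for i
    unfolding load_def using noedge[OF that] by simp
  have big: "m - 2 \<le> card (touching c1)" "m - 2 \<le> card (touching c2)"
    using bad li[OF c(2)] li[OF c(3)] c unfolding good_def by auto
  have tc: "e \<inter> copy c \<noteq> {}" if "e \<in> M" for e using concentrated_touch(1)[OF l that] .
  have dis: "touching c1 \<inter> touching c2 = {}"
    using three_touched[OF _ c(1,2,3,4,5,6) tc] unfolding touching_def by blast
  have fin: "finite (touching c1)" "finite (touching c2)" using finM unfolding touching_def by simp_all
  have "card (touching c1) + card (touching c2) = card (touching c1 \<union> touching c2)"
    using card_Un_disjoint[OF fin dis] by simp
  also have "\<dots> \<le> card M" using finM by (intro card_mono) (auto simp: touching_def)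
  finally have le: "card (touching c1) + card (touching c2) \<le> card M" .
  have cMD: "card M + card D + 1 = m" using f unfolding faults_def by simp
  have m: "m = 3" and ones: "card (touching c1) = 1" "card (touching c2) = 1" and "card M = 2" "card D = 0"
    using le cMD big m3 by linarith+
  then have D0: "D = {}" using D(1) by simp
  obtain e1 where e1: "touching c1 = {e1}" using ones(1) by (rule card_1_singletonE)
  obtain e2 where e2: "touching c2 = {e2}" using ones(2) by (rule card_1_singletonE)
  have eM: "e1 \<in> M" "e2 \<in> M" "e1 \<inter> copy c1 \<noteq> {}" "e2 \<inter> copy c2 \<noteq> {}"
    using e1 e2 unfolding touching_def by blast+
  have ne: "e1 \<noteq> e2" using e1 e2 dis by blast
  have "card {e1, e2} = card M" using ne \<open>card M = 2\<close> by simp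
  then have Me: "M = {e1, e2}" using eM(1,2) finM by (metis card_subset_eq empty_subsetI insert_subset)
  obtain v1 where v1: "v1 \<in> copy c" "cross v1 \<in> copy c1" "e1 = {v1, cross v1}" "out v1 = c1"
    using touch_two_across[OF eM(1) c(1,2,4) tc[OF eM(1)] eM(3)] .
  obtain v2 where v2: "v2 \<in> copy c" "cross v2 \<in> copy c2" "e2 = {v2, cross v2}" "out v2 = c2"
    using touch_two_across[OF eM(2) c(1,3,5) tc[OF eM(2)] eM(4)] .
  have ac: "all_cross" unfolding all_cross_def using D0 Me v1 v2 c(1) by blast
  have dd: "copy c \<inter> copy c1 = {}" "copy c \<inter> copy c2 = {}" "copy c1 \<inter> copy c2 = {}"
    using copy_disjoint c by blast+
  have "W = e1 \<union> e2" unfolding W_def by (subst Me) simp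
  then have We: "W = {v1, cross v1, v2, cross v2}" by (simp only: v1(3) v2(3)) blast
  have wc: "copy c \<inter> W = {v1, v2}" "copy c1 \<inter> W = {cross v1}" "copy c2 \<inter> W = {cross v2}"
    unfolding We using dd v1(1,2) v2(1,2) by blast+
  let ?G = "L - {c1, c2, c}"
  have G: "\<forall>g \<in> ?G. good g"
  proof
    fix g assume g: "g \<in> ?G"
    have "touching g = {}"
    proof (rule ccontr)
      assume "touching g \<noteq> {}"
      then obtain e where e: "e \<in> M" "e \<inter> copy g \<noteq> {}" unfolding touching_def by blast
      then have "e = e1 \<or> e = e2" using Me by blast
      then show False
        using three_touched[of e c c1 g] three_touched[of e c c2 g] tc[OF e(1)] e eM(3,4) c g by blast
    qed
    then show "good g" unfolding good_def using li[of g] g m by simp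
  qed
  interpret b: base "A - {\<bar>c\<bar>}" "c # z" v1
    using posset_copy card_rest[OF c(1)] v1(1) m by unfold_locales (auto simp: copy_def)
  have "v2 \<in> sperms (A - {\<bar>c\<bar>}) (c # z)" "out v2 \<noteq> out v1" using v2(1,4) v1(4) c(6) by (simp_all add: copy_def)
  then obtain x y where xy: "hpath (padj {} 3) (sperms (A - {\<bar>c\<bar>}) (c # z) - {v1, v2}) x y" "out x \<noteq> out y"
    "out x \<notin> {c1, c2}" "out y \<notin> {c1, c2}"
    using b.two_holes v1(4) v2(4) by metis
  have E: "sperms (A - {\<bar>c\<bar>}) (c # z) - {v1, v2} = live c"
    using wc(1) unfolding copy_def[symmetric] live_def by blast
  have "inner = padj {} 3" unfolding inner_def by (simp add: D0 m)
  then have h: "hpath inner (live c) x y" using xy(1) unfolding E by simp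
  have lc: "x \<in> live c" "y \<in> live c" using hpath_ends[OF h] by simp_all
  have sub: "live c \<subseteq> copy c" unfolding live_def by blast
  have s: "seg (live c) x y" unfolding seg_def
    using inner_hpath[OF c(1) sub h] all_cross_exit[OF ac c(1)] lc by blast
  have oG: "out x \<in> ?G" "out y \<in> ?G" using seg_live_outs[OF s lc c(1)] xy(3,4) by blast+
  have o1: "out (cross v1) = c" "out (cross v2) = c" using cross_facts(5)[OF c(1)] v1(1) v2(1) by blast+
  have p1: "pliable c1 ?G"
    by (rule pliableI[OF m c(2) v1(2) wc(2) noedge[OF c(2)]]) (use c o1 all_cross_exit[OF ac c(2)] in auto)
  have p2: "pliable c2 ?G"
    by (rule pliableI[OF m c(3) v2(2) wc(3) noedge[OF c(3)]]) (use c o1 all_cross_exit[OF ac c(3)] in auto)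
  show ?thesis
    by (rule three_damaged[OF m c(2,3,1,6) c(4)[symmetric] c(5)[symmetric] refl G s oG xy(2) p1 p2])
qed

lemma cross_faults_within:
  assumes T: "finite T" "T \<subseteq> L" and D0: "D = {}"
    and two: "\<And>e. e \<in> M \<Longrightarrow> card {i \<in> T. e \<inter> copy i \<noteq> {}} = 2"
  shows "all_cross" "\<And>i w. i \<in> T \<Longrightarrow> w \<in> copy i \<Longrightarrow> w \<in> W \<Longrightarrow> out w \<in> T - {i}"
proof -
  have ex: "\<exists>i \<in> T. \<exists>j \<in> T. \<exists>v. i \<noteq> j \<and> v \<in> copy i \<and> cross v \<in> copy j \<and> e = {v, cross v} \<and> out v = j"
    if e: "e \<in> M" for e
  proof -
    obtain i j where ij: "{i \<in> T. e \<inter> copy i \<noteq> {}} = {i, j}" "i \<noteq> j" using two[OF e] by (meson card_2_iff)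
    then have t: "i \<in> T" "j \<in> T" "e \<inter> copy i \<noteq> {}" "e \<inter> copy j \<noteq> {}" by blast+
    then have "i \<in> L" "j \<in> L" using T by blast+
    from touch_two_across[OF e this ij(2) t(3,4)] t ij(2) show ?thesis by metis
  qed
  show "all_cross" unfolding all_cross_def
  proof (intro conjI ballI D0)
    fix e assume "e \<in> M"
    then obtain i v where "i \<in> T" "v \<in> copy i" "e = {v, cross v}" using ex by blast
    then show "\<exists>i \<in> L. \<exists>v \<in> copy i. e = {v, cross v}" using T by blast
  qed
  fix k w assume k: "k \<in> T" "w \<in> copy k" "w \<in> W"
  then obtain e where e: "e \<in> M" "w \<in> e" unfolding W_def by blast
  obtain i j v where v: "i \<in> T" "j \<in> T" "i \<noteq> j" "v \<in> copy i" "cross v \<in> copy j" "e = {v, cross v}" "out v = j"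
    using ex[OF e(1)] by blast
  have L: "i \<in> L" "j \<in> L" "k \<in> L" using v k T by blast+
  consider "w = v" | "w = cross v" using e(2) v(6) by blast
  then show "out w \<in> T - {k}"
  proof cases
    case 1
    then have "k = i" using copyD(2)[OF L(3) k(2)] copyD(2)[OF L(1) v(4)] by simp
    then show ?thesis using 1 v by simp
  next
    case 2
    then have "k = j" using copyD(2)[OF L(3) k(2)] copyD(2)[OF L(2) v(5)] by simp
    moreover have "out w = i" using 2 cross_facts(5)[OF L(1) v(4)] by simp
    ultimately show ?thesis using v by simp
  qed
qed

lemma card_1_eq: "card S = 1 \<Longrightarrow> e \<in> S \<Longrightarrow> S = {e}"
  by (metis card_1_singletonE singletonD)

lemma sum_all_two:
  assumes "finite (N :: 'b set)" "\<And>e. e \<in> N \<Longrightarrow> f e \<le> (2 :: nat)" "2 * card N \<le> sum f N" "e \<in> N"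
  shows "f e = 2"
proof (rule ccontr)
  assume "f e \<noteq> 2"
  then have "f e < 2" using assms(2,4) by (metis le_neq_implies_less)
  then have "sum f N < (\<Sum>e \<in> N. 2)" using assms by (intro sum_strict_mono_ex1) auto
  then show False using assms(3) by simp
qed

lemma all_cross_pliable:
  assumes m: "m = 3" and ac: "all_cross" and c: "c \<in> L" "load c = 1" and G: "G \<subseteq> L - {c}"
    and w: "\<And>w. w \<in> copy c \<Longrightarrow> w \<in> W \<Longrightarrow> out w \<notin> G"
  shows "pliable c G"
proof -
  obtain w where w': "w \<in> copy c" "copy c \<inter> W = {w}" using all_cross_load_one[OF ac c] .
  have e: "edges_in c = {}" using ac unfolding all_cross_def edges_in_def by simp
  have "out w \<notin> G" using w w' by blast
  then show ?thesis
    using pliableI[OF m c(1) w' e G] all_cross_exit[OF ac c(1)] by blast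
qed

text \<open>
  A fault touches at most two copies, whereas each damaged copy is touched by all faults but one. Double counting
  leaves only the cases \<open>m = 3\<close> and \<open>m = 4\<close> and determines the faults in them almost completely.\<close>

lemma many_damaged_cycle:
  assumes f: "faults + 1 = m" and T: "T = {i \<in> L. \<not> good i}" "3 \<le> card T"
    and l: "\<And>i. i \<in> T \<Longrightarrow> load i + 2 = m"
  shows "hcycle step (region L)"
proof -
  have finT: "finite T" and TL: "T \<subseteq> L" using T(1) finite_L by auto
  have good: "\<And>g. g \<in> L \<Longrightarrow> g \<notin> T \<Longrightarrow> good g" using T(1) by blast
  let ?n = "\<lambda>e. card {i \<in> T. e \<inter> copy i \<noteq> {}}" and ?k = "\<lambda>d. card {i \<in> T. d \<subseteq> copy i}"
  have n2: "?n e \<le> 2" if "e \<in> M" for e using touch_at_most_two[OF that TL finT] .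
  have k1: "?k d \<le> 1" if "d \<in> D" for d using edge_at_most_one[OF that TL finT] .
  have sn: "sum ?n M \<le> 2 * card M" using sum_bounded_above[of M ?n 2] n2 by (simp add: mult.commute)
  have sk: "sum ?k D \<le> card D" using sum_bounded_above[of D ?k 1] k1 by simp
  have "load i = m - 2" if "i \<in> T" for i using l[OF that] by simp
  then have "(\<Sum>i \<in> T. load i) = (\<Sum>i \<in> T. m - 2)" by (rule sum.cong[OF refl])
  then have s: "card T * (m - 2) = sum ?n M + sum ?k D" using load_sum[OF finT TL] by simp
  have cMD: "card M + card D + 1 = m" using f unfolding faults_def by simp
  have "3 * (m - 2) \<le> card T * (m - 2)" using T(2) by (rule mult_le_mono1)
  then have "3 * (m - 2) \<le> 2 * card M + card D" using s sn sk by linarith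
  then have "m = 3 \<or> m = 4" using cMD m3 by linarith
  then show ?thesis
  proof
    assume m: "m = 4"
    then have t2: "card T * 2 = sum ?n M + sum ?k D" using s by simp
    have "card T = 3" "card D = 0" "2 * card M \<le> sum ?n M" using t2 sn sk cMD m T(2) by linarith+
    then have D0: "D = {}" using D(1) by simp
    have two: "?n e = 2" if "e \<in> M" for e
      by (rule sum_all_two[of M ?n, OF finM _ \<open>2 * card M \<le> sum ?n M\<close> that]) (rule n2)
    have ac: "all_cross" by (rule cross_faults_within(1)[OF finT TL D0]) (rule two)
    have acT: "out w \<in> T - {i}" if "i \<in> T" "w \<in> copy i" "w \<in> W" for i w
      by (rule cross_faults_within(2)[OF finT TL D0 _ that]) (rule two)
    obtain c1 c2 c3 where c: "T = {c1, c2, c3}" "c1 \<noteq> c2" "c1 \<noteq> c3" "c2 \<noteq> c3"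
      using \<open>card T = 3\<close> by (auto simp: card_3_iff)
    have cL: "c1 \<in> L" "c2 \<in> L" "c3 \<in> L" using TL c(1) by blast+
    have ll: "load c1 = 2" "load c2 = 2" "load c3 = 2" using l[of c1] l[of c2] l[of c3] c(1) m by simp_all
    have "\<forall>g \<in> L - {c1, c2, c3}. good g" using good c(1) by blast
    then show ?thesis
      by (rule triangle_cycle[OF m ac cL c(2-4) ll refl]) (use acT c(1) in blast)
  next
    assume m: "m = 3"
    then have t: "card T = sum ?n M + sum ?k D" using s by simp
    have l1: "load i = 1" if "i \<in> T" for i using l[OF that] m by simp
    consider "card T = 4" | "card T = 3" using t sn sk cMD m T(2) by linarith
    then show ?thesis
    proof cases
      case 1
      have "card D = 0" "2 * card M \<le> sum ?n M" using 1 t sn sk cMD m by linarith+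
      then have D0: "D = {}" using D(1) by simp
      have two: "?n e = 2" if "e \<in> M" for e
        by (rule sum_all_two[of M ?n, OF finM _ \<open>2 * card M \<le> sum ?n M\<close> that]) (rule n2)
      have ac: "all_cross" by (rule cross_faults_within(1)[OF finT TL D0]) (rule two)
      have acT: "out w \<in> T - {i}" if "i \<in> T" "w \<in> copy i" "w \<in> W" for i w
        by (rule cross_faults_within(2)[OF finT TL D0 _ that]) (rule two)
      have p: "pliable c (L - T)" if "c \<in> T" for c
      proof (rule all_cross_pliable[OF m ac _ l1[OF that]])
        show "c \<in> L" "L - T \<subseteq> L - {c}" using that TL by blast+
        show "out w \<notin> L - T" if "w \<in> copy c" "w \<in> W" for w using acT[OF \<open>c \<in> T\<close> that] by blast
      qed
      obtain xs where xs: "set xs = T" "distinct xs" using finite_distinct_list[OF finT] by blast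
      then have "length xs = 4" using 1 distinct_card by metis
      then obtain c1 c2 c3 c4 where x: "xs = [c1, c2, c3, c4]"
        by (auto simp: eval_nat_numeral length_Suc_conv)
      have Tc: "T = {c1, c2, c3, c4}" using xs(1) x by auto
      have cL: "c1 \<in> L" "c2 \<in> L" "c3 \<in> L" "c4 \<in> L" using TL Tc by blast+
      show ?thesis
        by (rule four_damaged[OF m cL xs(2)[unfolded x], of "L - T"]) (use Tc good p in auto)
    next
      case 2
      have "\<exists>e \<in> M. ?n e = 2"
      proof (rule ccontr)
        assume "\<not> (\<exists>e \<in> M. ?n e = 2)"
        then have "?n e \<le> 1" if "e \<in> M" for e using n2[OF that] that by force
        then have "sum ?n M \<le> card M" using sum_bounded_above[of M ?n 1] by simp
        then show False using 2 t sk cMD m by linarith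
      qed
      then obtain e where e: "e \<in> M" "?n e = 2" by blast
      obtain c1 c2 where c12: "{i \<in> T. e \<inter> copy i \<noteq> {}} = {c1, c2}" "c1 \<noteq> c2" using e(2) by (meson card_2_iff)
      then have cT: "c1 \<in> T" "c2 \<in> T" "e \<inter> copy c1 \<noteq> {}" "e \<inter> copy c2 \<noteq> {}" by blast+
      have "card (T - {c1, c2}) = 1" using 2 cT(1,2) c12(2) finT by simp
      then obtain c3 where c3: "T - {c1, c2} = {c3}" by (rule card_1_singletonE)
      then have c3T: "c3 \<in> T" "c3 \<noteq> c1" "c3 \<noteq> c2" "T = {c1, c2, c3}" using cT by blast+
      have cL: "c1 \<in> L" "c2 \<in> L" "c3 \<in> L" using TL cT c3T by blast+
      have ne3: "e \<inter> copy c3 = {}"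
        using three_touched[OF e(1) cL c12(2) c3T(2)[symmetric] c3T(3)[symmetric] cT(3,4)] by blast
      obtain v where v: "v \<in> copy c1" "cross v \<in> copy c2" "e = {v, cross v}" "out v = c2"
        using touch_two_across[OF e(1) cL(1,2) c12(2) cT(3,4)] .
      have single: "touching i = {e}" "edges_in i = {}" if i: "i \<in> {c1, c2}" for i
      proof -
        have ei: "e \<in> touching i" using i e(1) cT(3,4) unfolding touching_def by blast
        have fin: "finite (touching i)" "finite (edges_in i)"
          using finM D(1) unfolding touching_def edges_in_def by simp_all
        have "1 \<le> card (touching i)" using ei fin(1) by (metis One_nat_def Suc_leI card_gt_0_iff empty_iff)
        moreover have "card (touching i) + card (edges_in i) = 1" using l1[of i] i cT unfolding load_def by auto
        ultimately have "card (touching i) = 1" "card (edges_in i) = 0" by linarith+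
        then show "touching i = {e}" "edges_in i = {}" using card_1_eq[OF _ ei] fin by simp_all
      qed
      have Wi: "copy i \<inter> W = e \<inter> copy i" if "i \<in> {c1, c2}" for i
        using single(1)[OF that] unfolding touching_def W_def by blast
      have dis: "copy c1 \<inter> copy c2 = {}" using copy_disjoint[OF cL(1,2) c12(2)] .
      have w1: "copy c1 \<inter> W = {v}" using Wi[of c1] v dis by auto
      have w2: "copy c2 \<inter> W = {cross v}" using Wi[of c2] v dis by auto
      let ?G = "L - {c1, c2, c3}"
      have G: "\<forall>g \<in> ?G. good g" using good c3T(4) by blast
      have ex: "exit x" if x: "x \<in> live i" "out x \<in> ?G" and i: "i \<in> {c1, c2}" for x i
      proof -
        have iL: "i \<in> L" using i cL by blast
        have xc: "x \<in> copy i" using liveD(1)[OF x(1)] .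
        have cx: "cross x \<in> copy (out x)" using cross_facts(4)[OF iL xc] .
        have "load (out x) = 0" using G x(2) m unfolding good_def by auto
        then have "card (touching (out x)) = 0" unfolding load_def by simp
        then have "touching (out x) = {}" using finM unfolding touching_def by simp
        then have "cross x \<notin> W" using cx unfolding W_def touching_def by blast
        moreover have "{x, cross x} \<notin> D"
        proof
          assume d: "{x, cross x} \<in> D"
          have "1 \<le> card M" "1 \<le> card D"
            using e(1) d finM D(1) by (metis One_nat_def Suc_leI card_gt_0_iff empty_iff)+
          then have "card M = 1" "card D = 1" using cMD m by linarith+
          then have "M = {e}" "D = {{x, cross x}}" using card_1_eq[OF _ e(1)] card_1_eq[OF _ d] by blast+
          then have "touching c3 = {}" "edges_in c3 \<subseteq> {{x, cross x}}"
            using ne3 unfolding touching_def edges_in_def by blast+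
          moreover have "edges_in c3 \<noteq> {}"
          proof
            assume "edges_in c3 = {}"
            then show False using l1[OF c3T(1)] \<open>touching c3 = {}\<close> unfolding load_def by simp
          qed
          ultimately have "{x, cross x} \<subseteq> copy c3" unfolding edges_in_def by blast
          then show False using xc copy_disjoint[OF iL cL(3)] i c3T(2,3) by auto
        qed
        ultimately show ?thesis unfolding exit_def free_def using x(1) iL by blast
      qed
      have oc: "out (cross v) = c1" using cross_facts(5)[OF cL(1) v(1)] .
      have p1: "pliable c1 ?G"
        by (rule pliableI[OF m cL(1) v(1) w1 single(2)]) (use v(4) ex[of _ c1] in auto)
      have p2: "pliable c2 ?G"
        by (rule pliableI[OF m cL(2) v(2) w2 single(2)]) (use oc ex[of _ c2] in auto)
      have "load c3 + 2 \<le> m" "card {c1, c2} \<le> m - 1" using l1[OF c3T(1)] m card_four(3)[of c1 c2] by simp_all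
      then obtain x y where xy: "seg (live c3) x y" "x \<in> live c3" "y \<in> live c3" "out x \<noteq> out y"
        "out x \<notin> {c1, c2}" "out y \<notin> {c1, c2}"
        using break_cycle_few[OF cL(3)] by (metis finite.emptyI finite_insert)
      have oG: "out x \<in> ?G" "out y \<in> ?G" using seg_live_outs[OF xy(1-3) cL(3)] xy(5,6) by blast+
      show ?thesis
        by (rule three_damaged[OF m cL c12(2) c3T(2)[symmetric] c3T(3)[symmetric] refl G xy(1) oG xy(4) p1 p2])
    qed
  qed
qed

theorem cycle_step: "hcycle step (region L)"
proof (cases "faults + 2 \<le> m")
  case True
  then show ?thesis using cycle_from_connected connected_step by blast
next
  case False
  then have f: "faults + 1 = m" using few by linarith
  show ?thesis
  proof (cases "\<exists>c \<in> L. load c = faults")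
    case True
    then obtain c where c: "c \<in> L" "load c = faults" by blast
    show ?thesis
    proof (cases "\<forall>g \<in> L - {c}. good g")
      case True
      then show ?thesis using concentrated_cycle[OF c f] by blast
    next
      case False
      then obtain c1 where c1: "c1 \<in> L" "c1 \<noteq> c" "\<not> good c1" by blast
      show ?thesis
      proof (cases "\<forall>g \<in> L - {c, c1}. good g")
        case True
        have "load c1 \<noteq> 0" using c1 m3 unfolding good_def by auto
        moreover have "edges_in c1 = {}"
        proof -
          have "False" if d: "d \<in> D" "d \<subseteq> copy c1" for d
          proof -
            have "copy c \<inter> copy c1 = {}" using copy_disjoint[OF c(1) c1(1)] c1(2) by blast
            then have "d = {}" using concentrated_touch(2)[OF c(2) d(1)] d(2) by blast
            then show False using D(2) d(1) by simp
          qed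
          then show ?thesis unfolding edges_in_def by blast
        qed
        ultimately have "touching c1 \<noteq> {}" unfolding load_def by auto
        then obtain e where e: "e \<in> M" "e \<inter> copy c1 \<noteq> {}" unfolding touching_def by blast
        obtain v where "v \<in> copy c" "cross v \<in> copy c1" "e = {v, cross v}" "out v = c1"
          using touch_two_across[OF e(1) c(1) c1(1) c1(2)[symmetric] concentrated_touch(1)[OF c(2) e(1)] e(2)] .
        then show ?thesis using damaged_pair_cycle[OF c(1) c1(1) c1(2)[symmetric] c(2) f True] e(1) by blast
      next
        case False
        then obtain c2 where "c2 \<in> L" "c2 \<noteq> c" "c2 \<noteq> c1" "\<not> good c2" by blast
        then show ?thesis using damaged_star_cycle[OF c(1) c1(1) _ c1(2)[symmetric] _ _ c(2) f c1(3)] by metis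
      qed
    qed
  next
    case False
    then have l: "load i + 2 \<le> m" if "i \<in> L" for i using load_le_faults[of i] f that by (metis Suc_leI
          add.commute add_Suc_right le_neq_implies_less nat_1_add_1 plus_1_eq_Suc add_le_mono1 Suc_eq_plus1 add_2_eq_Suc')
    let ?T = "{i \<in> L. \<not> good i}"
    have finT: "finite ?T" using finite_L by simp
    consider "card ?T = 0" | "card ?T = 1" | "card ?T = 2" | "3 \<le> card ?T" by linarith
    then show ?thesis
    proof cases
      case 1
      then have "\<forall>g \<in> L. good g" using finT by auto
      then show ?thesis using cycle_from_connected region_connected by simp
    next
      case 2
      then obtain c where c: "?T = {c}" by (rule card_1_singletonE)
      then have cL: "c \<in> L" and G: "\<forall>g \<in> L - {c}. good g" by blast+
      have "card ({} :: int set) \<le> m - 1" by simp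
      then obtain x y where "seg (live c) x y" "out x \<noteq> out y"
        using break_cycle_few[OF cL l[OF cL] finite.emptyI] by metis
      then show ?thesis using close_lone[OF cL G] by metis
    next
      case 3
      then obtain c c' where c: "?T = {c, c'}" "c \<noteq> c'" by (meson card_2_iff)
      then have cL: "c \<in> L" "c' \<in> L" and G: "\<forall>g \<in> L - {c, c'}. good g" by blast+
      have "card {c'} \<le> m - 1" using m3 by simp
      then obtain x1 y1 where 1: "seg (live c) x1 y1" "out x1 \<noteq> out y1" "out x1 \<notin> {c'}" "out y1 \<notin> {c'}"
        using break_cycle_few[OF cL(1) l[OF cL(1)]] by (metis finite.emptyI finite_insert)
      have "card {c, out x1} \<le> m - 1" using m3 card_four(3)[of c "out x1"] by linarith
      then obtain x2 y2 where 2: "seg (live c') x2 y2" "out x2 \<noteq> out y2" "out x2 \<notin> {c, out x1}"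
        "out y2 \<notin> {c, out x1}"
        using break_cycle_few[OF cL(2) l[OF cL(2)]] by (metis finite.emptyI finite_insert)
      have ne: "{out x1, out y1} \<noteq> {out x2, out y2}" using 2(3,4) by (simp add: doubleton_eq_iff)
      show ?thesis
        by (rule close_two[OF cL c(2) G 1(1,2) _ _ 2(1,2) _ _ ne]) (use 1 2 in auto)
    next
      case 4
      have "load i + 2 = m" if "i \<in> ?T" for i
        using l[of i] that unfolding good_def by auto
      then show ?thesis using many_damaged_cycle[OF f refl 4] by blast
    qed
  qed
qed

end

theorem fault_tolerant_sperms:
  assumes "posset A" "3 \<le> card A"
  shows "fault_tolerant A z"
proof -
  obtain k where "card A = k + 3" using assms(2) by (metis le_add_diff_inverse2)
  with assms(1) show ?thesis
  proof (induction k arbitrary: A z)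
    case 0
    then show ?case using fault_tolerant_base by simp
  next
    case (Suc k A z)
    let ?m = "k + 3"
    have cA: "card A = Suc ?m" using Suc.prems(2) by simp
    have IH: "fault_tolerant (A - {\<bar>i\<bar>}) (i # z)" if "i \<in> labels A" for i z
    proof (rule Suc.IH[OF posset_remove[OF Suc.prems(1)]])
      show "card (A - {\<bar>i\<bar>}) = k + 3"
        using that cA Suc.prems(1) by (simp add: labels_iff posset_finite)
    qed
    have step: "few_faults A z ?m M D"
      if "fault_family A z M" "finite D" "{} \<notin> D" "card M + card D < ?m" for M D
    proof -
      interpret c: copies A z ?m M D
        using Suc.prems(1) cA that IH by unfold_locales auto
      show ?thesis using that(4) by unfold_locales (simp add: c.faults_def)
    qed
    have cyc: "hcycle (padj D (card A)) (sperms A z - \<Union>M)"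
      if MD: "fault_family A z M" "finite D" "{} \<notin> D" and le: "card M + card D + 2 \<le> card A" for M D
    proof -
      have "card M + card D < ?m" using le cA by simp
      then interpret f: few_faults A z ?m M D using step MD by blast
      have "f.region f.L = sperms A z - \<Union>M"
        unfolding f.region_def f.live_def f.W_def f.sperms_eq by blast
      then show ?thesis using f.cycle_step unfolding f.step_def cA by simp
    qed
    have con: "hpath (padj D (card A)) (sperms A z - \<Union>M) x y"
      if MD: "fault_family A z M" "finite D" "{} \<notin> D" and le: "card M + card D + 3 \<le> card A"
        and xy: "x \<in> sperms A z - \<Union>M" "y \<in> sperms A z - \<Union>M" "x \<noteq> y" for M D x y
    proof -
      have "card M + card D < ?m" using le cA by simp
      then interpret f: few_faults A z ?m M D using step MD by blast
      have E: "f.region f.L = sperms A z - \<Union>M"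
        unfolding f.region_def f.live_def f.W_def f.sperms_eq by blast
      have "f.faults + 2 \<le> ?m" using le cA by (simp add: f.faults_def)
      from f.connected_step[OF this, of x y] xy show ?thesis unfolding E f.step_def cA by simp
    qed
    show ?case unfolding fault_tolerant_def by (intro allI impI conjI ballI) 
      (blast intro: cyc con)+
  qed
qed

section \<open>Burnt pancake graphs\<close>

lemma signed_perms_eq: "signed_perms n = sperms {1..int n} []"
  unfolding signed_perms_def sperms_def permutations_of_set_def by auto

lemma posset_interval: "posset {1..int n}" "card {1..int n} = n"
  by (simp_all add: posset_def)

lemma verts_burnt_pancake: "verts (burnt_pancake_graph n) = sperms {1..int n} []"
  by (simp add: burnt_pancake_graph_def signed_perms_eq)

lemma edges_burnt_pancake:
  "edges (burnt_pancake_graph n) = {{u, spr k u} |u k. u \<in> sperms {1..int n} [] \<and> k \<in> {1..n}}"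
  by (simp add: burnt_pancake_graph_def signed_perms_eq)

lemma remove_faults_verts: "verts (remove_faults G M D) = verts G - \<Union>M"
  by (simp add: remove_faults_def delete_edges_def delete_verts_def)

lemma remove_faults_edges: "edges (remove_faults G M D) = {e \<in> edges G. e \<inter> \<Union>M = {}} - D"
  by (simp add: remove_faults_def delete_edges_def delete_verts_def)

lemma hamiltonian_cycle_iff:
  "(\<exists>xs. hamiltonian_cycle G xs) \<longleftrightarrow> hcycle (\<lambda>x y. {x, y} \<in> edges G) (verts G)"
  unfolding hamiltonian_cycle_def hcycle_def by blast

lemma hamiltonian_path_iff:
  "(\<exists>xs. hamiltonian_path G u xs v) \<longleftrightarrow> hpath (\<lambda>x y. {x, y} \<in> edges G) (verts G) u v"
  unfolding hamiltonian_path_def hpath_def by blast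

lemma hybrid_fault_family:
  assumes "hybrid_fault_set (burnt_pancake_graph n) M D"
  shows "fault_family {1..int n} [] M" "finite D" "{} \<notin> D"
proof -
  have M: "M \<subseteq> edges (burnt_pancake_graph n)" "pairwise disjnt M" "finite M" and D: "finite D"
    "D \<subseteq> edges (burnt_pancake_graph n)"
    using assms unfolding hybrid_fault_set_def is_matching_def delete_verts_def by auto
  show "finite D" by fact
  show "{} \<notin> D" using D(2) unfolding edges_burnt_pancake by blast
  show "fault_family {1..int n} [] M"
    unfolding fault_family_def posset_interval(2)
  proof (intro conjI ballI M)
    fix e assume "e \<in> M"
    then obtain u k where "u \<in> sperms {1..int n} []" "k \<in> {1..n}" "e = {u, spr k u}"
      using M(1) unfolding edges_burnt_pancake by blast
    then show "\<exists>v \<in> sperms {1..int n} []. e = {v} \<or> (\<exists>k \<in> {1..n}. e = {v, spr k v})" by blast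
  qed
qed

lemma padj_edge:
  assumes "x \<in> sperms {1..int n} [] - \<Union>M" "y \<in> sperms {1..int n} [] - \<Union>M" "padj D n x y"
  shows "{x, y} \<in> edges (remove_faults (burnt_pancake_graph n) M D)"
proof -
  obtain k where "k \<in> {1..n}" "y = spr k x" "{x, y} \<notin> D" using assms(3) unfolding padj_def by blast
  then show ?thesis using assms(1,2) unfolding remove_faults_edges edges_burnt_pancake by blast
qed

lemma burnt_pancake_hybrid_hamiltonian:
  assumes "3 \<le> n"
  shows "hybrid_fault_hamiltonian (n - 2) (burnt_pancake_graph n)"
  unfolding hybrid_fault_hamiltonian_def hamiltonian_cycle_iff
proof (intro allI impI)
  fix M D
  assume a: "hybrid_fault_set (burnt_pancake_graph n) M D \<and> card M + card D \<le> n - 2"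
  note f = hybrid_fault_family[OF conjunct1[OF a]]
  have "fault_tolerant {1..int n} []" using fault_tolerant_sperms posset_interval assms by simp
  moreover have "card M + card D + 2 \<le> n" using conjunct2[OF a] assms by linarith
  ultimately have "hcycle (padj D n) (sperms {1..int n} [] - \<Union>M)"
    using fault_tolerantD(1)[OF _ f] posset_interval(2) by metis
  then show "hcycle (\<lambda>x y. {x, y} \<in> edges (remove_faults (burnt_pancake_graph n) M D))
      (verts (remove_faults (burnt_pancake_graph n) M D))"
    unfolding remove_faults_verts verts_burnt_pancake by (rule hcycle_mono) (rule padj_edge)
qed

lemma burnt_pancake_hybrid_hamiltonian_connected:
  assumes "3 \<le> n"
  shows "hybrid_fault_hamiltonian_connected (n - 3) (burnt_pancake_graph n)"
  unfolding hybrid_fault_hamiltonian_connected_def hamiltonian_connected_def hamiltonian_path_iff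
proof (intro allI impI ballI)
  fix M D u v
  assume a: "hybrid_fault_set (burnt_pancake_graph n) M D \<and> card M + card D \<le> n - 3"
    and uv: "u \<in> verts (remove_faults (burnt_pancake_graph n) M D)"
      "v \<in> verts (remove_faults (burnt_pancake_graph n) M D)" "u \<noteq> v"
  note f = hybrid_fault_family[OF conjunct1[OF a]]
  have "fault_tolerant {1..int n} []" using fault_tolerant_sperms posset_interval assms by simp
  moreover have "card M + card D + 3 \<le> n" using conjunct2[OF a] assms by linarith
  ultimately have "hpath (padj D n) (sperms {1..int n} [] - \<Union>M) u v"
    using fault_tolerantD(2)[OF _ f, of u v] uv posset_interval(2)
    unfolding remove_faults_verts verts_burnt_pancake by metis
  then show "hpath (\<lambda>x y. {x, y} \<in> edges (remove_faults (burnt_pancake_graph n) M D))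
      (verts (remove_faults (burnt_pancake_graph n) M D)) u v"
    unfolding remove_faults_verts verts_burnt_pancake by (rule hpath_mono) (rule padj_edge)
qed

text \<open>
  The extremal faults: all edges at \<open>v\<close> but the \<open>l - 1\<close> shortest reversals. With one edge left there is no
  Hamiltonian cycle; with two edges left, a Hamiltonian path between the two remaining neighbours could not
  contain \<open>v\<close> and any further vertex.\<close>

lemma edges_at_vertex_hybrid:
  assumes v: "v \<in> sperms {1..int n} []" and l: "1 \<le> l"
  defines "D \<equiv> (\<lambda>k. {v, spr k v}) ` {l..n}"
  shows "hybrid_fault_set (burnt_pancake_graph n) {} D" "card D \<le> Suc n - l"
    "{v, x} \<in> edges (remove_faults (burnt_pancake_graph n) {} D) \<Longrightarrow> x \<in> (\<lambda>k. spr k v) ` {1..<l}"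
proof -
  have "D \<subseteq> edges (burnt_pancake_graph n)"
    unfolding D_def edges_burnt_pancake
  proof (rule image_subsetI)
    fix k assume "k \<in> {l..n}"
    then have "k \<in> {1..n}" using l by simp
    then show "{v, spr k v} \<in> {{u, spr k u} |u k. u \<in> sperms {1..int n} [] \<and> k \<in> {1..n}}"
      using v by blast
  qed
  moreover have "finite D" unfolding D_def by simp
  ultimately show "hybrid_fault_set (burnt_pancake_graph n) {} D"
    unfolding hybrid_fault_set_def is_matching_def delete_verts_def by simp
  show "card D \<le> Suc n - l" unfolding D_def using card_image_le[of "{l..n}"] by simp
  assume "{v, x} \<in> edges (remove_faults (burnt_pancake_graph n) {} D)"
  then have e: "{v, x} \<in> edges (burnt_pancake_graph n)" "{v, x} \<notin> D"
    unfolding remove_faults_edges by auto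
  from e(1) obtain k where k: "k \<in> {1..n}" "x = spr k v"
    using burnt_pancake_graph_adjacent_iff v unfolding signed_perms_eq by blast
  then have "k < l" using e(2) unfolding D_def by (metis atLeastAtMost_iff image_eqI not_le)
  then show "x \<in> (\<lambda>k. spr k v) ` {1..<l}" using k by auto
qed

lemma sperms_interval_card: "3 \<le> n \<Longrightarrow> 4 \<le> card (sperms {1..int n} [])"
proof -
  assume n: "3 \<le> n"
  have "card (sperms {1..int n} []) = 2 ^ n * fact n"
    using card_sperms[OF posset_interval(1), of n "[]"] posset_interval(2) by simp
  moreover have "(2::nat) ^ 2 * 1 \<le> 2 ^ n * fact n"
    using n by (intro mult_le_mono power_increasing) (auto simp: fact_ge_1)
  ultimately show ?thesis by simp
qed

lemma symp_doubleton: "symp (\<lambda>x y. {x, y} \<in> E)"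
  by (rule sympI) (simp add: insert_commute)

lemma not_hybrid_hamiltonian:
  assumes "3 \<le> n"
  shows "\<not> hybrid_fault_hamiltonian (n - 1) (burnt_pancake_graph n)"
proof
  assume h: "hybrid_fault_hamiltonian (n - 1) (burnt_pancake_graph n)"
  obtain v where v: "v \<in> sperms {1..int n} []" using sperms_interval_card[OF assms] by fastforce
  let ?D = "(\<lambda>k. {v, spr k v}) ` {2..n}" and ?G = "burnt_pancake_graph n"
  note e = edges_at_vertex_hybrid[OF v, of 2]
  have "card {} + card ?D \<le> n - 1" using e(2) by simp
  then have "hcycle (\<lambda>x y. {x, y} \<in> edges (remove_faults ?G {} ?D)) (verts (remove_faults ?G {} ?D))"
    using h e(1) unfolding hybrid_fault_hamiltonian_def hamiltonian_cycle_iff by simp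
  moreover have "v \<in> verts (remove_faults ?G {} ?D)"
    using v by (simp add: remove_faults_verts verts_burnt_pancake)
  ultimately obtain x y where "x \<noteq> y" "{v, x} \<in> edges (remove_faults ?G {} ?D)"
    "{v, y} \<in> edges (remove_faults ?G {} ?D)"
    using hcycle_remove[OF symp_doubleton] by metis
  moreover have "{1..<2::nat} = {1}" by auto
  ultimately show False using e(3)[of x] e(3)[of y] by simp
qed

lemma not_hybrid_hamiltonian_connected:
  assumes "3 \<le> n"
  shows "\<not> hybrid_fault_hamiltonian_connected (n - 2) (burnt_pancake_graph n)"
proof
  assume h: "hybrid_fault_hamiltonian_connected (n - 2) (burnt_pancake_graph n)"
  obtain v where v: "v \<in> sperms {1..int n} []" using sperms_interval_card[OF assms] by fastforce
  let ?D = "(\<lambda>k. {v, spr k v}) ` {3..n}" and ?G = "burnt_pancake_graph n"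
  let ?r = "\<lambda>x y. {x, y} \<in> edges (remove_faults ?G {} ?D)" and ?S = "sperms {1..int n} []"
  let ?s = "spr 1 v" and ?t = "spr 2 v"
  have "1 \<le> (3 :: nat)" by simp
  note e = edges_at_vertex_hybrid[OF v this]
  have S: "verts (remove_faults ?G {} ?D) = ?S" by (simp add: remove_faults_verts verts_burnt_pancake)
  have st: "?s \<in> ?S" "?t \<in> ?S" using spr_sperms[OF posset_interval(1) v] posset_interval(2) assms by simp_all
  have vst: "?s \<noteq> v" "?t \<noteq> v" using spr_neq[OF posset_interval(1) v] posset_interval(2) assms by simp_all
  have len: "length v = n" using length_sperms[OF posset_interval(1) v] posset_interval(2) by simp
  have "\<bar>v ! 0\<bar> \<noteq> \<bar>v ! 1\<bar>" using sperms_nth_neq[OF posset_interval(1) v, of 0 1] posset_interval(2) assms by simp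
  then have "out ?s \<noteq> out ?t" using out_spr[of 1 v] out_spr[of 2 v] len assms by auto
  then have ne: "?s \<noteq> ?t" by auto
  have "card {} + card ?D \<le> n - 2" using e(2) assms by simp
  then have "hamiltonian_connected (remove_faults ?G {} ?D)"
    using h e(1) unfolding hybrid_fault_hamiltonian_connected_def by blast
  then have p: "hpath ?r ?S ?s ?t"
    using st ne unfolding hamiltonian_connected_def hamiltonian_path_iff S by blast
  obtain S1 S2 x y where b: "S1 \<union> S2 = ?S - {v}" "S1 \<inter> S2 = {}" "hpath ?r S1 ?s x" "hpath ?r S2 y ?t"
    "{x, v} \<in> edges (remove_faults ?G {} ?D)" "{v, y} \<in> edges (remove_faults ?G {} ?D)"
    using hpath_remove_inner[OF p v vst(1)[symmetric] vst(2)[symmetric]] by blast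
  have m: "x \<in> S1" "?s \<in> S1" "y \<in> S2" "?t \<in> S2"
    using hpath_ends[OF b(3)] hpath_ends[OF b(4)] by simp_all
  have "{1..<3::nat} = {1, 2}" by auto
  then have "x \<in> {?s, ?t}" "y \<in> {?s, ?t}"
    using e(3)[of x] e(3)[of y] b(5,6) by (simp_all add: insert_commute)
  then have "x = ?s" "y = ?t" using m b(2) by blast+
  then have "S1 = {?s}" "S2 = {?t}"
    using hpath_same[OF b(3)[unfolded \<open>x = ?s\<close>]] hpath_same[OF b(4)[unfolded \<open>y = ?t\<close>]] by simp_all
  then have "?S = {v, ?s, ?t}" using b(1) v by blast
  then have "card ?S \<le> 3" by (simp add: card_insert_if)
  then show False using sperms_interval_card[OF assms] by simp
qed

theorem theorem3p6:
  fixes n :: nat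
  assumes "3 \<le> n"
  shows "hybrid_fault_hamiltonian (n - 2) (burnt_pancake_graph n)
    \<and> hybrid_fault_hamiltonian_connected (n - 3) (burnt_pancake_graph n)
    \<and> \<not> hybrid_fault_hamiltonian (n - 1) (burnt_pancake_graph n)
    \<and> \<not> hybrid_fault_hamiltonian_connected (n - 2) (burnt_pancake_graph n)"
  using burnt_pancake_hybrid_hamiltonian[OF assms] burnt_pancake_hybrid_hamiltonian_connected[OF assms]
    not_hybrid_hamiltonian[OF assms] not_hybrid_hamiltonian_connected[OF assms] by blast

end
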